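(* Let $G\subseteq GL(V)$ be a finite group acting on $V=\mathbb{F}^n$, and fix $0\le k\le n$. For a set $\mathcal B$ of $n\binom{n}{k}$ homogeneous elements of $(S\otimes \wedge^k V^*\otimes V)^G$, the following are equivalent: (a) $(S\otimes \wedge^k V^*\otimes V)^G$ is a free $S^G$-module with basis $\mathcal B$; (b) $\det \mathrm{Coef}(\mathcal B)\doteq Q^{\binom{n-1}{k}}\, Q_{\det}^{(n-1)\binom{n-1}{k-1}}\, Q_k$; (c) $\mathcal B$ is linearly independent over $\mathcal F(S)$ and $\sum_{\eta\in\mathcal B}\deg\eta=\sum_{H\in\mathcal A}\Big(\binom{n-1}{k}+(e_H-1)(n-1)\binom{n-1}{k-1}+e_H\, a_{H,k}\Big)$.
   Context: $\mathbb{F}$ is a field of arbitrary characteristic, $V=\mathbb{F}^n$ ($n\ge 1$) with basis $v_1,\dots,v_n$ and dual basis $x_1,\dots,x_n$ of $V^*$; $S=S(V^* )=\mathbb{F}[x_1,\dots,x_n]$ graded by polynomial degree, $\mathcal F(S)$ its fraction field. $G$ acts on $V^*$ by the contragredient action and on $S$ by graded algebra automorphisms; on $S\otimes M$ (tensor over $\mathbb{F}$, $M$ an $\mathbb{F}G$-module) $G$ acts diagonally, $S$ acts on the first factor, and $(S\otimes M)^G$ denotes invariants, an $S^G$-module. Elements of $S_i\otimes M$ have polynomial degree $i$ ($\deg$). For $I=\{i_1<\dots<i_k\}\subseteq[n]$, $x_I=x_{i_1}\wedge\dots\wedge x_{i_k}$. The coefficient matrix $\mathrm{Coef}(\mathcal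 B)$ of elements $\eta\in\mathcal B$ is the matrix of their coefficients $f$ in $S$ when written as $\eta=\sum f_{I,j}\otimes x_I\otimes v_j$ (basis $x_I\otimes v_j$ of $\wedge^kV^*\otimes V$); its determinant is defined up to sign. $a\doteq b$ means $a=cb$ for some $c\in\mathbb{F}^\times$. A reflection is a non-identity element of $GL(V)$ fixing a hyperplane pointwise; a transvection is a non-diagonalizable reflection. $\mathcal A$ is the set of hyperplanes $H\subset V$ that are fixed pointwise by some reflection in $G$; for each $H$ fix $\ell_H\in V^*$ with $\ker\ell_H=H$. $G_H$ is the pointwise stabilizer of $H$ in $G$. $e_H$ is the maximal order of a diagonalizable reflection in $G$ fixing $H$ (and $e_H=1$ if there is none). For a reflection $s$ about $H$, its root vector $v_s$ is defined by $s(v)=v+\ell_H(v)v_s$ for all $v$; $b_H$ is the dimension of the span of the root vectors of the transvections in $G$ about $H$. $\delta_H=1$ if $G_H$ consists of exactly the identity and one transvection, and $\delta_H=0$ otherwise. $Q=\prod_{H\in\mathcal A}\ell_H$, $Q_{\det}=\prod_{H\in\mathcal A}\ell_H^{e_H-1}$, $a_{H,k}=(n-\delta_H)\big(\binom{n-1}{k}-\binom{n-b_H-1}{k}\big)+\binom{n-1}{k-1}-\binom{n-b_H-1}{k-1}$ with $\binom{a}{b}=0$ when $a<b$ or $b<0$, and $Q_k=\prod_{H\in\mathcal A}\ell_H^{e_H a_{H,k}}$. *)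

theory Defs
  imports
    "HOL-Library.Poly_Mapping"
    "HOL-Computational_Algebra.Normalized_Fraction"
    "HOL-Algebra.Multiplicative_Group"
    "Jordan_Normal_Form.Determinant"
    "HOL-Analysis.Analysis"
begin

no_notation vec_index (infixl "$" 100)

text \<open>
  The index type \<open>'n\<close> is an arbitrary nonempty finite linearly ordered type; \<open>CARD('n)\<close> is the
  dimension \<open>n\<close>, and the order is the order of the basis \<open>v\<^sub>1, \<dots>, v\<^sub>n\<close>.  The space \<open>V\<close> is
  \<open>'a ^ 'n\<close> with \<open>v\<^sub>i = axis i 1\<close>.  Linear forms are also written as elements of \<open>'a ^ 'n\<close>, namely
  by their coordinates in the dual basis, so that \<open>x\<^sub>i\<close> is again \<open>axis i 1\<close> and the pairing of
  \<open>V\<^sup>*\<close> with \<open>V\<close> is \<open>scalar_product\<close>.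
\<close>

type_synonym ('a, 'n) space = "('a, 'n) Finite_Cartesian_Product.vec"
type_synonym ('a, 'n) sqmat = "(('a, 'n) space, 'n) Finite_Cartesian_Product.vec"

section \<open>The general linear group and reflections\<close>

definition GL :: "('a::field, 'n::finite) sqmat monoid" where
  "GL = \<lparr>carrier = {A. invertible A}, monoid.mult = (**), monoid.one = Finite_Cartesian_Product.mat 1\<rparr>"

lemma group_GL: "group (GL :: ('a::field, 'n::finite) sqmat monoid)"
proof (rule groupI)
  fix A :: "('a, 'n) sqmat"
  assume "A \<in> carrier GL"
  then have "invertible A" by (simp add: GL_def)
  then obtain B where "A ** B = Finite_Cartesian_Product.mat 1"
    "B ** A = Finite_Cartesian_Product.mat 1"
    unfolding invertible_def by blast
  then show "\<exists>y\<in>carrier GL. y \<otimes>\<^bsub>GL\<^esub> A = \<one>\<^bsub>GL\<^esub>"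
    by (intro bexI[of _ B]) (auto simp: GL_def invertible_def)
next
  fix A B :: "('a, 'n) sqmat"
  assume "A \<in> carrier GL" "B \<in> carrier GL"
  then show "A \<otimes>\<^bsub>GL\<^esub> B \<in> carrier GL"
    by (simp add: GL_def invertible_mult)
qed (auto simp: GL_def matrix_mul_assoc invertible_def)

definition hyperplane :: "('a::field, 'n::finite) space set \<Rightarrow> bool" where
  "hyperplane H \<longleftrightarrow> vec.subspace H \<and> vec.dim H = CARD('n) - 1"

definition reflection_about :: "('a::field, 'n::finite) space set \<Rightarrow> ('a, 'n) sqmat \<Rightarrow> bool" where
  "reflection_about H s \<longleftrightarrow> hyperplane H \<and> invertible s \<and>
     s \<noteq> Finite_Cartesian_Product.mat 1 \<and> (\<forall>v\<in>H. s *v v = v)"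

definition diagonalizable :: "('a::field, 'n::finite) sqmat \<Rightarrow> bool" where
  "diagonalizable A \<longleftrightarrow> (\<exists>(P :: ('a, 'n) sqmat) (D :: ('a, 'n) sqmat).
     invertible P \<and> (\<forall>i j. i \<noteq> j \<longrightarrow> D $ i $ j = 0) \<and> A = P ** D ** matrix_inv P)"

definition transvection_about :: "('a::field, 'n::finite) space set \<Rightarrow> ('a, 'n) sqmat \<Rightarrow> bool" where
  "transvection_about H s \<longleftrightarrow> reflection_about H s \<and> \<not> diagonalizable s"

definition reflection_arrangement ::
  "('a::field, 'n::finite) sqmat set \<Rightarrow> ('a, 'n) space set set" where
  "reflection_arrangement G = {H. \<exists>s\<in>G. reflection_about H s}"

definition pointwise_stabilizer ::
  "('a::field, 'n::finite) sqmat set \<Rightarrow> ('a, 'n) space set \<Rightarrow> ('a, 'n) sqmat set" where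
  "pointwise_stabilizer G H = {g\<in>G. \<forall>v\<in>H. g *v v = v}"

definition e_diag :: "('a::field, 'n::finite) sqmat set \<Rightarrow> ('a, 'n) space set \<Rightarrow> nat" where
  "e_diag G H = (if \<exists>s\<in>G. reflection_about H s \<and> diagonalizable s
     then Max {group.ord GL s | s. s \<in> G \<and> reflection_about H s \<and> diagonalizable s}
     else 1)"

text \<open>\<open>l\<close> is the chosen linear form with kernel \<open>H\<close>.\<close>

definition root_vector :: "('a::field, 'n::finite) space \<Rightarrow> ('a, 'n) sqmat \<Rightarrow> ('a, 'n) space" where
  "root_vector l s = (THE u. \<forall>v. s *v v = v + scalar_product l v *s u)"

definition b_root ::
  "('a::field, 'n::finite) sqmat set \<Rightarrow> ('a, 'n) space \<Rightarrow> ('a, 'n) space set \<Rightarrow> nat" where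
  "b_root G l H = vec.dim (vec.span {root_vector l s | s. s \<in> G \<and> transvection_about H s})"

definition delta :: "('a::field, 'n::finite) sqmat set \<Rightarrow> ('a, 'n) space set \<Rightarrow> nat" where
  "delta G H = (if \<exists>t. transvection_about H t \<and>
       pointwise_stabilizer G H = {Finite_Cartesian_Product.mat 1, t} then 1 else 0)"

text \<open>The binomial coefficient with integer arguments, zero if \<open>a < b\<close> or \<open>b < 0\<close>.\<close>

definition binom :: "int \<Rightarrow> int \<Rightarrow> nat" where
  "binom a b = (if a < b \<or> b < 0 then 0 else nat a choose nat b)"

text \<open>
  By this monotonicity, and because \<open>delta G H \<le> 1 \<le> n\<close>, the subtractions of natural numbers
  in \<open>a_exp\<close> below are never truncated.
\<close>

lemma binom_mono: "a \<le> a' \<Longrightarrow> binom a b \<le> binom a' b"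
  by (auto simp: binom_def intro!: binomial_right_mono)

definition a_exp ::
  "('a::field, 'n::finite) sqmat set \<Rightarrow> ('a, 'n) space \<Rightarrow> ('a, 'n) space set \<Rightarrow> nat \<Rightarrow> nat" where
  "a_exp G l H k = (let n = int CARD('n); b = int (b_root G l H) in
     (CARD('n) - delta G H) * (binom (n - 1) (int k) - binom (n - b - 1) (int k))
     + (binom (n - 1) (int k - 1) - binom (n - b - 1) (int k - 1)))"

section \<open>The polynomial ring\<close>

type_synonym ('a, 'n) pol = "('n \<Rightarrow>\<^sub>0 nat) \<Rightarrow>\<^sub>0 'a"

definition const :: "'a::field \<Rightarrow> ('a, 'n) pol" where
  "const c = Poly_Mapping.single 0 c"

definition var :: "'n \<Rightarrow> ('a::field, 'n) pol" where
  "var i = Poly_Mapping.single (Poly_Mapping.single i 1) 1"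

definition lin_form :: "('a::field, 'n::finite) space \<Rightarrow> ('a, 'n) pol" where
  "lin_form l = (\<Sum>i\<in>UNIV. const (l $ i) * var i)"

definition homogeneous_pol :: "nat \<Rightarrow> ('a::field, 'n::finite) pol \<Rightarrow> bool" where
  "homogeneous_pol d f \<longleftrightarrow> (\<forall>m\<in>Poly_Mapping.keys f. (\<Sum>i\<in>UNIV. Poly_Mapping.lookup m i) = d)"

text \<open>The contragredient action \<open>(g l)(v) = l (g\<^sup>-\<^sup>1 v)\<close>.\<close>

definition dual_act :: "('a::field, 'n::finite) sqmat \<Rightarrow> ('a, 'n) space \<Rightarrow> ('a, 'n) space" where
  "dual_act g l = l v* matrix_inv g"

lemma dual_act_apply: "scalar_product (dual_act g l) v = scalar_product l (matrix_inv g *v v)"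
proof -
  have "(\<Sum>i\<in>UNIV. (\<Sum>j\<in>UNIV. l $ j * matrix_inv g $ j $ i) * v $ i) =
        (\<Sum>j\<in>UNIV. l $ j * (\<Sum>i\<in>UNIV. matrix_inv g $ j $ i * v $ i))"
    unfolding sum_distrib_left sum_distrib_right
    by (subst sum.swap) (simp add: mult.assoc)
  then show ?thesis
    by (simp add: dual_act_def scalar_product_def vector_matrix_mult_def matrix_vector_mult_def
        mult.commute)
qed

text \<open>The action on polynomials substitutes \<open>g x\<^sub>i\<close> for \<open>x\<^sub>i\<close>.\<close>

definition pol_act :: "('a::field, 'n::finite) sqmat \<Rightarrow> ('a, 'n) pol \<Rightarrow> ('a, 'n) pol" where
  "pol_act g f = (\<Sum>m\<in>Poly_Mapping.keys f. const (Poly_Mapping.lookup f m) *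
     (\<Prod>i\<in>UNIV. lin_form (dual_act g (axis i 1)) ^ Poly_Mapping.lookup m i))"

lemma pol_act_var: "pol_act g (var i) = lin_form (dual_act g (axis i 1))"
proof -
  have "(\<Prod>j\<in>UNIV. lin_form (dual_act g (axis j 1)) ^
          Poly_Mapping.lookup (Poly_Mapping.single i 1) j) =
        (\<Prod>j\<in>UNIV. if j = i then lin_form (dual_act g (axis i 1)) else 1)"
    by (intro prod.cong) (auto simp: lookup_single when_def)
  then show ?thesis
    by (simp add: pol_act_def var_def const_def)
qed

definition invariant_ring :: "('a::field, 'n::finite) sqmat set \<Rightarrow> ('a, 'n) pol set" where
  "invariant_ring G = {f. \<forall>g\<in>G. pol_act g f = f}"

section \<open>The exterior algebra of the dual space\<close>

text \<open>
  An element of the exterior algebra of \<open>V\<^sup>*\<close> is given by its coordinates in the basis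
  \<open>x\<^sub>I = axis I 1\<close>, \<open>I \<subseteq> [n]\<close>.  For disjoint \<open>I\<close> and \<open>J\<close> the product of \<open>x\<^sub>I\<close> and \<open>x\<^sub>J\<close> is
  \<open>shuffle_sign I J\<close> times \<open>x\<^bsub>I \<union> J\<^esub>\<close>, otherwise it is zero.
\<close>

type_synonym ('a, 'n) ext = "('a, 'n set) space"

definition shuffle_sign :: "'n::{finite, linorder} set \<Rightarrow> 'n set \<Rightarrow> 'a::field" where
  "shuffle_sign I J = (-1) ^ card {(i, j). i \<in> I \<and> j \<in> J \<and> j < i}"

definition wedge ::
  "('a::field, 'n::{finite, linorder}) ext \<Rightarrow> ('a, 'n) ext \<Rightarrow> ('a, 'n) ext" where
  "wedge \<omega> \<tau> = (\<chi> K. \<Sum>I\<in>Pow K. shuffle_sign I (K - I) * \<omega> $ I * \<tau> $ (K - I))"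

definition one_form :: "('a::field, 'n::{finite, linorder}) space \<Rightarrow> ('a, 'n) ext" where
  "one_form l = (\<Sum>i\<in>UNIV. (l $ i) *s axis {i} 1)"

text \<open>\<open>wedge_family l {i\<^sub>1 < \<dots> < i\<^sub>k}\<close> is the product of \<open>l i\<^sub>1, \<dots>, l i\<^sub>k\<close> in this order.\<close>

definition wedge_family ::
  "('n::{finite, linorder} \<Rightarrow> ('a::field, 'n) space) \<Rightarrow> 'n set \<Rightarrow> ('a, 'n) ext" where
  "wedge_family l I =
     foldr (\<lambda>i \<omega>. wedge (one_form (l i)) \<omega>) (sorted_list_of_set I) (axis {} 1)"

lemma one_form_axis: "one_form (axis i 1) = axis {i} 1"
  unfolding one_form_def by (simp add: axis_def if_distrib[of "\<lambda>c. c *s _"] cong: if_cong)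

lemma wedge_axis:
  assumes "\<And>j. j \<in> J \<Longrightarrow> i < j"
  shows "wedge (axis {i} 1) (axis J 1) = axis (insert i J) (1::'a::field)"
proof -
  have iJ: "i \<notin> J" using assms by blast
  have "{(a, b). a \<in> {i} \<and> b \<in> J \<and> b < a} = {}" using assms by fastforce
  then have *: "shuffle_sign {i} J = (1::'a)" by (simp only: shuffle_sign_def) simp
  have "(\<Sum>I\<in>Pow K. shuffle_sign I (K - I) * axis {i} 1 $ I * axis J 1 $ (K - I)) =
        axis (insert i J) (1::'a) $ K" for K
  proof -
    have "(\<Sum>I\<in>Pow K. shuffle_sign I (K - I) * axis {i} (1::'a) $ I * axis J 1 $ (K - I)) =
          (\<Sum>I\<in>Pow K. if I = {i} then (if K - {i} = J then shuffle_sign {i} J else 0) else 0)"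
      by (intro sum.cong) (auto simp: axis_def)
    also have "\<dots> = (if i \<in> K \<and> K - {i} = J then shuffle_sign {i} J else 0)"
      by simp
    also have "\<dots> = axis (insert i J) (1::'a) $ K"
      using iJ * by (auto simp: axis_def)
    finally show ?thesis .
  qed
  then show ?thesis by (simp add: wedge_def vec_eq_iff)
qed

lemma wedge_family_axis: "wedge_family (\<lambda>i. axis i 1) I = axis I (1::'a::field)"
proof -
  have "foldr (\<lambda>i \<omega>. wedge (one_form (axis i 1)) \<omega>) xs (axis {} 1) = axis (set xs) (1::'a)"
    if "sorted_wrt (<) xs" for xs :: "'n::{finite, linorder} list"
    using that by (induction xs) (auto simp: one_form_axis wedge_axis)
  from this[of "sorted_list_of_set I"] show ?thesis
    by (simp add: wedge_family_def)
qed

section \<open>Differential derivations\<close>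

text \<open>
  An element of \<open>S \<otimes> \<Lambda>V\<^sup>* \<otimes> V\<close> is given by its coefficients \<open>f\<^bsub>I,j\<^esub>\<close> in the \<open>S\<close>-basis
  \<open>x\<^sub>I \<otimes> v\<^sub>j\<close>; the component \<open>S \<otimes> \<Lambda>\<^sup>kV\<^sup>* \<otimes> V\<close> consists of the elements with \<open>f\<^bsub>I,j\<^esub> = 0\<close> unless
  \<open>I\<close> has \<open>k\<close> elements.
\<close>

type_synonym ('a, 'n) sext = "(('a, 'n) pol, 'n set \<times> 'n) space"

definition basis_index :: "nat \<Rightarrow> ('n::finite set \<times> 'n) set" where
  "basis_index k = {I. card I = k} \<times> UNIV"

definition S_ext_V :: "nat \<Rightarrow> ('a::field, 'n::finite) sext set" where
  "S_ext_V k = {\<eta>. \<forall>p. p \<notin> basis_index k \<longrightarrow> \<eta> $ p = 0}"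

definition pure_tensor ::
  "('a::field, 'n::finite) pol \<Rightarrow> ('a, 'n) ext \<Rightarrow> ('a, 'n) space \<Rightarrow> ('a, 'n) sext" where
  "pure_tensor f \<omega> v = (\<chi> p. f * const (\<omega> $ fst p) * const (v $ snd p))"

text \<open>
  The diagonal action: \<open>g (f \<otimes> x\<^sub>I \<otimes> v\<^sub>j) = g f \<otimes> (g x\<^bsub>i\<^sub>1\<^esub> \<and> \<dots> \<and> g x\<^bsub>i\<^sub>k\<^esub>) \<otimes> g v\<^sub>j\<close>.
\<close>

definition sext_act ::
  "('a::field, 'n::{finite, linorder}) sqmat \<Rightarrow> ('a, 'n) sext \<Rightarrow> ('a, 'n) sext" where
  "sext_act g \<eta> = (\<Sum>(I, j)\<in>UNIV. pure_tensor (pol_act g (\<eta> $ (I, j)))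
     (wedge_family (\<lambda>i. dual_act g (axis i 1)) I) (g *v axis j 1))"

definition invariants ::
  "('a::field, 'n::{finite, linorder}) sqmat set \<Rightarrow> nat \<Rightarrow> ('a, 'n) sext set" where
  "invariants G k = {\<eta> \<in> S_ext_V k. \<forall>g\<in>G. sext_act g \<eta> = \<eta>}"

definition homogeneous :: "nat \<Rightarrow> ('a::field, 'n::finite) sext \<Rightarrow> bool" where
  "homogeneous d \<eta> \<longleftrightarrow> (\<forall>p. homogeneous_pol d (\<eta> $ p))"

text \<open>The degree is only used for homogeneous elements; the zero element gets degree 0.\<close>

definition pol_degree :: "('a::field, 'n::finite) sext \<Rightarrow> nat" where
  "pol_degree \<eta> = (LEAST d. homogeneous d \<eta>)"

text \<open>
  \<open>B\<close> is a basis of \<open>M\<close> as a module over the subring \<open>R\<close> of the ambient polynomial ring.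
\<close>

definition free_basis ::
  "'r::comm_ring_1 set \<Rightarrow> ('r ^ 'm::finite) set \<Rightarrow> ('r ^ 'm) set \<Rightarrow> bool" where
  "free_basis R M B \<longleftrightarrow> B \<subseteq> M \<and>
     (\<forall>\<eta>\<in>M. \<exists>T c. finite T \<and> T \<subseteq> B \<and> (\<forall>\<beta>\<in>T. c \<beta> \<in> R) \<and> \<eta> = (\<Sum>\<beta>\<in>T. c \<beta> *s \<beta>)) \<and>
     (\<forall>T c. finite T \<and> T \<subseteq> B \<and> (\<forall>\<beta>\<in>T. c \<beta> \<in> R) \<and> (\<Sum>\<beta>\<in>T. c \<beta> *s \<beta>) = 0
        \<longrightarrow> (\<forall>\<beta>\<in>T. c \<beta> = 0))"

definition coef_mat ::
  "('a::field, 'n::finite) sext list \<Rightarrow> ('n set \<times> 'n) list \<Rightarrow> ('a, 'n) pol Matrix.mat" where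
  "coef_mat bs ps = Matrix.mat (length bs) (length ps) (\<lambda>(r, c). (bs ! r) $ (ps ! c))"

definition eq_upto_unit :: "('a::field, 'n) pol \<Rightarrow> ('a, 'n) pol \<Rightarrow> bool" (infix "\<doteq>" 50) where
  "f \<doteq> h \<longleftrightarrow> (\<exists>c. c \<noteq> 0 \<and> f = const c * h)"

text \<open>
  This map is injective, so a set of elements and its image have the same linear relations over
  the fraction field.
\<close>

definition to_fract_vec ::
  "('a::field, 'n::{finite, linorder}) sext \<Rightarrow> (('a, 'n) pol fract, 'n set \<times> 'n) space" where
  "to_fract_vec \<eta> = (\<chi> p. to_fract (\<eta> $ p))"

section \<open>The polynomials attached to the reflection arrangement\<close>

text \<open>\<open>ell\<close> assigns to each hyperplane of the arrangement the chosen linear form.\<close>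

definition Q :: "('a::field, 'n::{finite, linorder}) sqmat set \<Rightarrow>
    (('a, 'n) space set \<Rightarrow> ('a, 'n) space) \<Rightarrow> ('a, 'n) pol" where
  "Q G ell = (\<Prod>H\<in>reflection_arrangement G. lin_form (ell H))"

definition Q_det :: "('a::field, 'n::{finite, linorder}) sqmat set \<Rightarrow>
    (('a, 'n) space set \<Rightarrow> ('a, 'n) space) \<Rightarrow> ('a, 'n) pol" where
  "Q_det G ell = (\<Prod>H\<in>reflection_arrangement G. lin_form (ell H) ^ (e_diag G H - 1))"

definition Q_exp :: "('a::field, 'n::{finite, linorder}) sqmat set \<Rightarrow>
    (('a, 'n) space set \<Rightarrow> ('a, 'n) space) \<Rightarrow> nat \<Rightarrow> ('a, 'n) pol" where
  "Q_exp G ell k =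
     (\<Prod>H\<in>reflection_arrangement G. lin_form (ell H) ^ (e_diag G H * a_exp G (ell H) H k))"

end

theory Submission
  imports Defs
begin

text \<open>
  For a hyperplane \<open>H = ker l\<close> the invariants of its pointwise stabilizer \<open>G\<^sub>H\<close> have an explicit
  \<open>S\<close>-spanning family whose coefficient determinant is \<open>l\<^sup>c\<close> up to a unit, where \<open>c\<close> is the
  exponent of \<open>l\<close> in the right-hand side \<open>D\<close> of (b): in coordinates adapted to \<open>H\<close> the group \<open>G\<^sub>H\<close>
  is generated by one diagonal reflection and by transvections.  Every \<open>G\<close>-invariant is
  \<open>G\<^sub>H\<close>-invariant, so \<open>D\<close> divides the determinant of any family of invariants.  Cramer's rule then
  turns (b) into (a), and a comparison of degrees gives the equivalence of (b) and (c).

  For (a) implies (b), let \<open>\<Delta>\<close> be the determinant of a basis.  A \<open>G\<^sub>H\<close>-invariant times a suitable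
  \<open>u\<close> is an \<open>S\<close>-combination of \<open>G\<close>-invariants obtained as relative transfers, and \<open>u\<close> can be chosen
  prime to \<open>l\<close>.  Hence \<open>\<Delta>\<close> divides \<open>u\<^sup>N l\<^sup>c\<close>, which bounds the multiplicity of \<open>l\<close> in \<open>\<Delta>\<close>.  The same
  argument with the trivial group in place of \<open>G\<^sub>H\<close> shows that all prime factors of \<open>\<Delta>\<close> are linear.
\<close>

section \<open>Polynomials\<close>

text \<open>The exponents of the linear forms come from leading coefficients. Over the stabilizer of
  \<open>H\<close> the basis elements are sorted into four layers such that the first nonzero layer
  of an invariant consists of semi-invariants. Transvections force a factor \<open>x_z\<close> or
  \<open>x_z^2\<close> into some of these, where \<open>x_z\<close> is the form of \<open>H\<close>.
  The diagonal reflection admits exact exponents in a single residue class modulo \<open>e_H\<close>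
  only, which raises the factor to the final power. The square is the delicate part. It stems from a
  congruence modulo \<open>x_z^2\<close> between a quadratic and a linear expression in the root
  vector. Separating the two takes a second root vector. If the stabilizer consists of one
  transvection and the identity there is none, and the exponent really drops by one, as a special
  invariant shows: this is the origin of \<open>\<delta>_H\<close>.\<close>

definition eval_pol :: "('a::field \<Rightarrow> 'r::comm_ring_1) \<Rightarrow> ('n::finite \<Rightarrow> 'r) \<Rightarrow> ('a, 'n) pol \<Rightarrow> 'r" where
  "eval_pol \<kappa> y f = (\<Sum>m\<in>Poly_Mapping.keys f. \<kappa> (Poly_Mapping.lookup f m) * (\<Prod>i\<in>UNIV. y i ^ Poly_Mapping.lookup m i))"

lemma pol_sum_singles: "f = (\<Sum>m\<in>Poly_Mapping.keys f. Poly_Mapping.single m (Poly_Mapping.lookup f m))"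
proof (rule poly_mapping_eqI)
  fix k
  have "Poly_Mapping.lookup (\<Sum>m\<in>Poly_Mapping.keys f. Poly_Mapping.single m (Poly_Mapping.lookup f m)) k
     = (\<Sum>m\<in>Poly_Mapping.keys f. if m = k then Poly_Mapping.lookup f k else 0)"
    by (auto simp: lookup_sum lookup_single when_def intro!: sum.cong)
  then show "Poly_Mapping.lookup f k = Poly_Mapping.lookup (\<Sum>m\<in>Poly_Mapping.keys f. Poly_Mapping.single m (Poly_Mapping.lookup f m)) k"
    by (simp add: in_keys_iff)
qed

lemma pol_single_conv:
  fixes m :: "'n::finite \<Rightarrow>\<^sub>0 nat" and c :: "'a::field"
  shows "Poly_Mapping.single m c = const c * (\<Prod>i\<in>UNIV. var i ^ Poly_Mapping.lookup m i)"
proof -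
  have pow: "Poly_Mapping.single s (1::'a) ^ k = Poly_Mapping.single (\<Sum>j<k. s) 1" for s :: "'n \<Rightarrow>\<^sub>0 nat" and k
    by (induction k) (auto simp: mult_single add.commute)
  have s: "(\<Sum>j<k. Poly_Mapping.single i (1::nat)) = Poly_Mapping.single i k" for k and i :: 'n
    by (induction k) (auto simp flip: single_add)
  have prod: "(\<Prod>i\<in>A. Poly_Mapping.single (w i) (1::'a)) = Poly_Mapping.single (\<Sum>i\<in>A. w i) 1"
    if "finite A" for A :: "'n set" and w :: "'n \<Rightarrow> ('n \<Rightarrow>\<^sub>0 nat)"
    using that by (induction A) (auto simp: mult_single)
  have m: "(\<Sum>i\<in>UNIV. Poly_Mapping.single i (Poly_Mapping.lookup m i)) = m"
    by (rule poly_mapping_eqI) (simp add: lookup_sum lookup_single when_def)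
  show ?thesis
    unfolding var_def pow s prod[OF finite] m by (simp add: const_def mult_single)
qed

lemma const_0 [simp]: "const 0 = 0" and const_1 [simp]: "const 1 = 1"
  and const_add: "const (a + b) = const a + const b"
  and const_mult: "const (a * b) = const a * const b"
  and const_minus: "const (- a) = - const a"
  by (simp_all add: const_def single_add mult_single single_uminus)

lemma const_eq_iff [simp]: "const a = const b \<longleftrightarrow> a = b"
  unfolding const_def by (metis lookup_single_eq)

lemma const_eq_0_iff [simp]: "const a = 0 \<longleftrightarrow> a = 0"
  using const_eq_iff[of a 0] by (simp del: const_eq_iff)

interpretation const_hom: comm_ring_hom "const :: 'a::field \<Rightarrow> ('a, 'n) pol"
  by unfold_locales (simp_all add: const_add const_mult)

lemma const_diff: "const (a - b) = const a - const b" by (rule const_hom.hom_minus)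

text \<open>Identities between ring homomorphisms and congruences modulo a linear form pass to sums
  and products, so they only have to be checked on constants and variables.\<close>

lemma pol_induct [case_names const var add mult]:
  fixes f :: "('a::field, 'n::finite) pol"
  assumes c: "\<And>c. P (const c)" and v: "\<And>i. P (var i)"
    and a: "\<And>f g. P f \<Longrightarrow> P g \<Longrightarrow> P (f + g)" and m: "\<And>f g. P f \<Longrightarrow> P g \<Longrightarrow> P (f * g)"
  shows "P f"
proof -
  have p: "P (var i ^ k)" for i k
    by (induction k) (use c[of 1] v m in auto)
  have "P (\<Prod>i\<in>A. var i ^ h i)" if "finite A" for A and h :: "'n \<Rightarrow> nat"
    using that by (induction A) (use c[of 1] p m in auto)
  then have s: "P (Poly_Mapping.single s x)" for s x
    unfolding pol_single_conv by (intro m c) auto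
  have "P (\<Sum>m\<in>A. Poly_Mapping.single m (Poly_Mapping.lookup f m))" if "finite A" for A
    using that by (induction A) (use c[of 0] s a in auto)
  then show ?thesis by (subst pol_sum_singles) simp
qed

lemma eval_pol_superset:
  assumes "comm_ring_hom \<kappa>" "finite A" "Poly_Mapping.keys f \<subseteq> A"
  shows "eval_pol \<kappa> y f = (\<Sum>m\<in>A. \<kappa> (Poly_Mapping.lookup f m) * (\<Prod>i\<in>UNIV. y i ^ Poly_Mapping.lookup m i))"
proof -
  interpret comm_ring_hom \<kappa> by fact
  show ?thesis unfolding eval_pol_def
    by (rule sum.mono_neutral_left) (use assms in \<open>auto simp: in_keys_iff\<close>)
qed

lemma comm_ring_hom_eval_pol:
  assumes h: "comm_ring_hom (\<kappa> :: 'a::field \<Rightarrow> 'r::comm_ring_1)"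
  shows "comm_ring_hom (eval_pol \<kappa> y :: ('a, 'n::finite) pol \<Rightarrow> 'r)"
proof -
  interpret comm_ring_hom \<kappa> by fact
  let ?e = "eval_pol \<kappa> y :: ('a, 'n::finite) pol \<Rightarrow> 'r"
  have add: "?e (f + g) = ?e f + ?e g" for f g
  proof -
    let ?A = "Poly_Mapping.keys f \<union> Poly_Mapping.keys g"
    have "Poly_Mapping.keys (f + g) \<subseteq> ?A" by (rule Poly_Mapping.keys_add)
    then show ?thesis
      using eval_pol_superset[OF h, of ?A] by (simp add: lookup_add hom_add distrib_right sum.distrib)
  qed
  have zero: "?e 0 = 0" by (simp add: eval_pol_def)
  have sum: "?e (\<Sum>x\<in>A. g x) = (\<Sum>x\<in>A. ?e (g x))" if "finite A" for A and g :: "('n \<Rightarrow>\<^sub>0 nat) \<Rightarrow> _"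
    using that by (induction A) (auto simp: add zero)
  have single: "?e (Poly_Mapping.single m c) = \<kappa> c * (\<Prod>i\<in>UNIV. y i ^ Poly_Mapping.lookup m i)" for m c
    by (cases "c = 0") (auto simp: eval_pol_def)
  have ss: "?e (Poly_Mapping.single m c * Poly_Mapping.single m' c') =
      ?e (Poly_Mapping.single m c) * ?e (Poly_Mapping.single m' c')" for m c m' c'
    by (simp add: mult_single single hom_mult lookup_add power_add prod.distrib)
  have mult: "?e (f * g) = ?e f * ?e g" for f g
    by (subst (1 2) pol_sum_singles[of f], subst (1 2) pol_sum_singles[of g])
       (simp add: sum_product sum ss)
  have one: "?e 1 = 1" using single[of 0 1] by simp
  show ?thesis by unfold_locales (simp_all add: add mult one zero)
qed

lemma eval_pol_const: "comm_ring_hom \<kappa> \<Longrightarrow> eval_pol \<kappa> y (const c) = \<kappa> c"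
proof -
  assume "comm_ring_hom \<kappa>"
  then interpret comm_ring_hom \<kappa> .
  show ?thesis by (cases "c = 0") (auto simp: eval_pol_def const_def)
qed

lemma eval_pol_var: 
  fixes \<kappa> :: "'a::field \<Rightarrow> 'r::comm_ring_1" and i :: "'n::finite"
  assumes "comm_ring_hom \<kappa>" shows "eval_pol \<kappa> y (var i) = y i"
proof -
  interpret comm_ring_hom \<kappa> by fact
  have "(\<Prod>j\<in>UNIV. y j ^ Poly_Mapping.lookup (Poly_Mapping.single i 1) j) = (\<Prod>j\<in>UNIV. if j = i then y i else 1)"
    by (intro prod.cong) (auto simp: lookup_single when_def)
  then show ?thesis by (simp add: eval_pol_def var_def)
qed

lemma pol_hom_eqI:
  fixes \<phi> \<psi> :: "('a::field, 'n::finite) pol \<Rightarrow> 'r::comm_ring_1"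
  assumes "comm_ring_hom \<phi>" "comm_ring_hom \<psi>"
    and "\<And>c. \<phi> (const c) = \<psi> (const c)" "\<And>i. \<phi> (var i) = \<psi> (var i)"
  shows "\<phi> f = \<psi> f"
proof -
  interpret A: comm_ring_hom \<phi> by fact
  interpret B: comm_ring_hom \<psi> by fact
  show ?thesis by (induction f rule: pol_induct) (auto simp: assms A.hom_add A.hom_mult B.hom_add B.hom_mult)
qed

subsection \<open>Degree\<close>

text \<open>This is \<open>f(x) -> f(x T)\<close>: the coefficient of \<open>T^d\<close> is the
  homogeneous component of degree \<open>d\<close>. Questions about total degree become questions
  about univariate polynomials.\<close>

definition grade_hom :: "('a::field, 'n::finite) pol \<Rightarrow> ('a, 'n) pol poly" where
  "grade_hom = eval_pol (\<lambda>c. [:const c:]) (\<lambda>i. monom (var i) 1)"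

lemma comm_ring_hom_grade: "comm_ring_hom (grade_hom :: ('a::field, 'n::finite) pol \<Rightarrow> _)"
  unfolding grade_hom_def
  by (rule comm_ring_hom_eval_pol, unfold_locales) (simp_all add: const_add const_mult one_pCons)

interpretation grade_hom: comm_ring_hom grade_hom by (rule comm_ring_hom_grade)

lemma grade_hom_expand:
  fixes f :: "('a::field, 'n::finite) pol"
  shows "grade_hom f = (\<Sum>m\<in>Poly_Mapping.keys f. monom (Poly_Mapping.single m (Poly_Mapping.lookup f m))
      (\<Sum>i\<in>UNIV. Poly_Mapping.lookup m i))"
proof -
  have "[:const c:] * (\<Prod>i\<in>UNIV. monom (var i) 1 ^ Poly_Mapping.lookup m i) =
     monom (Poly_Mapping.single m c) (\<Sum>i\<in>UNIV. Poly_Mapping.lookup m i)" for c :: 'a and m :: "'n \<Rightarrow>\<^sub>0 nat"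
  proof -
    have "(\<Prod>i\<in>A. monom (var i :: ('a, 'n) pol) 1 ^ Poly_Mapping.lookup m i) =
      monom (\<Prod>i\<in>A. var i ^ Poly_Mapping.lookup m i) (\<Sum>i\<in>A. Poly_Mapping.lookup m i)" if "finite A" for A
      using that by (induction A) (auto simp: monom_power mult_monom)
    then show ?thesis
      by (simp add: pol_single_conv smult_monom)
  qed
  then show ?thesis by (simp add: grade_hom_def eval_pol_def)
qed

lemma grade_hom_homogeneous:
  assumes "homogeneous_pol d f"
  shows "grade_hom f = monom f d"
proof -
  have "grade_hom f = (\<Sum>m\<in>Poly_Mapping.keys f. monom (Poly_Mapping.single m (Poly_Mapping.lookup f m)) d)"
    unfolding grade_hom_expand by (rule sum.cong) (use assms in \<open>auto simp: homogeneous_pol_def\<close>)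
  also have "\<dots> = monom (\<Sum>m\<in>Poly_Mapping.keys f. Poly_Mapping.single m (Poly_Mapping.lookup f m)) d"
    by (rule poly_eqI) (auto simp: coeff_sum)
  finally show ?thesis by (simp flip: pol_sum_singles)
qed

lemma lookup_coeff_grade_hom:
  "Poly_Mapping.lookup (coeff (grade_hom f) d) m =
     (if (\<Sum>i\<in>UNIV. Poly_Mapping.lookup m i) = d then Poly_Mapping.lookup f m else 0)"
proof -
  have "Poly_Mapping.lookup (coeff (grade_hom f) d) m = (\<Sum>m'\<in>Poly_Mapping.keys f.
     if m' = m then (if (\<Sum>i\<in>UNIV. Poly_Mapping.lookup m i) = d then Poly_Mapping.lookup f m else 0) else 0)"
    unfolding grade_hom_expand coeff_sum lookup_sum
    by (intro sum.cong) (auto simp: lookup_single)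
  then show ?thesis by (auto simp: in_keys_iff)
qed

lemma homogeneous_pol_iff_grade: "homogeneous_pol d f \<longleftrightarrow> grade_hom f = monom f d"
proof
  assume *: "grade_hom f = monom f d"
  show "homogeneous_pol d f" unfolding homogeneous_pol_def
  proof
    fix m assume "m \<in> Poly_Mapping.keys f"
    then have "Poly_Mapping.lookup f m \<noteq> 0" by (simp add: in_keys_iff)
    moreover have "Poly_Mapping.lookup (coeff (grade_hom f) (\<Sum>i\<in>UNIV. Poly_Mapping.lookup m i)) m = Poly_Mapping.lookup f m"
      by (simp add: lookup_coeff_grade_hom)
    ultimately show "(\<Sum>i\<in>UNIV. Poly_Mapping.lookup m i) = d"
      unfolding * by (auto split: if_splits)
  qed
qed (rule grade_hom_homogeneous)

lemma grade_hom_inj: "grade_hom f = grade_hom g \<Longrightarrow> f = g"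
  by (rule poly_mapping_eqI) (metis lookup_coeff_grade_hom)

lemma grade_hom_eq_0_iff [simp]: "grade_hom f = 0 \<longleftrightarrow> f = 0"
  using grade_hom_inj[of f 0] by auto

lemma homogeneous_pol_mult: "homogeneous_pol a f \<Longrightarrow> homogeneous_pol b g \<Longrightarrow> homogeneous_pol (a + b) (f * g)"
  by (simp add: homogeneous_pol_iff_grade grade_hom.hom_mult mult_monom)

lemma homogeneous_pol_0 [simp]: "homogeneous_pol d 0" by (simp add: homogeneous_pol_def)

lemma homogeneous_pol_const: "homogeneous_pol 0 (const c)"
  by (auto simp: homogeneous_pol_def const_def)

lemma homogeneous_pol_1 [simp]: "homogeneous_pol 0 1"
  using homogeneous_pol_const[of 1] by simp

lemma homogeneous_pol_add: "homogeneous_pol d f \<Longrightarrow> homogeneous_pol d g \<Longrightarrow> homogeneous_pol d (f + g)"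
  by (simp add: homogeneous_pol_iff_grade grade_hom.hom_add add_monom)

lemma homogeneous_pol_sum: "(\<And>x. x \<in> A \<Longrightarrow> homogeneous_pol d (f x)) \<Longrightarrow> homogeneous_pol d (sum f A)"
  by (induction A rule: infinite_finite_induct) (auto intro: homogeneous_pol_add)

lemma homogeneous_pol_prod: "(\<And>x. x \<in> A \<Longrightarrow> homogeneous_pol (d x) (f x)) \<Longrightarrow> homogeneous_pol (sum d A) (prod f A)"
  by (induction A rule: infinite_finite_induct) (auto intro: homogeneous_pol_mult)

lemma homogeneous_pol_power: "homogeneous_pol d f \<Longrightarrow> homogeneous_pol (d * k) (f ^ k)"
  using homogeneous_pol_prod[of "{..<k}" "\<lambda>_. d" "\<lambda>_. f"] by (simp add: mult.commute)

lemma homogeneous_pol_var: "homogeneous_pol 1 (var i :: ('a::field, 'n::finite) pol)"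
  by (auto simp: homogeneous_pol_def var_def lookup_single when_def)

lemma homogeneous_pol_lin_form: "homogeneous_pol 1 (lin_form l)"
  unfolding lin_form_def
  using homogeneous_pol_mult[OF homogeneous_pol_const homogeneous_pol_var] by (intro homogeneous_pol_sum) simp

lemma homogeneous_pol_unique: "homogeneous_pol d f \<Longrightarrow> homogeneous_pol d' f \<Longrightarrow> f \<noteq> 0 \<Longrightarrow> d = d'"
  using homogeneous_pol_iff_grade monom_eq_iff' by (metis degree_monom_eq)

lemma degree_grade_hom_0:
  fixes f :: "('a::field, 'n::finite) pol"
  assumes "degree (grade_hom f) = 0" shows "\<exists>c. f = const c"
proof
  show "f = const (Poly_Mapping.lookup f 0)"
  proof (rule poly_mapping_eqI)
    fix m :: "'n \<Rightarrow>\<^sub>0 nat"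
    show "Poly_Mapping.lookup f m = Poly_Mapping.lookup (const (Poly_Mapping.lookup f 0)) m"
    proof (cases "m = 0")
      case True
      then show ?thesis by (simp add: const_def)
    next
      case False
      then have "(\<Sum>i\<in>UNIV. Poly_Mapping.lookup m i) \<noteq> 0"
        by (auto simp: poly_mapping_eq_iff fun_eq_iff)
      then have "coeff (grade_hom f) (\<Sum>i\<in>UNIV. Poly_Mapping.lookup m i) = 0"
        using assms by (intro coeff_eq_0) linarith
      then have "Poly_Mapping.lookup f m = 0"
        using lookup_coeff_grade_hom[of f "\<Sum>i\<in>UNIV. Poly_Mapping.lookup m i" m] by simp
      with False show ?thesis by (simp add: const_def lookup_single)
    qed
  qed
qed

text \<open>The degree in the grading variable is additive over a domain, so it leaves degree 0 for
  the cofactor.\<close>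

lemma homogeneous_cofactor_const:
  fixes f h :: "('a::field, 'n::{finite, linorder}) pol"
  assumes "homogeneous_pol d f" "homogeneous_pol d (f * h)" "f * h \<noteq> 0"
  shows "\<exists>c. c \<noteq> 0 \<and> h = const c"
proof -
  have "f \<noteq> 0" "h \<noteq> 0" using assms by auto
  then have "degree (grade_hom (f * h)) = degree (grade_hom f) + degree (grade_hom h)"
    by (simp add: grade_hom.hom_mult degree_mult_eq)
  then have "degree (grade_hom h) = 0"
    using assms by (simp add: grade_hom_homogeneous \<open>f \<noteq> 0\<close> degree_monom_eq)
  then show ?thesis using degree_grade_hom_0 \<open>h \<noteq> 0\<close> by (metis const_0)
qed

lemma unit_pol_const:
  fixes h :: "('a::field, 'n::{finite, linorder}) pol"
  assumes "h dvd 1"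
  shows "\<exists>c. c \<noteq> 0 \<and> h = const c"
proof -
  obtain f where f: "1 = h * f" using assms by auto
  then have "h \<noteq> 0" "f \<noteq> 0" by auto
  then have "degree (grade_hom h * grade_hom f) = degree (grade_hom h) + degree (grade_hom f)"
    by (simp add: degree_mult_eq)
  also have "grade_hom h * grade_hom f = 1" using f by (metis grade_hom.hom_mult grade_hom.hom_one)
  finally show ?thesis using degree_grade_hom_0 \<open>h \<noteq> 0\<close> by (metis add_is_0 const_0 degree_1)
qed

subsection \<open>Linear forms\<close>

lemma lin_form_add: "lin_form (a + b) = lin_form a + lin_form b"
  by (simp add: lin_form_def const_add distrib_right sum.distrib)

lemma lin_form_scale: "lin_form (c *s a) = const c * lin_form a"
  by (simp add: lin_form_def const_mult sum_distrib_left mult.assoc)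

lemma lin_form_0 [simp]: "lin_form 0 = 0"
  by (simp add: lin_form_def)

lemma lin_form_diff: "lin_form (a - b) = lin_form a - lin_form b"
  by (simp add: lin_form_def const_diff left_diff_distrib sum_subtractf)

lemma lin_form_sum: "lin_form (\<Sum>x\<in>A. h x) = (\<Sum>x\<in>A. lin_form (h x))"
  by (induction A rule: infinite_finite_induct) (simp_all add: lin_form_add)

lemma lin_form_axis [simp]: "lin_form (axis i 1) = var i"
proof -
  have "lin_form (axis i 1) = (\<Sum>j\<in>UNIV. if j = i then var i else 0)"
    unfolding lin_form_def by (intro sum.cong) (auto simp: axis_def)
  then show ?thesis by simp
qed

lemma single_one_eq_iff: "Poly_Mapping.single j (1::nat) = Poly_Mapping.single i 1 \<longleftrightarrow> j = i"
  using lookup_single[of j "1::nat" i] by (metis lookup_single_eq when_def zero_neq_one)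
lemma lookup_lin_form:
  fixes l :: "('a::field, 'n::finite) space"
  shows "Poly_Mapping.lookup (lin_form l) (Poly_Mapping.single i 1) = l $ i"
proof -
  have *: "const c * var j = Poly_Mapping.single (Poly_Mapping.single j 1) c" for c :: 'a and j :: 'n
    by (simp add: const_def var_def mult_single)
  have "Poly_Mapping.lookup (lin_form l) (Poly_Mapping.single i 1) =
     (\<Sum>j\<in>UNIV. Poly_Mapping.lookup (Poly_Mapping.single (Poly_Mapping.single j (1::nat)) (l $ j)) (Poly_Mapping.single i (1::nat)))"
    by (simp only: lin_form_def * lookup_sum)
  also have "\<dots> = (\<Sum>j\<in>UNIV. if j = i then l $ i else 0)"
    by (intro sum.cong) (auto simp: lookup_single single_one_eq_iff when_def simp del: One_nat_def)
  also have "\<dots> = l $ i" by simp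
  finally show ?thesis .
qed

lemma lin_form_eq_iff [simp]: "lin_form a = lin_form b \<longleftrightarrow> a = b"
  by (metis lookup_lin_form vec_eq_iff)

lemma lin_form_eq_0_iff [simp]: "lin_form a = 0 \<longleftrightarrow> a = 0"
  using lin_form_eq_iff[of a 0] by (simp del: lin_form_eq_iff)

text \<open>Solves \<open>l = 0\<close> for the variable \<open>i0\<close>. It realises the
  restriction to the hyperplane as an endomorphism of the same polynomial ring.\<close>

definition lin_subst :: "('a::field, 'n::finite) space \<Rightarrow> 'n \<Rightarrow> ('a, 'n) pol \<Rightarrow> ('a, 'n) pol" where
  "lin_subst l i0 = eval_pol const
     (\<lambda>i. if i = i0 then var i0 - const (inverse (l $ i0)) * lin_form l else var i)"

lemma comm_ring_hom_lin_subst: "comm_ring_hom (lin_subst l i0)"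
  unfolding lin_subst_def by (rule comm_ring_hom_eval_pol) (rule const_hom.comm_ring_hom_axioms)

text \<open>The substitution kills \<open>l\<close>, which gives one direction, and changes every
  polynomial by a multiple of \<open>l\<close>, which gives the other. Being the kernel of an
  endomorphism of a domain, the ideal of \<open>l\<close> is then prime.\<close>

lemma lin_form_dvd_iff:
  fixes l :: "('a::field, 'n::finite) space"
  assumes l: "l $ i0 \<noteq> 0"
  shows "lin_form l dvd f \<longleftrightarrow> lin_subst l i0 f = 0"
proof -
  interpret s: comm_ring_hom "lin_subst l i0" by (rule comm_ring_hom_lin_subst)
  have c: "lin_subst l i0 (const c) = const c" for c
    unfolding lin_subst_def by (rule eval_pol_const[OF const_hom.comm_ring_hom_axioms])
  have v: "lin_subst l i0 (var i) = (if i = i0 then var i0 - const (inverse (l $ i0)) * lin_form l else var i)" for i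
    unfolding lin_subst_def by (rule eval_pol_var[OF const_hom.comm_ring_hom_axioms])
  have "lin_subst l i0 (lin_form l) =
      (\<Sum>i\<in>UNIV. const (l $ i) * var i - (if i = i0 then const (l $ i0) * (const (inverse (l $ i0)) * lin_form l) else 0))"
    unfolding lin_form_def[of l]
    by (auto simp: s.hom_sum s.hom_mult c v algebra_simps lin_form_def[of l] intro!: sum.cong)
  also have "\<dots> = lin_form l - const (l $ i0) * (const (inverse (l $ i0)) * lin_form l)"
    by (simp add: sum_subtractf lin_form_def)
  also have "\<dots> = 0" using l by (simp flip: mult.assoc const_mult)
  finally have 0: "lin_subst l i0 (lin_form l) = 0" .
  have d: "lin_form l dvd f - lin_subst l i0 f"
  proof (induction f rule: pol_induct)
    case (add f g)
    then show ?case using dvd_add[OF add] by (simp add: s.hom_add algebra_simps)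
  next
    case (mult f g)
    have "f * g - lin_subst l i0 f * lin_subst l i0 g = (f - lin_subst l i0 f) * g + lin_subst l i0 f * (g - lin_subst l i0 g)"
      by (simp add: algebra_simps)
    then show ?case using mult by (simp add: s.hom_mult)
  qed (simp_all add: c v)
  show ?thesis
  proof
    assume "lin_form l dvd f"
    then show "lin_subst l i0 f = 0" using 0 by (auto simp: s.hom_mult elim!: dvdE)
  next
    assume "lin_subst l i0 f = 0" then show "lin_form l dvd f" using d by simp
  qed
qed

lemma prime_elem_lin_form:
  fixes l :: "('a::field, 'n::{finite, linorder}) space"
  assumes "l \<noteq> 0"
  shows "prime_elem (lin_form l)"
proof -
  obtain i0 where i0: "l $ i0 \<noteq> 0" using assms by (auto simp: vec_eq_iff)
  interpret s: comm_ring_hom "lin_subst l i0" by (rule comm_ring_hom_lin_subst)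
  show ?thesis
  proof (rule prime_elemI)
    show "lin_form l \<noteq> 0" using assms by simp
    show "\<not> lin_form l dvd 1" unfolding lin_form_dvd_iff[OF i0] s.hom_one by (rule one_neq_zero)
    fix a b assume "lin_form l dvd a * b"
    then show "lin_form l dvd a \<or> lin_form l dvd b"
      unfolding lin_form_dvd_iff[OF i0] s.hom_mult by (simp only: mult_eq_0_iff)
  qed
qed

lemma lin_form_dvd_lin_form:
  fixes l l' :: "('a::field, 'n::{finite, linorder}) space"
  assumes "lin_form l dvd lin_form l'"
  shows "\<exists>c. l' = c *s l"
proof (cases "l' = 0")
  case True
  then show ?thesis by (intro exI[of _ 0]) simp
next
  case False
  obtain h where h: "lin_form l' = lin_form l * h" using assms by auto
  then have "\<exists>c. c \<noteq> 0 \<and> h = const c"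
    using homogeneous_cofactor_const[OF homogeneous_pol_lin_form, of l h] False
    by (metis homogeneous_pol_lin_form lin_form_eq_0_iff)
  then obtain c where "lin_form l' = lin_form (c *s l)"
    using h by (auto simp: lin_form_scale mult.commute)
  then show ?thesis by auto
qed

section \<open>Divisibility and products of prime elements\<close>

lemma prime_power_dvd_multD:
  fixes p :: "'r::idom"
  assumes "prime_elem p" "\<not> p dvd q" "p ^ a dvd q * r"
  shows "p ^ a dvd r"
  using assms(3)
proof (induction a arbitrary: r)
  case (Suc a)
  then have "p dvd q * r" by (metis dvd_mult_left power_Suc)
  then obtain r' where r': "r = p * r'" using assms by (auto simp: prime_elem_dvd_mult_iff)
  have "p * p ^ a dvd p * (q * r')" using Suc.prems unfolding r' power_Suc mult.left_commute[of q p] .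
  moreover have "p \<noteq> 0" using assms(1) not_prime_elem_zero by metis
  ultimately have "p ^ a dvd q * r'" by (metis dvd_mult_cancel_left)
  then have "p ^ a dvd r'" by (rule Suc.IH)
  then show ?case unfolding r' power_Suc by (rule mult_dvd_mono[OF dvd_refl])
qed simp

text \<open>The next prime divides none of the factors already split off, so its full power must
  divide the remaining cofactor.\<close>

lemma prod_prime_powers_dvd:
  fixes p :: "'i \<Rightarrow> 'r::idom"
  assumes "finite A" "\<And>x. x \<in> A \<Longrightarrow> prime_elem (p x)"
    and "\<And>x y. x \<in> A \<Longrightarrow> y \<in> A \<Longrightarrow> x \<noteq> y \<Longrightarrow> \<not> p x dvd p y"
    and "\<And>x. x \<in> A \<Longrightarrow> p x ^ c x dvd f"
  shows "(\<Prod>x\<in>A. p x ^ c x) dvd f"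
  using assms
proof (induction A)
  case (insert x A)
  have "(\<Prod>x\<in>A. p x ^ c x) dvd f" by (rule insert.IH) (simp_all add: insert.prems)
  then obtain r where r: "f = (\<Prod>x\<in>A. p x ^ c x) * r" by (rule dvdE)
  have px: "prime_elem (p x)" using insert by simp
  have "\<not> p x dvd (\<Prod>y\<in>A. p y ^ c y)"
  proof
    assume *: "p x dvd (\<Prod>y\<in>A. p y ^ c y)"
    have "\<exists>y\<in>B. p x dvd p y ^ c y" if "finite B" "p x dvd (\<Prod>y\<in>B. p y ^ c y)" for B
      using that by (induction B) (use px in \<open>auto simp: prime_elem_dvd_mult_iff prime_elem_not_unit\<close>)
    then obtain y where y: "y \<in> A" "p x dvd p y ^ c y" using * insert by blast
    then have "p x dvd p y" using prime_elem_dvd_power[OF px] by blast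
    then show False using insert.prems(2)[of x y] insert.hyps y by auto
  qed
  then have "p x ^ c x dvd r"
    using prime_power_dvd_multD[OF px] insert.prems(3)[of x] r by blast
  then obtain r' where "r = p x ^ c x * r'" by (rule dvdE)
  then have "f = (\<Prod>x\<in>insert x A. p x ^ c x) * r'"
    using insert.hyps r by (simp add: mult_ac)
  then show ?case by simp
qed simp

text \<open>A prime of the product that does not divide \<open>h\<close> divides the complementary
  factor and can be cancelled. This does the work of unique factorization for a product whose prime
  factors are known.\<close>

lemma dvd_prod_prime_elems:
  fixes p :: "'i \<Rightarrow> 'r::idom"
  assumes "finite A" "\<And>x. x \<in> A \<Longrightarrow> prime_elem (p x)" "h dvd (\<Prod>x\<in>A. p x)"
  shows "h dvd 1 \<or> (\<exists>x\<in>A. p x dvd h)"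
  using assms
proof (induction A)
  case (insert x A)
  obtain h' where h': "p x * (\<Prod>x\<in>A. p x) = h * h'"
    using insert.prems(2) insert.hyps by (auto elim: dvdE)
  have px: "prime_elem (p x)" using insert by simp
  show ?case
  proof (cases "p x dvd h")
    case False
    have "p x dvd h * h'" using h' by (metis dvd_triv_left)
    then obtain h'' where "h' = p x * h''" using False px by (auto simp: prime_elem_dvd_mult_iff)
    then have "p x * (\<Prod>x\<in>A. p x) = p x * (h * h'')" using h' by (metis mult.left_commute)
    moreover have "p x \<noteq> 0" using px not_prime_elem_zero by metis
    ultimately have "(\<Prod>x\<in>A. p x) = h * h''" by (metis mult_cancel_left)
    then show ?thesis using insert by auto
  qed auto
qed simp

subsection \<open>The action of the general linear group on polynomials\<close>

lemma matrix_inv_props: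
  fixes A :: "('a::field, 'n::finite) sqmat"
  assumes "invertible A"
  shows "A ** matrix_inv A = Finite_Cartesian_Product.mat 1" "matrix_inv A ** A = Finite_Cartesian_Product.mat 1"
  using someI_ex[OF assms[unfolded invertible_def]] unfolding matrix_inv_def by auto

lemma matrix_inv_eqI:
  fixes A :: "('a::field, 'n::finite) sqmat"
  assumes "A ** B = Finite_Cartesian_Product.mat 1" "B ** A = Finite_Cartesian_Product.mat 1"
  shows "matrix_inv A = B"
proof -
  have "invertible A" using assms unfolding invertible_def by blast
  then have "matrix_inv A = (matrix_inv A ** A) ** B"
    using assms by (simp flip: matrix_mul_assoc)
  then show ?thesis using matrix_inv_props[OF \<open>invertible A\<close>] by simp
qed

lemma invertible_matrix_inv: "invertible A \<Longrightarrow> invertible (matrix_inv (A :: ('a::field, 'n::finite) sqmat))"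
  using matrix_inv_props unfolding invertible_def by blast

lemma matrix_inv_mult:
  fixes A B :: "('a::field, 'n::finite) sqmat"
  assumes "invertible A" "invertible B"
  shows "matrix_inv (A ** B) = matrix_inv B ** matrix_inv A"
proof (rule matrix_inv_eqI)
  have "A ** B ** (matrix_inv B ** matrix_inv A) = A ** (B ** matrix_inv B) ** matrix_inv A"
    by (simp add: matrix_mul_assoc)
  then show "A ** B ** (matrix_inv B ** matrix_inv A) = Finite_Cartesian_Product.mat 1"
    using assms by (simp add: matrix_inv_props)
  have "matrix_inv B ** matrix_inv A ** (A ** B) = matrix_inv B ** (matrix_inv A ** A) ** B"
    by (simp add: matrix_mul_assoc)
  then show "matrix_inv B ** matrix_inv A ** (A ** B) = Finite_Cartesian_Product.mat 1"
    using assms by (simp add: matrix_inv_props)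
qed

lemma invertible_mat_1 [simp]: "invertible (Finite_Cartesian_Product.mat 1 :: ('a::field, 'n::finite) sqmat)"
  unfolding invertible_def by (rule exI[of _ "Finite_Cartesian_Product.mat 1"]) simp

lemma matrix_inv_mat_1 [simp]:
  "matrix_inv (Finite_Cartesian_Product.mat 1) = (Finite_Cartesian_Product.mat 1 :: ('a::field, 'n::finite) sqmat)"
  by (intro matrix_inv_eqI) simp_all

lemma dual_act_add: "dual_act g (a + b) = dual_act g a + dual_act g b"
  by (simp add: dual_act_def vector_matrix_mult_def vec_eq_iff algebra_simps sum.distrib)

lemma dual_act_scale: "dual_act g (c *s a) = c *s dual_act g a"
  by (simp add: dual_act_def vector_matrix_mult_def vec_eq_iff sum_distrib_left mult_ac)

lemma dual_act_0 [simp]: "dual_act g 0 = 0"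
  by (simp add: dual_act_def)

lemma dual_act_sum: "dual_act g (\<Sum>x\<in>A. h x) = (\<Sum>x\<in>A. dual_act g (h x))"
  by (induction A rule: infinite_finite_induct) (simp_all add: dual_act_add)

lemma dual_act_1 [simp]: "dual_act (Finite_Cartesian_Product.mat 1) l = l"
  by (simp add: dual_act_def)

lemma dual_act_mult:
  "invertible g \<Longrightarrow> invertible h \<Longrightarrow> dual_act (g ** h) l = dual_act g (dual_act h l)"
  by (simp add: dual_act_def matrix_inv_mult vector_matrix_mul_assoc)

lemma dual_act_eqI:
  assumes "invertible g" "r v* g = l" shows "dual_act g l = r"
  using assms(2)[symmetric] by (simp add: dual_act_def vector_matrix_mul_assoc matrix_inv_props[OF assms(1)])

lemma space_expand:
  fixes l :: "('a::field, 'n::finite) space"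
  shows "l = (\<Sum>i\<in>UNIV. (l $ i) *s axis i 1)"
  by (simp add: vec_eq_iff axis_def if_distrib cong: if_cong)

lemma pol_act_eval: "pol_act g = eval_pol const (\<lambda>i. lin_form (dual_act g (axis i 1)))"
  by (simp add: fun_eq_iff pol_act_def eval_pol_def)

lemma comm_ring_hom_pol_act: "comm_ring_hom (pol_act g)"
  unfolding pol_act_eval by (rule comm_ring_hom_eval_pol) (rule const_hom.comm_ring_hom_axioms)

interpretation pol_act: comm_ring_hom "pol_act g" for g by (rule comm_ring_hom_pol_act)

lemma pol_act_const [simp]: "pol_act g (const c) = const c"
  unfolding pol_act_eval by (rule eval_pol_const) (rule const_hom.comm_ring_hom_axioms)

lemma pol_act_lin_form: "pol_act g (lin_form l) = lin_form (dual_act g l)"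
proof -
  have "lin_form (dual_act g l) = lin_form (\<Sum>i\<in>UNIV. (l $ i) *s dual_act g (axis i 1))"
    by (subst space_expand[of l]) (simp only: dual_act_sum dual_act_scale)
  also have "\<dots> = pol_act g (lin_form l)"
    unfolding lin_form_sum lin_form_scale
    by (simp add: lin_form_def[of l] pol_act.hom_sum pol_act.hom_mult pol_act_var)
  finally show ?thesis by simp
qed

lemma pol_act_1 [simp]: "pol_act (Finite_Cartesian_Product.mat 1) f = f"
  by (rule pol_hom_eqI[of "pol_act (Finite_Cartesian_Product.mat 1)" "\<lambda>f. f"]) (unfold_locales, simp_all add: pol_act_var)

lemma comm_ring_hom_comp: "comm_ring_hom f \<Longrightarrow> comm_ring_hom g \<Longrightarrow> comm_ring_hom (\<lambda>x. f (g x))"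
proof -
  assume "comm_ring_hom f" "comm_ring_hom g"
  then interpret f: comm_ring_hom f + g: comm_ring_hom g by simp_all
  show ?thesis by unfold_locales (simp_all add: f.hom_add g.hom_add f.hom_mult g.hom_mult)
qed

lemma pol_act_mult:
  assumes "invertible g" "invertible h"
  shows "pol_act (g ** h) f = pol_act g (pol_act h f)"
  by (rule pol_hom_eqI[of "pol_act (g ** h)" "\<lambda>f. pol_act g (pol_act h f)"])
     (use assms in \<open>simp_all add: comm_ring_hom_pol_act comm_ring_hom_comp pol_act_var dual_act_mult pol_act_lin_form\<close>)

lemma pol_act_inv [simp]:
  assumes "invertible g"
  shows "pol_act g (pol_act (matrix_inv g) f) = f" "pol_act (matrix_inv g) (pol_act g f) = f"
  using assms by (simp_all add: matrix_inv_props invertible_matrix_inv flip: pol_act_mult)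

lemma pol_act_eq_0_iff [simp]: "invertible g \<Longrightarrow> pol_act g f = 0 \<longleftrightarrow> f = 0"
  by (metis pol_act.hom_zero pol_act_inv(2))

section \<open>Functoriality of the exterior algebra\<close>

lemma shuffle_sign_singleton: "shuffle_sign {i} J = (-1) ^ card {j \<in> J. j < i}"
proof -
  have "{(a, b). a \<in> {i} \<and> b \<in> J \<and> b < a} = Pair i ` {j \<in> J. j < i}" by auto
  then show ?thesis unfolding shuffle_sign_def by (simp add: card_image inj_on_def)
qed

lemma shuffle_sign_sq [simp]: "shuffle_sign I J * shuffle_sign I J = (1::'a::field)"
  by (simp add: shuffle_sign_def flip: power_mult_distrib)

lemma shuffle_sign_sq_left [simp]: "shuffle_sign I J * (shuffle_sign I J * x) = (x::'a::field)"
  by (simp flip: mult.assoc)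

lemma shuffle_sign_insert_less:
  assumes "a < i" "a \<notin> J" "finite J"
  shows "shuffle_sign {i} (insert a J) = - (shuffle_sign {i} J :: 'a::field)"
proof -
  have "{j \<in> insert a J. j < i} = insert a {j \<in> J. j < i}" using assms by auto
  then show ?thesis using assms by (simp add: shuffle_sign_singleton)
qed

lemma shuffle_sign_insert_not_less:
  assumes "\<not> a < i"
  shows "shuffle_sign {i} (insert a J) = (shuffle_sign {i} J :: 'a::field)"
proof -
  have "{j \<in> insert a J. j < i} = {j \<in> J. j < i}" using assms by auto
  then show ?thesis by (simp add: shuffle_sign_singleton)
qed

lemma shuffle_sign_min:
  assumes "\<And>j. j \<in> J \<Longrightarrow> i \<le> j" shows "shuffle_sign {i} J = (1 :: 'a::field)"
proof -
  have "{j \<in> J. j < i} = {}" using assms by fastforce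
  then show ?thesis by (simp only: shuffle_sign_singleton) simp
qed

lemma shuffle_sign_empty [simp]: "shuffle_sign {i} {} = (1 :: 'a::field)"
  by (rule shuffle_sign_min) simp

lemma one_form_nth: "one_form y $ I = (\<Sum>i\<in>UNIV. if I = {i} then y $ i else 0)"
  unfolding one_form_def sum_component by (intro sum.cong) (auto simp: axis_def)

lemma wedge_one_form_nth:
  "wedge (one_form y) \<omega> $ K = (\<Sum>i\<in>K. shuffle_sign {i} (K - {i}) * y $ i * \<omega> $ (K - {i}))"
proof -
  have inj: "inj_on (\<lambda>i. {i}) K" by (simp add: inj_on_def)
  have "wedge (one_form y) \<omega> $ K = (\<Sum>I\<in>Pow K. shuffle_sign I (K - I) * one_form y $ I * \<omega> $ (K - I))"
    by (simp add: wedge_def)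
  also have "\<dots> = (\<Sum>I\<in>(\<lambda>i. {i}) ` K. shuffle_sign I (K - I) * one_form y $ I * \<omega> $ (K - I))"
  proof (rule sum.mono_neutral_right)
    show "\<forall>I\<in>Pow K - (\<lambda>i. {i}) ` K. shuffle_sign I (K - I) * one_form y $ I * \<omega> $ (K - I) = 0"
    proof
      fix I assume "I \<in> Pow K - (\<lambda>i. {i}) ` K"
      then have "\<And>i. I \<noteq> {i}" by auto
      then show "shuffle_sign I (K - I) * one_form y $ I * \<omega> $ (K - I) = 0" by (simp add: one_form_nth)
    qed
  qed auto
  also have "\<dots> = (\<Sum>i\<in>K. shuffle_sign {i} (K - {i}) * one_form y $ {i} * \<omega> $ (K - {i}))"
    by (simp add: sum.reindex[OF inj])
  finally show ?thesis by (simp add: one_form_nth)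
qed

lemma wedge_add_left: "wedge (a + b) \<omega> = wedge a \<omega> + wedge b \<omega>"
  by (simp add: wedge_def vec_eq_iff algebra_simps sum.distrib)

lemma wedge_add_right: "wedge a (\<omega> + \<tau>) = wedge a \<omega> + wedge a \<tau>"
  by (simp add: wedge_def vec_eq_iff algebra_simps sum.distrib)

lemma wedge_scale_left: "wedge (c *s a) \<omega> = c *s wedge a \<omega>"
  by (simp add: wedge_def vec_eq_iff sum_distrib_left mult_ac)

lemma wedge_scale_right: "wedge a (c *s \<omega>) = c *s wedge a \<omega>"
  by (simp add: wedge_def vec_eq_iff sum_distrib_left mult_ac)

lemma wedge_0_left [simp]: "wedge 0 \<omega> = 0" and wedge_0_right [simp]: "wedge a 0 = 0"
  by (simp_all add: wedge_def vec_eq_iff)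

lemma wedge_sum_left: "wedge (\<Sum>x\<in>A. h x) \<omega> = (\<Sum>x\<in>A. wedge (h x) \<omega>)"
  by (induction A rule: infinite_finite_induct) (simp_all add: wedge_add_left)

lemma wedge_sum_right: "wedge \<omega> (\<Sum>x\<in>A. h x) = (\<Sum>x\<in>A. wedge \<omega> (h x))"
  by (induction A rule: infinite_finite_induct) (simp_all add: wedge_add_right)

lemma one_form_add: "one_form (x + y) = one_form x + one_form y"
  by (simp add: one_form_def vector_sadd_rdistrib sum.distrib)

lemma one_form_scale: "one_form (c *s x) = c *s one_form x"
  by (simp add: vec_eq_iff one_form_nth sum_distrib_left if_distrib cong: if_cong)

lemma one_form_sum: "one_form (\<Sum>x\<in>A. h x) = (\<Sum>x\<in>A. one_form (h x))"
proof -
  have [simp]: "one_form 0 = 0" by (simp add: one_form_def)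
  show ?thesis by (induction A rule: infinite_finite_induct) (simp_all add: one_form_add)
qed

text \<open>The ordered pairs of indices removed from \<open>K\<close> cancel in couples
  \<open>(i, j)\<close>, \<open>(j, i)\<close>: the sign of the larger index counts the smaller one
  exactly when that one is still present. Cancelling couples also covers characteristic 2, where
  anticommutativity alone would say nothing.\<close>

lemma wedge_one_form_self: "wedge (one_form y) (wedge (one_form y) \<omega>) = (0 :: ('a::field, 'n::{finite, linorder}) ext)"
proof -
  have "wedge (one_form y) (wedge (one_form y) \<omega>) $ K = 0" for K
  proof -
    define F where "F i j = shuffle_sign {i} (K - {i}) * y $ i *
        (shuffle_sign {j} (K - {i} - {j}) * y $ j * \<omega> $ (K - {i} - {j}))" for i j
    define P where "P = {(i, j). i \<in> K \<and> j \<in> K \<and> i < j}"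
    have anti: "F j i = - F i j" if "(i, j) \<in> P" for i j
    proof -
      have ij: "i \<in> K" "j \<in> K" "i < j" using that by (auto simp: P_def)
      let ?R = "K - {i} - {j}"
      have e: "K - {j} - {i} = ?R" "K - {j} = insert i ?R" "K - {i} = insert j ?R" using ij by auto
      have "shuffle_sign {j} (K - {j}) = - (shuffle_sign {j} ?R :: 'a)"
        by (subst e(2), rule shuffle_sign_insert_less) (use ij in auto)
      moreover have "shuffle_sign {i} (K - {i}) = (shuffle_sign {i} ?R :: 'a)"
        by (subst e(3), rule shuffle_sign_insert_not_less) (use ij in auto)
      ultimately show ?thesis by (simp add: F_def e(1))
    qed
    have fin: "finite P" "finite (prod.swap ` P)" by (rule finite_subset[of _ UNIV], auto)+
    have "wedge (one_form y) (wedge (one_form y) \<omega>) $ K = (\<Sum>i\<in>K. \<Sum>j\<in>K - {i}. F i j)"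
      by (simp add: wedge_one_form_nth F_def sum_distrib_left)
    also have "\<dots> = (\<Sum>(i, j)\<in>(SIGMA i:K. K - {i}). F i j)"
      by (rule sum.Sigma) auto
    also have "(SIGMA i:K. K - {i}) = P \<union> prod.swap ` P"
      by (auto simp: P_def image_iff)
    also have "(\<Sum>(i, j)\<in>P \<union> prod.swap ` P. F i j) = (\<Sum>(i, j)\<in>P. F i j) + (\<Sum>(i, j)\<in>prod.swap ` P. F i j)"
      by (rule sum.union_disjoint[OF fin]) (auto simp: P_def)
    also have "(\<Sum>(i, j)\<in>prod.swap ` P. F i j) = (\<Sum>(i, j)\<in>P. F j i)"
      by (subst sum.reindex) (auto intro!: sum.cong inj_onI)
    also have "\<dots> = (\<Sum>(i, j)\<in>P. - F i j)"
      using anti by (intro sum.cong) auto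
    finally show ?thesis by (simp add: sum_negf split_def)
  qed
  then show ?thesis by (simp add: vec_eq_iff)
qed

text \<open>Polarization of the square-zero identity at \<open>x + y\<close>.\<close>

lemma wedge_one_form_commute:
  "wedge (one_form x) (wedge (one_form y) \<omega>) = - wedge (one_form y) (wedge (one_form x) \<omega>)"
  using wedge_one_form_self[of "x + y" \<omega>]
  by (simp add: one_form_add wedge_add_left wedge_add_right wedge_one_form_self add_eq_0_iff2)

lemma wedge_family_empty [simp]: "wedge_family y {} = axis {} 1"
  by (simp add: wedge_family_def)

lemma wedge_family_insert_min:
  assumes "\<And>j. j \<in> J \<Longrightarrow> i < j"
  shows "wedge_family y (insert i J) = wedge (one_form (y i)) (wedge_family y J)"
proof -
  have "sorted_list_of_set (insert i J) = insort i (sorted_list_of_set J)"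
    using assms by (subst sorted_list_of_set.sorted_key_list_of_set_insert) auto
  also have "\<dots> = i # sorted_list_of_set J"
    using assms by (intro insort_is_Cons) (auto intro: less_imp_le)
  finally show ?thesis by (simp add: wedge_family_def)
qed

text \<open>Induction on the least element \<open>a\<close> of \<open>J\<close>. A smaller
  \<open>i\<close> goes in front, \<open>i = a\<close> gives zero, and a larger \<open>i\<close> is
  moved past \<open>a\<close>, which costs one sign in the product and one in
  \<open>shuffle_sign\<close>.\<close>

lemma wedge_one_form_family:
  "wedge (one_form (y i)) (wedge_family y J) =
     (if i \<in> J then 0 else shuffle_sign {i} J *s wedge_family y (insert i J))"
proof -
  have "finite J" by simp
  then show ?thesis
  proof (induction J rule: finite_linorder_min_induct)
    case empty
    then show ?case using wedge_family_insert_min[of "{}" i y] by simp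
  next
    case (insert a J)
    have a: "wedge_family y (insert a J) = wedge (one_form (y a)) (wedge_family y J)"
      using insert by (intro wedge_family_insert_min) auto
    consider "i < a" | "i = a" | "a < i" by fastforce
    then show ?case
    proof cases
      case 1
      then have "\<And>j. j \<in> insert a J \<Longrightarrow> i < j" using insert by auto
      then have w: "wedge_family y (insert i (insert a J)) = wedge (one_form (y i)) (wedge_family y (insert a J))"
        and s: "shuffle_sign {i} (insert a J) = (1 :: 'a)" and "i \<notin> insert a J"
        by (auto intro!: wedge_family_insert_min shuffle_sign_min less_imp_le)
      then show ?thesis unfolding w s by simp
    next
      case 2
      then show ?thesis by (simp add: a wedge_one_form_self)
    next
      case 3
      have aJ: "a \<notin> J" using insert by auto
      have ins: "wedge_family y (insert a (insert i J)) = wedge (one_form (y a)) (wedge_family y (insert i J))"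
        using insert 3 by (intro wedge_family_insert_min) auto
      have "wedge (one_form (y i)) (wedge_family y (insert a J)) =
         - wedge (one_form (y a)) (wedge (one_form (y i)) (wedge_family y J))"
        unfolding a by (rule wedge_one_form_commute)
      also have "\<dots> = (if i \<in> J then 0 else - shuffle_sign {i} J *s wedge_family y (insert a (insert i J)))"
        unfolding insert.IH by (simp add: wedge_scale_right ins)
      also have "\<dots> = (if i \<in> insert a J then 0 else shuffle_sign {i} (insert a J) *s wedge_family y (insert i (insert a J)))"
        using 3 aJ by (simp add: shuffle_sign_insert_less insert_commute)
      finally show ?thesis .
    qed
  qed
qed

text \<open>The algebra endomorphism of the exterior algebra induced by \<open>x_i -> y i\<close>,
  described by its values on the basis.\<close>

definition ext_map :: "('n \<Rightarrow> ('a, 'n) space) \<Rightarrow> ('a::field, 'n::{finite, linorder}) ext \<Rightarrow> ('a, 'n) ext" where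
  "ext_map y \<omega> = (\<Sum>I\<in>UNIV. (\<omega> $ I) *s wedge_family y I)"

lemma ext_map_add: "ext_map y (a + b) = ext_map y a + ext_map y b"
  by (simp add: ext_map_def vector_sadd_rdistrib sum.distrib)

lemma ext_map_scale: "ext_map y (c *s a) = c *s ext_map y a"
  by (simp add: ext_map_def vec_eq_iff sum_distrib_left mult.assoc)

lemma ext_map_0 [simp]: "ext_map y 0 = 0"
  by (simp add: ext_map_def)

lemma ext_map_sum: "ext_map y (\<Sum>x\<in>A. h x) = (\<Sum>x\<in>A. ext_map y (h x))"
  by (induction A rule: infinite_finite_induct) (simp_all add: ext_map_add)

lemma ext_map_axis [simp]: "ext_map y (axis I 1) = wedge_family y I"
proof -
  have "ext_map y (axis I 1) = (\<Sum>J\<in>UNIV. if J = I then wedge_family y I else 0)"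
    unfolding ext_map_def by (intro sum.cong) (auto simp: axis_def)
  then show ?thesis by simp
qed

text \<open>Both sides are bilinear, so the insertion formula for basis elements decides.
  Multiplicativity against one-forms is enough for functoriality, because
  \<open>wedge_family\<close> is an iterated product of one-forms.\<close>

lemma ext_map_wedge_one_form:
  fixes \<omega> :: "('a::field, 'n::{finite, linorder}) ext"
  shows "ext_map y (wedge (one_form l) \<omega>) = wedge (one_form (\<Sum>i\<in>UNIV. (l $ i) *s y i)) (ext_map y \<omega>)"
proof -
  have basis: "ext_map y (wedge (axis {i} 1) (axis J 1)) = wedge (one_form (y i)) (wedge_family y J)" for i J
    using wedge_one_form_family[of "\<lambda>i. axis i (1::'a)" i J]
    by (cases "i \<in> J") (simp_all add: one_form_axis wedge_family_axis ext_map_scale wedge_one_form_family)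
  have "ext_map y (wedge (one_form l) \<omega>) =
      ext_map y (wedge (\<Sum>i\<in>UNIV. (l $ i) *s axis {i} 1) (\<Sum>J\<in>UNIV. (\<omega> $ J) *s axis J 1))"
    unfolding one_form_def by (simp flip: space_expand)
  then show ?thesis
    by (simp add: wedge_sum_left wedge_sum_right wedge_scale_left wedge_scale_right ext_map_sum
        ext_map_scale basis one_form_sum one_form_scale ext_map_def[of y \<omega>])
qed

lemma wedge_family_compose:
  "wedge_family (\<lambda>i. \<Sum>j\<in>UNIV. (l i $ j) *s y j) I = ext_map y (wedge_family l I)"
proof -
  have "finite I" by simp
  then show ?thesis
  proof (induction I rule: finite_linorder_min_induct)
    case (insert a J)
    then show ?case by (simp add: wedge_family_insert_min ext_map_wedge_one_form)
  qed simp
qed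

lemma wedge_family_nth_eq_0: "card K \<noteq> card I \<Longrightarrow> wedge_family l I $ K = 0"
proof -
  have "finite I" by simp
  then show "card K \<noteq> card I \<Longrightarrow> wedge_family l I $ K = 0"
  proof (induction I arbitrary: K rule: finite_linorder_min_induct)
    case empty
    then show ?case by (auto simp: axis_def)
  next
    case (insert a J)
    then have aJ: "a \<notin> J" by auto
    have "wedge_family l J $ (K - {i}) = 0" if "i \<in> K" for i
      using insert.prems insert.hyps aJ that
      by (intro insert.IH) (simp add: card_Diff_singleton, metis Suc_pred card_gt_0_iff empty_iff finite)
    moreover have "wedge_family l (insert a J) = wedge (one_form (l a)) (wedge_family l J)"
      using insert by (intro wedge_family_insert_min) auto
    ultimately show ?case by (simp add: wedge_one_form_nth)
  qed
qed

section \<open>The action on differential derivations\<close>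

text \<open>The entry in row \<open>p\<close> and column \<open>q\<close> of the representation on
  the exterior algebra tensored with \<open>V\<close>, over the base field. The action on
  \<open>sext\<close> applies this matrix to the transformed coefficients, so it is semilinear over
  \<open>S\<close>.\<close>

definition rho :: "('a::field, 'n::{finite, linorder}) sqmat \<Rightarrow> 'n set \<times> 'n \<Rightarrow> 'n set \<times> 'n \<Rightarrow> 'a" where
  "rho g p q = wedge_family (\<lambda>i. dual_act g (axis i 1)) (fst q) $ fst p * g $ snd p $ snd q"

lemma sext_act_nth: "sext_act g \<eta> $ p = (\<Sum>q\<in>UNIV. pol_act g (\<eta> $ q) * const (rho g p q))"
proof -
  have "(g *v axis j 1) $ i = g $ i $ j" for i j
    by (simp add: matrix_vector_mult_def axis_def if_distrib cong: if_cong)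
  then show ?thesis
    unfolding sext_act_def sum_component
    by (intro sum.cong) (auto simp: pure_tensor_def rho_def const_mult mult.assoc)
qed

lemma rho_mult:
  assumes "invertible g" "invertible h"
  shows "rho (g ** h) p q = (\<Sum>r\<in>UNIV. rho g p r * rho h r q)"
proof -
  let ?W = "\<lambda>g I. wedge_family (\<lambda>i. dual_act g (axis i 1)) I"
  have "dual_act (g ** h) (axis i 1) = (\<Sum>j\<in>UNIV. (dual_act h (axis i 1) $ j) *s dual_act g (axis j 1))" for i
    unfolding dual_act_mult[OF assms]
    by (subst space_expand[of "dual_act h (axis i 1)"]) (simp only: dual_act_sum dual_act_scale)
  then have "?W (g ** h) I = ext_map (\<lambda>j. dual_act g (axis j 1)) (?W h I)" for I
    by (simp add: wedge_family_compose)
  then have "?W (g ** h) I $ K = (\<Sum>M\<in>UNIV. ?W g M $ K * ?W h I $ M)" for I K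
    by (simp add: ext_map_def mult.commute)
  then have "rho (g ** h) p q = (\<Sum>M\<in>UNIV. ?W g M $ fst p * ?W h (fst q) $ M) * (\<Sum>m\<in>UNIV. g $ snd p $ m * h $ m $ snd q)"
    by (simp add: rho_def matrix_matrix_mult_def)
  also have "\<dots> = (\<Sum>(M, m)\<in>UNIV \<times> UNIV. rho g p (M, m) * rho h (M, m) q)"
    unfolding sum_product sum.cartesian_product by (intro sum.cong) (auto simp: rho_def)
  finally show ?thesis by (simp add: split_def)
qed

lemma rho_1: "rho (Finite_Cartesian_Product.mat 1) p q = (if p = q then 1 else 0)"
  by (cases p; cases q) (simp only: rho_def dual_act_1 wedge_family_axis, auto simp: axis_def Finite_Cartesian_Product.mat_def)

lemma rho_eq_0: "card (fst p) \<noteq> card (fst q) \<Longrightarrow> rho g p q = 0"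
  by (simp add: rho_def wedge_family_nth_eq_0)

lemma sext_act_add: "sext_act g (\<eta> + \<theta>) = sext_act g \<eta> + sext_act g \<theta>"
  by (simp add: vec_eq_iff sext_act_nth pol_act.hom_add distrib_right sum.distrib)

lemma sext_act_scale: "sext_act g (f *s \<eta>) = pol_act g f *s sext_act g \<eta>"
  by (simp add: vec_eq_iff sext_act_nth pol_act.hom_mult sum_distrib_left mult.assoc)

lemma sext_act_0 [simp]: "sext_act g 0 = 0"
  by (simp add: vec_eq_iff sext_act_nth)

lemma sext_act_sum: "sext_act g (\<Sum>x\<in>A. h x) = (\<Sum>x\<in>A. sext_act g (h x))"
  by (induction A rule: infinite_finite_induct) (simp_all add: sext_act_add)

lemma sext_act_diff: "sext_act g (\<eta> - \<theta>) = sext_act g \<eta> - sext_act g \<theta>"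
  by (simp add: vec_eq_iff sext_act_nth pol_act.hom_minus left_diff_distrib sum_subtractf)

lemma sext_act_1 [simp]: "sext_act (Finite_Cartesian_Product.mat 1) \<eta> = \<eta>"
  by (simp add: vec_eq_iff sext_act_nth rho_1 if_distrib cong: if_cong)

lemma sext_act_mult:
  assumes "invertible g" "invertible h"
  shows "sext_act (g ** h) \<eta> = sext_act g (sext_act h \<eta>)"
proof -
  have "sext_act (g ** h) \<eta> $ p = sext_act g (sext_act h \<eta>) $ p" for p
  proof -
    have "sext_act (g ** h) \<eta> $ p = (\<Sum>q\<in>UNIV. \<Sum>r\<in>UNIV. pol_act g (pol_act h (\<eta> $ q)) * const (rho h r q) * const (rho g p r))"
      unfolding sext_act_nth pol_act_mult[OF assms] rho_mult[OF assms]
      by (simp add: const_hom.hom_sum const_mult sum_distrib_left mult_ac)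
    also have "\<dots> = (\<Sum>r\<in>UNIV. \<Sum>q\<in>UNIV. pol_act g (pol_act h (\<eta> $ q)) * const (rho h r q) * const (rho g p r))"
      by (rule sum.swap)
    also have "\<dots> = sext_act g (sext_act h \<eta>) $ p"
      unfolding sext_act_nth by (simp add: pol_act.hom_sum pol_act.hom_mult sum_distrib_right)
    finally show ?thesis .
  qed
  then show ?thesis by (simp add: vec_eq_iff)
qed

lemma S_ext_V_sext_act:
  assumes "\<eta> \<in> S_ext_V k" shows "sext_act g \<eta> \<in> S_ext_V k"
proof -
  have "pol_act g (\<eta> $ q) * const (rho g p q) = 0" if "p \<notin> basis_index k" for p q
  proof (cases "q \<in> basis_index k")
    case True
    then have "card (fst p) \<noteq> card (fst q)" using that by (auto simp: basis_index_def mem_Times_iff)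
    then show ?thesis by (simp add: rho_eq_0)
  next
    case False
    then have "\<eta> $ q = 0" using assms unfolding S_ext_V_def by blast
    then show ?thesis by simp
  qed
  then have "sext_act g \<eta> $ p = 0" if "p \<notin> basis_index k" for p
    unfolding sext_act_nth using that by (intro sum.neutral) blast
  then show ?thesis unfolding S_ext_V_def by blast
qed

lemma S_ext_V_add: "a \<in> S_ext_V k \<Longrightarrow> b \<in> S_ext_V k \<Longrightarrow> a + b \<in> S_ext_V k"
  and S_ext_V_scale: "a \<in> S_ext_V k \<Longrightarrow> f *s a \<in> S_ext_V k"
  and S_ext_V_diff: "a \<in> S_ext_V k \<Longrightarrow> b \<in> S_ext_V k \<Longrightarrow> a - b \<in> S_ext_V k"
  and S_ext_V_0: "0 \<in> S_ext_V k"
  by (simp_all add: S_ext_V_def)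

lemma S_ext_V_sum: "(\<And>x. x \<in> A \<Longrightarrow> h x \<in> S_ext_V k) \<Longrightarrow> (\<Sum>x\<in>A. h x) \<in> S_ext_V k"
  by (induction A rule: infinite_finite_induct) (auto simp: S_ext_V_0 intro: S_ext_V_add)

lemma sext_act_inv [simp]:
  assumes "invertible g"
  shows "sext_act g (sext_act (matrix_inv g) \<eta>) = \<eta>" "sext_act (matrix_inv g) (sext_act g \<eta>) = \<eta>"
  using assms by (simp_all add: matrix_inv_props invertible_matrix_inv flip: sext_act_mult)

section \<open>Coefficient matrices\<close>

definition S_span :: "('a::field, 'n::finite) sext list \<Rightarrow> ('a, 'n) sext set" where
  "S_span xs = {\<eta>. \<exists>c. \<eta> = (\<Sum>s<length xs. c s *s xs ! s)}"

lemma S_span_I: "\<eta> = (\<Sum>s<length xs. c s *s xs ! s) \<Longrightarrow> \<eta> \<in> S_span xs"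
  by (auto simp: S_span_def)

lemma S_span_add: "a \<in> S_span xs \<Longrightarrow> b \<in> S_span xs \<Longrightarrow> a + b \<in> S_span xs"
proof -
  assume "a \<in> S_span xs" "b \<in> S_span xs"
  then obtain c d where "a = (\<Sum>s<length xs. c s *s xs ! s)" "b = (\<Sum>s<length xs. d s *s xs ! s)"
    by (auto simp: S_span_def)
  then have "a + b = (\<Sum>s<length xs. (c s + d s) *s xs ! s)"
    by (simp add: vector_sadd_rdistrib sum.distrib)
  then show ?thesis by (rule S_span_I)
qed

lemma S_span_scale: "a \<in> S_span xs \<Longrightarrow> f *s a \<in> S_span xs"
proof -
  assume "a \<in> S_span xs"
  then obtain c where "a = (\<Sum>s<length xs. c s *s xs ! s)"
    by (auto simp: S_span_def)
  then have "f *s a = (\<Sum>s<length xs. (f * c s) *s xs ! s)"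
    by (simp add: vec_eq_iff sum_distrib_left mult.assoc)
  then show ?thesis by (rule S_span_I)
qed

lemma S_span_0: "0 \<in> S_span xs"
  by (rule S_span_I[where c = "\<lambda>_. 0"]) simp

lemma S_span_sum: "(\<And>x. x \<in> A \<Longrightarrow> h x \<in> S_span xs) \<Longrightarrow> (\<Sum>x\<in>A. h x) \<in> S_span xs"
  by (induction A rule: infinite_finite_induct) (auto intro: S_span_add S_span_0)

lemma S_span_base: "x \<in> set xs \<Longrightarrow> x \<in> S_span xs"
proof -
  assume "x \<in> set xs"
  then obtain r where r: "r < length xs" "x = xs ! r" by (auto simp: in_set_conv_nth)
  have "x = (\<Sum>s<length xs. if s = r then xs ! r else 0)" using r by simp
  also have "\<dots> = (\<Sum>s<length xs. (if s = r then 1 else 0) *s xs ! s)"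
    by (intro sum.cong) auto
  finally show ?thesis by (rule S_span_I)
qed

text \<open>The matrix expressing \<open>xs\<close> through \<open>bs\<close> has entries in
  \<open>S\<close>, and its determinant is the cofactor.\<close>

lemma det_coef_mat_dvd:
  assumes len: "length xs = length ps" "length bs = length ps"
    and span: "\<And>x. x \<in> set xs \<Longrightarrow> x \<in> S_span bs"
  shows "Determinant.det (coef_mat bs ps) dvd Determinant.det (coef_mat xs ps)"
proof -
  let ?N = "length ps"
  have "\<exists>c. xs ! r = (\<Sum>s<?N. c s *s bs ! s)" if "r < ?N" for r
    using span[of "xs ! r"] that len unfolding S_span_def by simp
  then have "\<forall>r\<in>{..<?N}. \<exists>c. xs ! r = (\<Sum>s<?N. c s *s bs ! s)" by blast
  from bchoice[OF this] obtain C where C: "\<And>r. r < ?N \<Longrightarrow> xs ! r = (\<Sum>s<?N. C r s *s bs ! s)"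
    by blast
  define M where "M = Matrix.mat ?N ?N (\<lambda>(r, s). C r s)"
  have M: "M \<in> carrier_mat ?N ?N" and B: "coef_mat bs ps \<in> carrier_mat ?N ?N"
    using len by (auto simp: M_def coef_mat_def)
  have "coef_mat xs ps = M * coef_mat bs ps"
  proof (rule eq_matI)
    fix i j assume "i < dim_row (M * coef_mat bs ps)" "j < dim_col (M * coef_mat bs ps)"
    then show "coef_mat xs ps $$ (i, j) = (M * coef_mat bs ps) $$ (i, j)"
      using len C by (simp add: M_def coef_mat_def scalar_prod_def lessThan_atLeast0)
  qed (use len in \<open>auto simp: coef_mat_def M_def\<close>)
  then show ?thesis using det_mult[OF M B] by simp
qed

lemma det_coef_mat_scale:
  assumes "length xs = length ps"
  shows "Determinant.det (coef_mat (map (\<lambda>x. u *s x) xs) ps) = u ^ length ps * Determinant.det (coef_mat xs ps)"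
proof -
  have "coef_mat (map (\<lambda>x. u *s x) xs) ps = u \<cdot>\<^sub>m coef_mat xs ps"
    by (rule eq_matI) (auto simp: coef_mat_def)
  then show ?thesis by (simp add: coef_mat_def)
qed

lemma det_coef_mat_dvd_scaled:
  assumes len: "length xs = length ps" "length bs = length ps"
    and span: "\<And>x. x \<in> set xs \<Longrightarrow> u *s x \<in> S_span bs"
  shows "Determinant.det (coef_mat bs ps) dvd u ^ length ps * Determinant.det (coef_mat xs ps)"
  using det_coef_mat_dvd[of "map (\<lambda>x. u *s x) xs" ps bs] assms
  by (simp add: det_coef_mat_scale) auto

lemma sext_eqI:
  assumes "\<eta> \<in> S_ext_V k" "\<theta> \<in> S_ext_V k" "set ps = basis_index k"
    and "\<And>j. j < length ps \<Longrightarrow> \<eta> $ (ps ! j) = \<theta> $ (ps ! j)"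
  shows "\<eta> = \<theta>"
proof -
  have "\<eta> $ p = \<theta> $ p" for p
  proof (cases "p \<in> basis_index k")
    case True
    then obtain j where "j < length ps" "p = ps ! j" using assms(3) by (metis in_set_conv_nth)
    then show ?thesis using assms by simp
  next
    case False
    have "\<eta> $ p = 0" "\<theta> $ p = 0" using False assms(1,2) unfolding S_ext_V_def by blast+
    then show ?thesis by simp
  qed
  then show ?thesis by (simp add: vec_eq_iff)
qed

text \<open>By Cramer's rule the coefficients of \<open>\<eta>\<close> are the determinants with one
  row replaced by \<open>\<eta>\<close>, divided by that of \<open>xs\<close>. As the latter is a
  unit times \<open>D\<close>, the divisibility hypothesis turns these fractions into
  polynomials.\<close>

lemma cramer_S_span:
  fixes xs :: "('a::field, 'n::{finite, linorder}) sext list"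
  assumes len: "length xs = length ps" and ps: "set ps = basis_index k"
    and xs: "set xs \<subseteq> S_ext_V k" and \<eta>: "\<eta> \<in> S_ext_V k"
    and det: "Determinant.det (coef_mat xs ps) = const c * D" "c \<noteq> 0" "D \<noteq> 0"
    and dvd: "\<And>i. i < length ps \<Longrightarrow> D dvd Determinant.det (coef_mat (xs[i := \<eta>]) ps)"
  shows "\<eta> \<in> S_span xs"
proof -
  let ?N = "length ps" and ?M = "coef_mat xs ps"
  have M: "?M \<in> carrier_mat ?N ?N" using len by (simp add: coef_mat_def)
  \<comment> \<open>The Cramer numerators, written with the cofactors of the original matrix: the
    cofactors of row \<open>i\<close> do not involve row \<open>i\<close>, so replacing it leaves
    them unchanged.\<close>
  define y where "y i = (\<Sum>j<?N. \<eta> $ (ps ! j) * cofactor ?M i j)" for i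
  have y: "y i = Determinant.det (coef_mat (xs[i := \<eta>]) ps)" if i: "i < ?N" for i
  proof -
    let ?M' = "coef_mat (xs[i := \<eta>]) ps"
    have M': "?M' \<in> carrier_mat ?N ?N" using len by (simp add: coef_mat_def)
    have "mat_delete ?M' i j = mat_delete ?M i j" for j
      by (rule eq_matI) (auto simp: mat_delete_def coef_mat_def len nth_list_update)
    then have "cofactor ?M' i j = cofactor ?M i j" for j
      by (simp add: cofactor_def)
    moreover have "?M' $$ (i, j) = \<eta> $ (ps ! j)" if "j < ?N" for j
      using that i len by (simp add: coef_mat_def)
    ultimately show ?thesis
      unfolding laplace_expansion_row[OF M' i] y_def by simp
  qed
  have "\<exists>z. y i = D * z" if "i < ?N" for i
    using dvd[OF that] y[OF that] unfolding dvd_def by simp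
  then have "\<forall>i\<in>{..<?N}. \<exists>z. y i = D * z" by blast
  from bchoice[OF this] obtain z where z: "\<And>i. i < ?N \<Longrightarrow> y i = D * z i" by blast
  have sum: "(\<Sum>i<?N. y i * xs ! i $ (ps ! l)) = Determinant.det ?M * \<eta> $ (ps ! l)" if l: "l < ?N" for l
  proof -
    have adj: "(\<Sum>i<?N. cofactor ?M i j * xs ! i $ (ps ! l)) = (if j = l then Determinant.det ?M else 0)"
      if j: "j < ?N" for j
    proof -
      have "(adj_mat ?M * ?M) $$ (j, l) = (\<Sum>i<?N. cofactor ?M i j * xs ! i $ (ps ! l))"
        using j l len M by (simp add: adj_mat_def scalar_prod_def lessThan_atLeast0 coef_mat_def)
      then show ?thesis using j l unfolding adj_mat(3)[OF M] by (cases "j = l") simp_all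
    qed
    have "(\<Sum>i<?N. y i * xs ! i $ (ps ! l)) =
        (\<Sum>i<?N. \<Sum>j<?N. \<eta> $ (ps ! j) * (cofactor ?M i j * xs ! i $ (ps ! l)))"
      by (simp add: y_def sum_distrib_right mult.assoc)
    also have "\<dots> = (\<Sum>j<?N. \<eta> $ (ps ! j) * (\<Sum>i<?N. cofactor ?M i j * xs ! i $ (ps ! l)))"
      by (subst sum.swap) (simp add: sum_distrib_left)
    also have "\<dots> = (\<Sum>j<?N. if j = l then \<eta> $ (ps ! l) * Determinant.det ?M else 0)"
      by (intro sum.cong) (auto simp: adj)
    finally show ?thesis using l by (simp add: mult.commute)
  qed
  have "\<eta> = (\<Sum>i<?N. (const (inverse c) * z i) *s xs ! i)"
  proof (rule sext_eqI[OF \<eta> _ ps])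
    show "(\<Sum>i<?N. (const (inverse c) * z i) *s xs ! i) \<in> S_ext_V k"
      using xs len by (intro S_ext_V_sum S_ext_V_scale) auto
    fix l assume l: "l < ?N"
    have "(\<Sum>i<?N. D * (z i * xs ! i $ (ps ! l))) = (\<Sum>i<?N. y i * xs ! i $ (ps ! l))"
      using z by (intro sum.cong) (auto simp: mult.assoc)
    also have "\<dots> = D * (const c * \<eta> $ (ps ! l))" by (simp add: sum[OF l] det mult_ac)
    finally have "D * (\<Sum>i<?N. z i * xs ! i $ (ps ! l)) = D * (const c * \<eta> $ (ps ! l))"
      unfolding sum_distrib_left .
    then have *: "(\<Sum>i<?N. z i * xs ! i $ (ps ! l)) = const c * \<eta> $ (ps ! l)"
      using det(3) unfolding mult_cancel_left by blast
    have "(\<Sum>i<?N. (const (inverse c) * z i) *s xs ! i) $ (ps ! l) =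
        const (inverse c) * (\<Sum>i<?N. z i * xs ! i $ (ps ! l))"
      by (simp add: sum_distrib_left mult.assoc)
    also have "\<dots> = \<eta> $ (ps ! l)"
      unfolding * using det(2) by (simp flip: mult.assoc const_mult)
    finally show "\<eta> $ (ps ! l) = (\<Sum>i<?N. (const (inverse c) * z i) *s xs ! i) $ (ps ! l)" by simp
  qed
  then show ?thesis unfolding len[symmetric] by (rule S_span_I)
qed

text \<open>Multiplying the relation by the adjugate matrix isolates \<open>c r\<close> times the
  determinant, and a domain allows cancelling the latter.\<close>

lemma coef_mat_independent:
  fixes xs :: "('a::field, 'n::{finite, linorder}) sext list"
  assumes len: "length xs = length ps" and det: "Determinant.det (coef_mat xs ps) \<noteq> 0"
    and rel: "(\<Sum>s<length ps. c s *s xs ! s) = 0" and r: "r < length ps"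
  shows "c r = 0"
proof -
  let ?N = "length ps" and ?M = "coef_mat xs ps"
  have M: "?M \<in> carrier_mat ?N ?N" using len by (simp add: coef_mat_def)
  have "(\<Sum>s<?N. c s * ?M $$ (s, j)) = 0" if "j < ?N" for j
  proof -
    have "(\<Sum>s<?N. c s * ?M $$ (s, j)) = (\<Sum>s<?N. c s *s xs ! s) $ (ps ! j)"
      using that len by (simp add: coef_mat_def)
    then show ?thesis by (simp add: rel)
  qed
  then have "0 = (\<Sum>j<?N. (\<Sum>s<?N. c s * ?M $$ (s, j)) * adj_mat ?M $$ (j, r))" by simp
  also have "\<dots> = (\<Sum>j<?N. \<Sum>s<?N. c s * (?M $$ (s, j) * adj_mat ?M $$ (j, r)))"
    by (simp add: sum_distrib_right mult.assoc)
  also have "\<dots> = (\<Sum>s<?N. c s * (\<Sum>j<?N. ?M $$ (s, j) * adj_mat ?M $$ (j, r)))"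
    by (subst sum.swap) (simp add: sum_distrib_left)
  also have "\<dots> = (\<Sum>s<?N. if s = r then c r * Determinant.det ?M else 0)"
  proof (intro sum.cong refl)
    fix s assume s: "s \<in> {..<?N}"
    have "(?M * adj_mat ?M) $$ (s, r) = (\<Sum>j<?N. ?M $$ (s, j) * adj_mat ?M $$ (j, r))"
      using s r len M adj_mat(1)[OF M] by (simp add: scalar_prod_def lessThan_atLeast0)
    then show "c s * (\<Sum>j<?N. ?M $$ (s, j) * adj_mat ?M $$ (j, r)) = (if s = r then c r * Determinant.det ?M else 0)"
      using adj_mat(2)[OF M] s r by auto
  qed
  finally show ?thesis using r det by simp
qed

lemma to_fract_vec_inj: "to_fract_vec \<eta> = to_fract_vec \<theta> \<Longrightarrow> \<eta> = \<theta>"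
  by (simp add: to_fract_vec_def vec_eq_iff)

lemma independent_to_fract_iff:
  fixes xs :: "('a::field, 'n::{finite, linorder}) sext list"
  assumes len: "length xs = length ps" and dist: "distinct xs"
    and ps: "set ps = basis_index k" and xs: "set xs \<subseteq> S_ext_V k"
  shows "vec.independent (to_fract_vec ` set xs) \<longleftrightarrow> Determinant.det (coef_mat xs ps) \<noteq> 0"
proof -
  let ?N = "length ps"
  \<comment> \<open>Transposed, because a relation among rows of the coefficient matrix has to
    become a kernel vector.\<close>
  define M where "M = transpose_mat (map_mat to_fract (coef_mat xs ps))"
  have M: "M \<in> carrier_mat ?N ?N" using len by (simp add: M_def coef_mat_def)
  interpret tf: comm_ring_hom "to_fract :: ('a, 'n) pol \<Rightarrow> _" by unfold_locales auto
  have "Determinant.det M = to_fract (Determinant.det (coef_mat xs ps))"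
    unfolding M_def using len by (subst Determinant.det_transpose[of _ ?N]) (auto simp: coef_mat_def)
  then have d: "Determinant.det (coef_mat xs ps) = 0 \<longleftrightarrow> Determinant.det M = 0" by simp
  let ?f = "\<lambda>s. to_fract_vec (xs ! s)"
  have bij: "bij_betw ?f {..<?N} (to_fract_vec ` set xs)"
  proof (rule bij_betw_imageI)
    show "inj_on ?f {..<?N}"
      using dist len by (auto simp: inj_on_def nth_eq_iff_index_eq dest: to_fract_vec_inj)
    show "?f ` {..<?N} = to_fract_vec ` set xs"
      unfolding len[symmetric] by (auto simp: set_conv_nth)
  qed
  have Mv: "M *\<^sub>v v = 0\<^sub>v ?N \<longleftrightarrow> (\<Sum>s<?N. (vec_index v s) *s ?f s) = 0" if v: "v \<in> carrier_vec ?N" for v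
  proof -
    have on: "vec_index (M *\<^sub>v v) j = (\<Sum>s<?N. (vec_index v s) *s ?f s) $ (ps ! j)" if "j < ?N" for j
      using that v len by (auto simp: M_def coef_mat_def scalar_prod_def lessThan_atLeast0 to_fract_vec_def mult.commute intro!: sum.cong)
    \<comment> \<open>All vectors vanish outside \<open>basis_index k\<close>, so the square matrix
      sees every relation.\<close>
    have off: "(\<Sum>s<?N. (vec_index v s) *s ?f s) $ p = 0" if p: "p \<notin> basis_index k" for p
    proof -
      have "xs ! s $ p = 0" if "s < ?N" for s
      proof -
        have "xs ! s \<in> S_ext_V k" using xs that len nth_mem[of s xs] by auto
        then show ?thesis using p unfolding S_ext_V_def by blast
      qed
      then show ?thesis by (simp add: to_fract_vec_def)
    qed
    show ?thesis
    proof
      assume 0: "M *\<^sub>v v = 0\<^sub>v ?N"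
      have "(\<Sum>s<?N. (vec_index v s) *s ?f s) $ p = 0" for p
      proof (cases "p \<in> basis_index k")
        case True
        then obtain j where "j < ?N" "p = ps ! j" unfolding ps[symmetric] in_set_conv_nth by blast
        then show ?thesis using on[of j] 0 by (simp del: sum_component)
      qed (rule off)
      then show "(\<Sum>s<?N. (vec_index v s) *s ?f s) = 0" unfolding vec_eq_iff zero_index by blast
    next
      assume "(\<Sum>s<?N. (vec_index v s) *s ?f s) = 0"
      then show "M *\<^sub>v v = 0\<^sub>v ?N" using M by (intro eq_vecI) (simp_all add: on del: index_mult_mat_vec sum_component)
    qed
  qed
  have "vec.dependent (to_fract_vec ` set xs) \<longleftrightarrow>
      (\<exists>u. (\<exists>x\<in>to_fract_vec ` set xs. u x \<noteq> 0) \<and> (\<Sum>x\<in>to_fract_vec ` set xs. u x *s x) = 0)"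
    by (rule vec.dependent_finite) simp
  also have "\<dots> \<longleftrightarrow> (\<exists>c. (\<exists>s<?N. c s \<noteq> 0) \<and> (\<Sum>s<?N. c s *s ?f s) = 0)"
  proof
    assume "\<exists>u. (\<exists>x\<in>to_fract_vec ` set xs. u x \<noteq> 0) \<and> (\<Sum>x\<in>to_fract_vec ` set xs. u x *s x) = 0"
    then obtain u x where u: "x \<in> to_fract_vec ` set xs" "u x \<noteq> 0" "(\<Sum>x\<in>to_fract_vec ` set xs. u x *s x) = 0" by blast
    then obtain s where "s < ?N" "x = ?f s" using bij by (auto simp: bij_betw_def)
    then show "\<exists>c. (\<exists>s<?N. c s \<noteq> 0) \<and> (\<Sum>s<?N. c s *s ?f s) = 0"
      using u sum.reindex_bij_betw[OF bij, of "\<lambda>x. u x *s x"] by (intro exI[of _ "\<lambda>s. u (?f s)"]) auto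
  next
    assume "\<exists>c. (\<exists>s<?N. c s \<noteq> 0) \<and> (\<Sum>s<?N. c s *s ?f s) = 0"
    then obtain c s where c: "s < ?N" "c s \<noteq> 0" "(\<Sum>s<?N. c s *s ?f s) = 0" by blast
    let ?u = "\<lambda>x. c (the_inv_into {..<?N} ?f x)"
    have inv: "the_inv_into {..<?N} ?f (?f s) = s" if "s < ?N" for s
      using bij that by (intro the_inv_into_f_f) (auto simp: bij_betw_def)
    have "(\<Sum>x\<in>to_fract_vec ` set xs. ?u x *s x) = (\<Sum>s<?N. ?u (?f s) *s ?f s)"
      by (rule sum.reindex_bij_betw[OF bij, symmetric])
    also have "\<dots> = 0" using c(3) inv by simp
    finally show "\<exists>u. (\<exists>x\<in>to_fract_vec ` set xs. u x \<noteq> 0) \<and> (\<Sum>x\<in>to_fract_vec ` set xs. u x *s x) = 0"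
      using c inv len by (intro exI[of _ ?u] conjI bexI[of _ "?f s"]) auto
  qed
  also have "\<dots> \<longleftrightarrow> (\<exists>v. v \<in> carrier_vec ?N \<and> v \<noteq> 0\<^sub>v ?N \<and> M *\<^sub>v v = 0\<^sub>v ?N)"
  proof
    assume "\<exists>c. (\<exists>s<?N. c s \<noteq> 0) \<and> (\<Sum>s<?N. c s *s ?f s) = 0"
    then obtain c s where c: "s < ?N" "c s \<noteq> 0" "(\<Sum>s<?N. c s *s ?f s) = 0" by blast
    have "Matrix.vec ?N c \<noteq> 0\<^sub>v ?N" using c by (metis index_vec index_zero_vec(1))
    then show "\<exists>v. v \<in> carrier_vec ?N \<and> v \<noteq> 0\<^sub>v ?N \<and> M *\<^sub>v v = 0\<^sub>v ?N"
      using c Mv[of "Matrix.vec ?N c"] by (intro exI[of _ "Matrix.vec ?N c"]) simp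
  next
    assume "\<exists>v. v \<in> carrier_vec ?N \<and> v \<noteq> 0\<^sub>v ?N \<and> M *\<^sub>v v = 0\<^sub>v ?N"
    then obtain v where v: "v \<in> carrier_vec ?N" "v \<noteq> 0\<^sub>v ?N" "M *\<^sub>v v = 0\<^sub>v ?N" by blast
    then have "\<exists>s<?N. vec_index v s \<noteq> 0" by (metis carrier_vecD eq_vecI index_zero_vec)
    then show "\<exists>c. (\<exists>s<?N. c s \<noteq> 0) \<and> (\<Sum>s<?N. c s *s ?f s) = 0"
      using v Mv by (intro exI[of _ "\<lambda>s. vec_index v s"]) auto
  qed
  also have "\<dots> \<longleftrightarrow> Determinant.det (coef_mat xs ps) = 0"
    unfolding d by (rule det_0_iff_vec_prod_zero_field[OF M, symmetric])
  finally show ?thesis by blast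
qed

text \<open>The new coefficient matrix is the entrywise image of the old one times the constant
  matrix of \<open>rho g\<close>. The ring homomorphism \<open>pol_act g\<close> commutes with
  determinants, and the constant matrix is invertible because \<open>g\<close> is.\<close>

lemma det_coef_mat_sext_act:
  fixes xs :: "('a::field, 'n::{finite, linorder}) sext list"
  assumes len: "length xs = length ps" and ps: "set ps = basis_index k" "distinct ps"
    and xs: "set xs \<subseteq> S_ext_V k" and g: "invertible g"
  shows "\<exists>c. c \<noteq> 0 \<and> Determinant.det (coef_mat (map (sext_act g) xs) ps) =
      const c * pol_act g (Determinant.det (coef_mat xs ps))"
proof -
  let ?N = "length ps"
  define R where "R g = Matrix.mat ?N ?N (\<lambda>(i, j). rho g (ps ! j) (ps ! i))" for g :: "('a, 'n) sqmat"
  have R: "R g \<in> carrier_mat ?N ?N" for g by (simp add: R_def)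
  have sumps: "(\<Sum>q\<in>basis_index k. h q) = (\<Sum>i<?N. h (ps ! i))" for h :: "_ \<Rightarrow> 'b::comm_monoid_add"
    unfolding ps(1)[symmetric] using ps(2) by (simp add: sum.distinct_set_conv_list sum_list_sum_nth lessThan_atLeast0)
  \<comment> \<open>The rows hold the coefficients, so \<open>R\<close> is transposed against
    \<open>rho\<close> and reverses products.\<close>
  have mult: "R (g ** h) = R h * R g" if "invertible g" "invertible h" for g h
  proof (rule eq_matI)
    fix i j assume "i < dim_row (R h * R g)" "j < dim_col (R h * R g)"
    then have ij: "i < ?N" "j < ?N" by (simp_all add: R_def)
    have "card (fst (ps ! i)) = k" using ij ps nth_mem[of i ps] by (auto simp: basis_index_def mem_Times_iff)
    then have "rho (g ** h) (ps ! j) (ps ! i) = (\<Sum>r\<in>basis_index k. rho g (ps ! j) r * rho h r (ps ! i))"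
      unfolding rho_mult[OF that]
      by (intro sum.mono_neutral_right) (auto simp: basis_index_def mem_Times_iff rho_eq_0)
    then show "R (g ** h) $$ (i, j) = (R h * R g) $$ (i, j)"
      using ij by (simp add: R_def scalar_prod_def sumps lessThan_atLeast0 mult.commute)
  qed (simp_all add: R_def)
  have one: "R (Finite_Cartesian_Product.mat 1) = 1\<^sub>m ?N"
    by (rule eq_matI) (use ps(2) in \<open>auto simp: R_def rho_1 nth_eq_iff_index_eq\<close>)
  have "R (g ** matrix_inv g) = R (matrix_inv g) * R g"
    using g by (intro mult invertible_matrix_inv)
  then have "Determinant.det (R (matrix_inv g)) * Determinant.det (R g) = 1"
    using one det_mult[OF R R, of "matrix_inv g" g] matrix_inv_props(1)[OF g] by (metis det_one)
  then have nz: "Determinant.det (R g) \<noteq> 0" by auto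
  let ?A = "map_mat (pol_act g) (coef_mat xs ps)" and ?B = "map_mat const (R g)"
  have AB: "?A \<in> carrier_mat ?N ?N" "?B \<in> carrier_mat ?N ?N" using len by (simp_all add: coef_mat_def R_def)
  have "coef_mat (map (sext_act g) xs) ps = ?A * ?B"
  proof (rule eq_matI)
    fix i j assume "i < dim_row (?A * ?B)" "j < dim_col (?A * ?B)"
    then have ij: "i < ?N" "j < ?N" using len by (simp_all add: R_def coef_mat_def)
    have "xs ! i \<in> S_ext_V k" using xs ij len by auto
    then have 0: "xs ! i $ q = 0" if "q \<notin> basis_index k" for q using that unfolding S_ext_V_def by blast
    have "sext_act g (xs ! i) $ (ps ! j) = (\<Sum>q\<in>basis_index k. pol_act g (xs ! i $ q) * const (rho g (ps ! j) q))"
      unfolding sext_act_nth by (intro sum.mono_neutral_right) (auto simp: 0)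
    then show "coef_mat (map (sext_act g) xs) ps $$ (i, j) = (?A * ?B) $$ (i, j)"
      using ij len by (simp add: coef_mat_def R_def scalar_prod_def sumps lessThan_atLeast0)
  qed (simp_all add: R_def coef_mat_def)
  then have "Determinant.det (coef_mat (map (sext_act g) xs) ps) =
      const (Determinant.det (R g)) * pol_act g (Determinant.det (coef_mat xs ps))"
    using det_mult[OF AB] by (simp add: mult.commute)
  then show ?thesis using nz by blast
qed

lemma homogeneous_det_coef_mat:
  fixes xs :: "('a::field, 'n::{finite, linorder}) sext list"
  assumes len: "length xs = length ps" and hom: "\<And>r. r < length ps \<Longrightarrow> homogeneous (d r) (xs ! r)"
  shows "homogeneous_pol (\<Sum>r<length ps. d r) (Determinant.det (coef_mat xs ps))"
proof -
  let ?N = "length ps"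
  have M: "coef_mat xs ps \<in> carrier_mat ?N ?N" using len by (simp add: coef_mat_def)
  show ?thesis unfolding det_def'[OF M]
  proof (rule homogeneous_pol_sum)
    fix p assume "p \<in> {p. p permutes {0..<?N}}"
    then have p: "p permutes {0..<?N}" by simp
    have "homogeneous_pol (\<Sum>r=0..<?N. d r) (\<Prod>i=0..<?N. coef_mat xs ps $$ (i, p i))"
    proof (rule homogeneous_pol_prod)
      fix i assume i: "i \<in> {0..<?N}"
      then have "p i < ?N" using permutes_in_image[OF p, of i] by simp
      then show "homogeneous_pol (d i) (coef_mat xs ps $$ (i, p i))"
        using hom[of i] i len unfolding homogeneous_def by (simp add: coef_mat_def del: split_paired_All)
    qed
    moreover have "homogeneous_pol 0 (signof p :: ('a, 'n) pol)"
      using homogeneous_pol_const[of 1] homogeneous_pol_const[of "-1"]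
      by (auto simp: sign_def const_minus)
    ultimately show "homogeneous_pol (\<Sum>r<?N. d r) (signof p * (\<Prod>i=0..<?N. coef_mat xs ps $$ (i, p i)))"
      using homogeneous_pol_mult by (fastforce simp: lessThan_atLeast0)
  qed
qed

text \<open>A permutation contributing to the determinant cannot decrease the layer, so it preserves
  every layer, where the matrix is diagonal.\<close>

lemma det_layered:
  fixes f :: "'i \<Rightarrow> 'i \<Rightarrow> 'r::comm_ring_1" and layer :: "'i \<Rightarrow> nat"
  assumes "distinct ps"
    and zero: "\<And>p q. p \<in> set ps \<Longrightarrow> q \<in> set ps \<Longrightarrow> p \<noteq> q \<Longrightarrow> layer q \<le> layer p \<Longrightarrow> f p q = 0"
  shows "Determinant.det (Matrix.mat (length ps) (length ps) (\<lambda>(i, j). f (ps ! i) (ps ! j))) = (\<Prod>p\<in>set ps. f p p)"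
proof -
  let ?N = "length ps" and ?M = "Matrix.mat (length ps) (length ps) (\<lambda>(i, j). f (ps ! i) (ps ! j))"
  have z: "(\<Prod>i=0..<?N. ?M $$ (i, \<pi> i)) = 0" if \<pi>: "\<pi> permutes {0..<?N}" and "\<pi> \<noteq> id" for \<pi>
  proof (rule ccontr)
    assume nz: "(\<Prod>i=0..<?N. ?M $$ (i, \<pi> i)) \<noteq> 0"
    have lt: "\<pi> i < ?N" if "i < ?N" for i using permutes_in_image[OF \<pi>, of i] that by simp
    have nzi: "f (ps ! i) (ps ! \<pi> i) \<noteq> 0" if "i < ?N" for i
    proof
      assume "f (ps ! i) (ps ! \<pi> i) = 0"
      then have "(\<Prod>i=0..<?N. ?M $$ (i, \<pi> i)) = 0"
        using that lt[OF that] by (intro prod_zero) (auto intro!: bexI[of _ i])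
      then show False using nz by blast
    qed
    have le: "layer (ps ! i) \<le> layer (ps ! \<pi> i)" if "i < ?N" for i
      using zero[of "ps ! i" "ps ! \<pi> i"] nzi[OF that] lt[OF that] that by (metis le_cases nth_mem)
    have sum: "(\<Sum>i=0..<?N. layer (ps ! i)) = (\<Sum>i=0..<?N. layer (ps ! \<pi> i))"
      by (rule sum.permute[OF \<pi>, unfolded o_def])
    have eq: "layer (ps ! i) = layer (ps ! \<pi> i)" if "i < ?N" for i
    proof (rule ccontr)
      assume "layer (ps ! i) \<noteq> layer (ps ! \<pi> i)"
      then have "layer (ps ! i) < layer (ps ! \<pi> i)" using le that by (simp add: less_le)
      then have "(\<Sum>i=0..<?N. layer (ps ! i)) < (\<Sum>i=0..<?N. layer (ps ! \<pi> i))"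
        using le that by (intro sum_strict_mono_ex1) auto
      then show False using sum by simp
    qed
    have "\<pi> i = i" for i
    proof (cases "i < ?N")
      case True
      then have "ps ! i = ps ! \<pi> i"
        using zero[of "ps ! i" "ps ! \<pi> i"] nzi[OF True] eq[OF True] lt[OF True] True
        by (metis order_refl nth_mem)
      then show ?thesis using assms(1) True lt[OF True] by (simp add: nth_eq_iff_index_eq)
    next
      case False
      then show ?thesis using permutes_not_in[OF \<pi>, of i] by simp
    qed
    then show False using \<open>\<pi> \<noteq> id\<close> by auto
  qed
  have 0: "\<forall>\<pi>\<in>{\<pi>. \<pi> permutes {0..<?N}} - {id}. signof \<pi> * (\<Prod>i=0..<?N. ?M $$ (i, \<pi> i)) = 0"
  proof
    fix \<pi> assume "\<pi> \<in> {\<pi>. \<pi> permutes {0..<?N}} - {id}"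
    then have "\<pi> permutes {0..<?N}" "\<pi> \<noteq> id" by auto
    then have "(\<Prod>i=0..<?N. ?M $$ (i, \<pi> i)) = 0" by (rule z)
    then show "signof \<pi> * (\<Prod>i=0..<?N. ?M $$ (i, \<pi> i)) = 0" by (simp only: mult_zero_right)
  qed
  have "Determinant.det ?M = (\<Sum>\<pi> | \<pi> permutes {0..<?N}. signof \<pi> * (\<Prod>i=0..<?N. ?M $$ (i, \<pi> i)))"
    by (rule det_def') simp
  also have "\<dots> = (\<Sum>\<pi>\<in>{id}. signof \<pi> * (\<Prod>i=0..<?N. ?M $$ (i, \<pi> i)))"
    by (rule sum.mono_neutral_right[OF _ _ 0]) (simp_all add: finite_permutations permutes_id)
  also have "\<dots> = (\<Prod>i=0..<?N. f (ps ! i) (ps ! i))" by simp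
  also have "\<dots> = (\<Prod>p\<in>set ps. f p p)"
    using prod.reindex_bij_betw[OF bij_betw_nth[OF assms(1) refl refl], of "\<lambda>p. f p p"]
    by (simp add: lessThan_atLeast0)
  finally show ?thesis .
qed

section \<open>Groups fixing the hyperplane of a coordinate form\<close>

text \<open>Fixes every \<open>v_j\<close> with \<open>j \<noteq> z\<close> and sends
  \<open>v_z\<close> to \<open>c (v_z + u)\<close>; for \<open>u $ z = 0\<close> this is the
  diagonal map \<open>v_z -> c v_z\<close> followed by the transvection with root \<open>u\<close>.
  With \<open>u\<close> inside the scaling, the dual action \<open>x_i -> x_i - u_i x_z\<close> for
  \<open>i \<noteq> z\<close> does not depend on \<open>c\<close>.\<close>

definition smat :: "'n \<Rightarrow> 'a \<Rightarrow> ('a, 'n) space \<Rightarrow> ('a::field, 'n::finite) sqmat" where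
  "smat z c u = (\<chi> i j. if j = z then c * (axis z 1 + u) $ i else if i = j then 1 else 0)"

lemma matrix_vector_mult_axis: "(A *v axis j 1) $ i = (A :: ('a::field, 'n::finite) sqmat) $ i $ j"
  by (simp add: matrix_vector_mult_def axis_def if_distrib cong: if_cong)

lemma smat_eqI:
  assumes "\<And>j. j \<noteq> z \<Longrightarrow> s *v axis j 1 = axis j 1" "s *v axis z 1 = c *s (axis z 1 + u)"
  shows "s = smat z c u"
proof -
  have "s $ i $ j = smat z c u $ i $ j" for i j
    using assms(1)[of j] assms(2) unfolding matrix_vector_mult_axis[symmetric, of s]
    by (cases "j = z") (auto simp: smat_def axis_def distrib_left)
  then show ?thesis by (simp add: vec_eq_iff)
qed

lemma smat_mult_axis:
  "smat z c u *v axis j 1 = (if j = z then c *s (axis z 1 + u) else axis j 1)"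
  by (auto simp: vec_eq_iff matrix_vector_mult_axis) (auto simp: smat_def axis_def distrib_left)

lemma smat_1_0 [simp]: "smat z 1 0 = Finite_Cartesian_Product.mat 1"
  by (rule smat_eqI[symmetric]) simp_all

lemma smat_mult_vec:
  assumes "u $ z = 0"
  shows "smat z c u *v v = v + ((c - 1) * v $ z) *s axis z 1 + (c * v $ z) *s u"
proof -
  have "(smat z c u *v v) $ i = (v + ((c - 1) * v $ z) *s axis z 1 + (c * v $ z) *s u) $ i" for i
  proof -
    have "(smat z c u *v v) $ i = smat z c u $ i $ z * v $ z + (\<Sum>j\<in>UNIV - {z}. smat z c u $ i $ j * v $ j)"
      by (simp add: matrix_vector_mult_def sum.remove[of UNIV z])
    also have "(\<Sum>j\<in>UNIV - {z}. smat z c u $ i $ j * v $ j) = (\<Sum>j\<in>UNIV - {z}. if j = i then v $ i else 0)"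
      by (intro sum.cong) (auto simp: smat_def)
    also have "\<dots> = (if i = z then 0 else v $ i)" by simp
    finally show ?thesis using assms by (auto simp: smat_def axis_def algebra_simps)
  qed
  then show ?thesis by (simp add: vec_eq_iff)
qed

lemma invertible_smat:
  assumes "c \<noteq> 0" "u $ z = 0" shows "invertible (smat z c u)"
proof -
  \<comment> \<open>The product sends \<open>v_z\<close> to \<open>a b v_z + b (a v + w)\<close>, so
    the two equations say that it is the identity.\<close>
  have inv: "smat z a v ** smat z b w = Finite_Cartesian_Product.mat 1"
    if "a * b = 1" "a *s v + w = 0" "v $ z = 0" "w $ z = 0" for a b :: 'a and v w :: "('a, 'b) space"
  proof -
    have "smat z a v ** smat z b w = smat z 1 0"
    proof (rule smat_eqI)
      fix j assume "j \<noteq> z"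
      then show "(smat z a v ** smat z b w) *v axis j 1 = axis j 1"
        by (simp add: smat_mult_axis flip: matrix_vector_mul_assoc)
    next
      have "smat z a v *v (b *s (axis z 1 + w)) = axis z 1"
      proof -
        have "(smat z a v *v (b *s (axis z 1 + w))) $ i = axis z 1 $ i" for i
        proof -
          have "(smat z a v *v (b *s (axis z 1 + w))) $ i = (a * b) * axis z 1 $ i + b * (a * v $ i + w $ i)"
            using that by (simp add: smat_mult_vec axis_def algebra_simps)
          moreover have "a * v $ i + w $ i = 0" using that(2) by (simp add: vec_eq_iff)
          ultimately show ?thesis using that(1) by simp
        qed
        then show ?thesis by (simp add: vec_eq_iff)
      qed
      also have "\<dots> = 1 *s (axis z 1 + 0)" by simp
      finally show "(smat z a v ** smat z b w) *v axis z 1 = 1 *s (axis z 1 + 0)"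
        by (simp add: smat_mult_axis flip: matrix_vector_mul_assoc)
    qed
    then show ?thesis by simp
  qed
  show ?thesis unfolding invertible_def
    using inv[where a = c and b = "inverse c" and v = u and w = "- (c *s u)"]
      inv[where a = "inverse c" and b = c and v = "- (c *s u)" and w = u] assms
    by (intro exI[of _ "smat z (inverse c) (- (c *s u))"]) (simp add: vec_eq_iff)
qed

lemma vector_matrix_mult_smat:
  assumes "u $ z = 0"
  shows "(r v* smat z c u) $ j = (if j = z then c * (r $ z + (\<Sum>i\<in>UNIV. r $ i * u $ i)) else r $ j)"
proof (cases "j = z")
  case True
  have "(r v* smat z c u) $ z = (\<Sum>i\<in>UNIV. (if i = z then c * r $ z else 0) + c * (r $ i * u $ i))"
    unfolding vector_matrix_mult_def by (auto simp: smat_def axis_def algebra_simps intro!: sum.cong)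
  then show ?thesis using True by (simp add: sum.distrib sum_distrib_left algebra_simps)
next
  case False
  have "(r v* smat z c u) $ j = (\<Sum>i\<in>UNIV. if i = j then r $ j else 0)"
    unfolding vector_matrix_mult_def vec_lambda_beta
  proof (intro sum.cong refl)
    show "r $ i * smat z c u $ i $ j = (if i = j then r $ j else 0)" for i
      using False by (simp add: smat_def)
  qed
  then show ?thesis using False by simp
qed

lemma dual_act_smat:
  assumes "c \<noteq> 0" "u $ z = 0"
  shows "dual_act (smat z c u) (axis i 1) = (if i = z then (1 / c) *s axis z 1 else axis i 1 - (u $ i) *s axis z 1)"
proof (rule dual_act_eqI[OF invertible_smat[OF assms]])
  let ?r = "if i = z then (1 / c) *s axis z 1 else axis i 1 - (u $ i) *s axis z 1"
  have "?r $ j * u $ j = (if j = i then u $ i else 0)" for j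
    using assms by (auto simp: axis_def)
  then have S: "(\<Sum>j\<in>UNIV. ?r $ j * u $ j) = u $ i" by simp
  have "(?r v* smat z c u) $ j = axis i 1 $ j" for j
    unfolding vector_matrix_mult_smat[OF assms(2)] S using assms by (auto simp: axis_def)
  then show "?r v* smat z c u = axis i 1" unfolding vec_eq_iff by blast
qed

lemma pol_act_smat_var:
  assumes "c \<noteq> 0" "u $ z = 0"
  shows "pol_act (smat z c u) (var i) = (if i = z then const (1 / c) * var z else var i - const (u $ i) * var z)"
  using assms by (simp add: pol_act_var dual_act_smat lin_form_scale lin_form_diff)

lemma wedge_axis_axis:
  "wedge (axis {i} 1) (axis J (1::'a::field)) = (if i \<in> J then 0 else shuffle_sign {i} J *s axis (insert i J) 1)"
  using wedge_one_form_family[of "\<lambda>i. axis i (1::'a)" i J] by (simp add: one_form_axis wedge_family_axis)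

text \<open>In the expansion of the product of the forms \<open>x_i - u_i x_z\<close> two factors
  \<open>x_z\<close> annihilate each other, so at most one factor is replaced. The new
  \<open>x_z\<close> is moved to the front, which is its place because \<open>z\<close> is the least
  index; this produces the sign.\<close>

lemma wedge_family_smat_notin:
  fixes u :: "('a::field, 'n::{finite, linorder}) space"
  assumes z: "\<And>i. z \<le> i" and "c \<noteq> 0" "u $ z = 0" and "z \<notin> I"
  shows "wedge_family (\<lambda>i. dual_act (smat z c u) (axis i 1)) I =
    axis I 1 - (\<Sum>i\<in>I. (u $ i * shuffle_sign {i} (I - {i})) *s axis (insert z (I - {i})) 1)"
proof -
  have "finite I" by simp
  then show ?thesis using \<open>z \<notin> I\<close>
  proof (induction I rule: finite_linorder_min_induct)
    case (insert a J)
    let ?W = "wedge_family (\<lambda>i. dual_act (smat z c u) (axis i 1))"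
    have aJ: "a \<notin> J" and zJ: "z \<notin> J" and az: "a \<noteq> z" using insert by auto
    have za: "z < a" using z[of a] az by simp
    have sa: "shuffle_sign {a} J = (1::'a)" "shuffle_sign {z} J = (1::'a)"
      using insert.hyps z by (blast intro: shuffle_sign_min less_imp_le)+
    have sa': "shuffle_sign {a} (insert z (J - {i})) = (-1::'a)" for i
      using za zJ insert.hyps by (subst shuffle_sign_insert_less) (auto intro!: shuffle_sign_min less_imp_le)
    have si: "shuffle_sign {i} (insert a J - {i}) = - (shuffle_sign {i} (J - {i}) :: 'a)" if "i \<in> J" for i
    proof -
      have "insert a J - {i} = insert a (J - {i})" using that aJ by auto
      then show ?thesis using that insert.hyps aJ by (simp add: shuffle_sign_insert_less)
    qed
    have ins: "insert z (insert a J - {i}) = insert a (insert z (J - {i}))" if "i \<in> J" for i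
      using that aJ by auto
    have f: "one_form (dual_act (smat z c u) (axis a 1)) = axis {a} 1 - (u $ a) *s axis {z} 1"
    proof -
      have "one_form (x - y) = one_form x - one_form y" for x y :: "('a, 'n) space"
        using one_form_add[of "x - y" y] by simp
      then show ?thesis using assms az by (simp add: dual_act_smat one_form_scale one_form_axis)
    qed
    have wdl: "wedge (x - y) \<omega> = wedge x \<omega> - wedge y \<omega>" and wdr: "wedge \<omega> (x - y) = wedge \<omega> x - wedge \<omega> y"
      for x y \<omega> :: "('a, 'n) ext"
      using wedge_add_left[of "x - y" y \<omega>] wedge_add_right[of \<omega> "x - y" y] by simp_all
    have "?W (insert a J) = wedge (axis {a} 1 - (u $ a) *s axis {z} 1)
       (axis J 1 - (\<Sum>i\<in>J. (u $ i * shuffle_sign {i} (J - {i})) *s axis (insert z (J - {i})) 1))"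
      using insert zJ by (subst wedge_family_insert_min) (simp_all add: f)
    also have "\<dots> = axis (insert a J) 1 - (\<Sum>i\<in>J. (u $ i * shuffle_sign {i} (J - {i})) *s ((-1) *s axis (insert a (insert z (J - {i}))) 1))
        - (u $ a) *s axis (insert z J) 1"
      using aJ zJ az by (simp add: wdl wdr wedge_sum_right wedge_scale_left wedge_scale_right wedge_axis_axis sa sa')
    also have "(\<Sum>i\<in>J. (u $ i * shuffle_sign {i} (J - {i})) *s ((-1) *s axis (insert a (insert z (J - {i}))) (1::'a))) =
        (\<Sum>i\<in>J. (u $ i * shuffle_sign {i} (insert a J - {i})) *s axis (insert z (insert a J - {i})) 1)"
      by (intro sum.cong) (simp_all add: si ins vec_eq_iff)
    finally show ?case using aJ insert.hyps(1) by (simp add: sa)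
  qed simp
qed

text \<open>The factor \<open>x_z\<close> stands first, and each correction term of the other
  factors contains \<open>x_z\<close> once more.\<close>

lemma wedge_family_smat_in:
  fixes u :: "('a::field, 'n::{finite, linorder}) space"
  assumes z: "\<And>i. z \<le> i" and "c \<noteq> 0" "u $ z = 0" and "z \<in> I"
  shows "wedge_family (\<lambda>i. dual_act (smat z c u) (axis i 1)) I = (1 / c) *s axis I 1"
proof -
  let ?J = "I - {z}"
  let ?W = "wedge_family (\<lambda>i. dual_act (smat z c u) (axis i 1))"
  have I: "insert z ?J = I" using assms by auto
  have lt: "z < j" if "j \<in> ?J" for j using that z[of j] by auto
  have f: "one_form (dual_act (smat z c u) (axis z 1)) = (1 / c) *s axis {z} 1"
    using assms by (simp add: dual_act_smat one_form_scale one_form_axis)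
  have s: "shuffle_sign {z} ?J = (1::'a)" using lt by (blast intro: shuffle_sign_min less_imp_le)
  have J: "?W ?J = axis ?J 1 - (\<Sum>i\<in>?J. (u $ i * shuffle_sign {i} (?J - {i})) *s axis (insert z (?J - {i})) 1)"
    by (rule wedge_family_smat_notin[OF z assms(2,3)]) simp
  have wdr: "wedge \<omega> (x - y) = wedge \<omega> x - wedge \<omega> y" for x y \<omega> :: "('a, 'n) ext"
    using wedge_add_right[of \<omega> "x - y" y] by simp
  have "?W (insert z ?J) = wedge ((1 / c) *s axis {z} 1) (axis ?J 1 - (\<Sum>i\<in>?J. (u $ i * shuffle_sign {i} (?J - {i})) *s axis (insert z (?J - {i})) 1))"
    using lt by (subst wedge_family_insert_min) (simp_all only: f J)
  also have "\<dots> = (1 / c) *s axis (insert z ?J) 1"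
    using lt by (simp add: wdr wedge_sum_right wedge_scale_left wedge_scale_right wedge_axis_axis s)
  finally show ?thesis unfolding I .
qed

text \<open>The vector part of the action in coordinates; \<open>form_coord_act\<close> is the part
  of the exterior algebra. \<open>F\<close> and \<open>h\<close> stand for polynomial coefficients
  that have already been transformed, so the three tensor factors are treated separately.\<close>

definition vec_coord_act :: "'n \<Rightarrow> 'a \<Rightarrow> ('a, 'n) space \<Rightarrow> ('n \<Rightarrow> ('a::field, 'n::{finite, linorder}) pol) \<Rightarrow> 'n \<Rightarrow> ('a, 'n) pol" where
  "vec_coord_act z c u F l = (if l = z then const c * F z else F l + const (c * u $ l) * F z)"

definition form_coord_act :: "'n \<Rightarrow> 'a \<Rightarrow> ('a, 'n) space \<Rightarrow> ('n set \<Rightarrow> ('a::field, 'n::{finite, linorder}) pol) \<Rightarrow> 'n set \<Rightarrow> ('a, 'n) pol" where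
  "form_coord_act z c u h K = (if z \<notin> K then h K else const (1 / c) * h K -
     (\<Sum>i\<in>-K. const (u $ i * shuffle_sign {i} (K - {z})) * h (insert i (K - {z}))))"

lemma sum_wedge_family_smat:
  fixes u :: "('a::field, 'n::{finite, linorder}) space"
  assumes z: "\<And>i. z \<le> i" and c: "c \<noteq> 0" "u $ z = 0"
  shows "(\<Sum>I\<in>UNIV. const (wedge_family (\<lambda>i. dual_act (smat z c u) (axis i 1)) I $ K) * h I) = form_coord_act z c u h K"
proof -
  let ?W = "wedge_family (\<lambda>i. dual_act (smat z c u) (axis i 1))"
  let ?t = "\<lambda>I i. if z \<notin> I \<and> i \<in> I \<and> K = insert z (I - {i}) then const (u $ i * shuffle_sign {i} (I - {i})) * h I else 0"
  have W: "const (?W I $ K) * h I = (if I = K then (if z \<in> K then const (1 / c) else 1) * h K else 0) - (\<Sum>i\<in>UNIV. ?t I i)" for I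
  proof (cases "z \<in> I")
    case True
    then have "?W I $ K = (if I = K then 1 / c else 0)"
      unfolding wedge_family_smat_in[OF z c True] by (auto simp: axis_def)
    then show ?thesis using True by auto
  next
    case False
    have "?W I $ K = (if I = K then 1 else 0) -
        (\<Sum>i\<in>I. u $ i * shuffle_sign {i} (I - {i}) * (if K = insert z (I - {i}) then 1 else 0))"
      unfolding wedge_family_smat_notin[OF z c False] by (auto simp: axis_def)
    then have "const (?W I $ K) * h I = (if I = K then h K else 0) -
        (\<Sum>i\<in>I. const (u $ i * shuffle_sign {i} (I - {i}) * (if K = insert z (I - {i}) then 1 else 0)) * h I)"
      by (simp add: const_diff const_hom.hom_sum left_diff_distrib sum_distrib_right)
    also have "(\<Sum>i\<in>I. const (u $ i * shuffle_sign {i} (I - {i}) * (if K = insert z (I - {i}) then 1 else 0)) * h I) = (\<Sum>i\<in>UNIV. ?t I i)"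
      using False by (intro sum.mono_neutral_cong_left) auto
    finally show ?thesis using False by auto
  qed
  have "(\<Sum>I\<in>UNIV. const (?W I $ K) * h I) = (if z \<in> K then const (1 / c) else 1) * h K - (\<Sum>I\<in>UNIV. \<Sum>i\<in>UNIV. ?t I i)"
    unfolding W by (simp add: sum_subtractf)
  also have "(\<Sum>I\<in>UNIV. \<Sum>i\<in>UNIV. ?t I i) = (\<Sum>i\<in>UNIV. \<Sum>I\<in>UNIV. ?t I i)" by (rule sum.swap)
  also have "\<dots> = (\<Sum>i\<in>UNIV. if z \<in> K \<and> i \<notin> K then const (u $ i * shuffle_sign {i} (K - {z})) * h (insert i (K - {z})) else 0)"
  proof (intro sum.cong refl)
    fix i
    show "(\<Sum>I\<in>UNIV. ?t I i) = (if z \<in> K \<and> i \<notin> K then const (u $ i * shuffle_sign {i} (K - {z})) * h (insert i (K - {z})) else 0)"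
    proof (cases "z \<in> K \<and> i \<notin> K")
      case True
      \<comment> \<open>For given \<open>K\<close> and \<open>i\<close> a single set contributes,
        namely \<open>K\<close> with \<open>z\<close> exchanged for \<open>i\<close>.\<close>
      then have eq: "z \<notin> I \<and> i \<in> I \<and> K = insert z (I - {i}) \<longleftrightarrow> I = insert i (K - {z})" for I by auto
      have "insert i (K - {z}) - {i} = K - {z}" using True by auto
      then have "(\<Sum>I\<in>UNIV. ?t I i) = (\<Sum>I\<in>UNIV. if I = insert i (K - {z}) then const (u $ i * shuffle_sign {i} (K - {z})) * h (insert i (K - {z})) else 0)"
        unfolding eq by (intro sum.cong) auto
      then show ?thesis using True by simp
    next
      case False
      then have "?t I i = 0" for I by (auto simp: c(2))
      then show ?thesis using False by auto
    qed
  qed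
  also have "\<dots> = (if z \<in> K then \<Sum>i\<in>-K. const (u $ i * shuffle_sign {i} (K - {z})) * h (insert i (K - {z})) else 0)"
    by (cases "z \<in> K") (auto intro!: sum.mono_neutral_cong_right)
  finally show ?thesis by (simp add: form_coord_act_def)
qed

lemma sext_act_smat:
  fixes u :: "('a::field, 'n::{finite, linorder}) space"
  assumes z: "\<And>i. z \<le> i" and c: "c \<noteq> 0" "u $ z = 0"
  shows "sext_act (smat z c u) \<eta> $ (K, l) =
    form_coord_act z c u (\<lambda>I. vec_coord_act z c u (\<lambda>j. pol_act (smat z c u) (\<eta> $ (I, j))) l) K"
proof -
  let ?W = "wedge_family (\<lambda>i. dual_act (smat z c u) (axis i 1))" and ?F = "\<lambda>I j. pol_act (smat z c u) (\<eta> $ (I, j))"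
  have v: "(\<Sum>j\<in>UNIV. const (smat z c u $ l $ j) * F j) = vec_coord_act z c u F l" for F :: "'n \<Rightarrow> ('a, 'n) pol"
  proof -
    have "(\<Sum>j\<in>UNIV. const (smat z c u $ l $ j) * F j) =
       const (smat z c u $ l $ z) * F z + (\<Sum>j\<in>UNIV - {z}. if j = l then F l else 0)"
    proof -
      have r: "(\<Sum>j\<in>UNIV - {z}. const (smat z c u $ l $ j) * F j) = (\<Sum>j\<in>UNIV - {z}. if j = l then F l else 0)"
        by (intro sum.cong) (auto simp: smat_def)
      show ?thesis by (subst sum.remove[of UNIV z]) (simp_all only: r finite UNIV_I)
    qed
    then show ?thesis using c by (auto simp: vec_coord_act_def smat_def axis_def)
  qed
  have "sext_act (smat z c u) \<eta> $ (K, l) = (\<Sum>(I, j)\<in>UNIV \<times> UNIV. ?F I j * const (?W I $ K * smat z c u $ l $ j))"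
    unfolding sext_act_nth by (intro sum.cong) (auto simp: rho_def)
  also have "\<dots> = (\<Sum>I\<in>UNIV. \<Sum>j\<in>UNIV. ?F I j * const (?W I $ K * smat z c u $ l $ j))"
    by (rule sum.cartesian_product[symmetric])
  also have "\<dots> = (\<Sum>I\<in>UNIV. const (?W I $ K) * (\<Sum>j\<in>UNIV. const (smat z c u $ l $ j) * ?F I j))"
    by (simp add: sum_distrib_left const_mult mult_ac)
  finally show ?thesis unfolding v sum_wedge_family_smat[OF assms] .
qed

text \<open>The map is the identity on the hyperplane \<open>x_z = 0\<close>. On products the defect
  obeys a twisted Leibniz rule, so the generators suffice.\<close>

lemma var_dvd_diff_pol_act_smat:
  assumes "c \<noteq> 0" "u $ z = 0"
  shows "var z dvd f - pol_act (smat z c u) f"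
proof (induction f rule: pol_induct)
  case (var i)
  have "var z - const (1 / c) * var z = var z * (1 - const (1 / c))" by (simp add: algebra_simps)
  then show ?case using assms by (auto simp: pol_act_smat_var)
next
  case (add f g)
  then show ?case using dvd_add[OF add] by (simp add: pol_act.hom_add algebra_simps)
next
  case (mult f g)
  let ?a = "pol_act (smat z c u)"
  have "f * g - ?a f * ?a g = (f - ?a f) * g + ?a f * (g - ?a g)" by (simp add: algebra_simps)
  then show ?case using mult by (simp add: pol_act.hom_mult)
qed simp

text \<open>First-order Taylor expansion, with the partial derivatives of \<open>f\<close> as
  \<open>d\<close>. The point is that one \<open>d\<close> serves all \<open>u\<close>: modulo
  \<open>x_z^2\<close> the difference is linear in \<open>u\<close>.\<close>

lemma pol_act_smat_taylor:
  fixes f :: "('a::field, 'n::finite) pol"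
  shows "\<exists>d. \<forall>u. u $ z = 0 \<longrightarrow> var z ^ 2 dvd f - pol_act (smat z 1 u) f - var z * (\<Sum>i\<in>UNIV. const (u $ i) * d i)"
proof (induction f rule: pol_induct)
  case (const c)
  show ?case by (rule exI[of _ "\<lambda>_. 0"]) simp
next
  case (var i)
  have S: "(\<Sum>j\<in>UNIV. const (u $ j) * (if j = i then 1 else 0)) = const (u $ i)" for u :: "('a, 'n) space"
    by (simp add: if_distrib cong: if_cong)
  then show ?case
    by (intro exI[of _ "\<lambda>j. if j = i then 1 else 0"]) (auto simp only: S, auto simp: pol_act_smat_var mult.commute)
next
  case (add f g)
  then obtain d d' where "\<And>u. u $ z = 0 \<Longrightarrow> var z ^ 2 dvd f - pol_act (smat z 1 u) f - var z * (\<Sum>i\<in>UNIV. const (u $ i) * d i)"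
    "\<And>u. u $ z = 0 \<Longrightarrow> var z ^ 2 dvd g - pol_act (smat z 1 u) g - var z * (\<Sum>i\<in>UNIV. const (u $ i) * d' i)"
    by blast
  from dvd_add[OF this] show ?case
    by (intro exI[of _ "\<lambda>i. d i + d' i"]) (simp add: pol_act.hom_add sum.distrib algebra_simps)
next
  case (mult f g)
  then obtain d d' where d: "\<And>u. u $ z = 0 \<Longrightarrow> var z ^ 2 dvd f - pol_act (smat z 1 u) f - var z * (\<Sum>i\<in>UNIV. const (u $ i) * d i)"
    and d': "\<And>u. u $ z = 0 \<Longrightarrow> var z ^ 2 dvd g - pol_act (smat z 1 u) g - var z * (\<Sum>i\<in>UNIV. const (u $ i) * d' i)"
    by blast
  show ?case
  proof (intro exI[of _ "\<lambda>i. d i * g + f * d' i"] allI impI)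
    fix u :: "('a, 'n) space" assume u: "u $ z = 0"
    let ?a = "pol_act (smat z 1 u)"
    let ?s = "\<Sum>i\<in>UNIV. const (u $ i) * d i" and ?s' = "\<Sum>i\<in>UNIV. const (u $ i) * d' i"
    have sum: "(\<Sum>i\<in>UNIV. const (u $ i) * (d i * g + f * d' i)) = ?s * g + f * ?s'"
      by (simp add: sum_distrib_left sum_distrib_right sum.distrib algebra_simps)
    have sq: "var z ^ 2 dvd (f - ?a f) * (g - ?a g)"
      unfolding power2_eq_square using u by (intro mult_dvd_mono var_dvd_diff_pol_act_smat) auto
    have eq: "f * g - ?a (f * g) - var z * (?s * g + f * ?s') =
        (f - ?a f - var z * ?s) * g + f * (g - ?a g - var z * ?s') - (f - ?a f) * (g - ?a g)"
      by (simp add: pol_act.hom_mult algebra_simps)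
    show "var z ^ 2 dvd f * g - ?a (f * g) - var z * (\<Sum>i\<in>UNIV. const (u $ i) * (d i * g + f * d' i))"
      unfolding sum eq by (rule dvd_diff[OF dvd_add[OF dvd_mult2[OF d[OF u]] dvd_mult[OF d'[OF u]]] sq])
  qed
qed

lemma vec_coord_act_mult: "vec_coord_act z c u (\<lambda>j. f * F j) l = f * vec_coord_act z c u F l"
  by (simp add: vec_coord_act_def algebra_simps)

lemma form_coord_act_mult: "form_coord_act z c u (\<lambda>I. h I * f) K = form_coord_act z c u h K * f"
  by (simp add: form_coord_act_def left_diff_distrib sum_distrib_right mult.assoc)

definition invars :: "('a::field, 'n::{finite, linorder}) sqmat set \<Rightarrow> nat \<Rightarrow> ('a, 'n) sext set" where
  "invars I k = {\<eta> \<in> S_ext_V k. \<forall>g\<in>I. sext_act g \<eta> = \<eta>}"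

text \<open>A pointwise stabilizer in adapted coordinates. The hyperplane is \<open>x_z = 0\<close>,
  the vectors \<open>v_a\<close> with \<open>a \<in> P\<close> form a basis of the span of the
  transvection roots, and \<open>\<zeta>\<close> is the determinant of a diagonal element attaining
  the common exponent \<open>e\<close> of all determinants. \<open>z\<close> is least so that
  \<open>x_z\<close> comes first in wedge products. \<open>delta0\<close> provides the second root
  for \<open>quadratic_dvd\<close>; \<open>delta1\<close> describes a single transvection with the
  identity, possible only in characteristic 2.\<close>

locale std_group =
  fixes z :: "'n::{finite, linorder}" and P :: "'n set" and e d :: nat and \<zeta> :: "'a::field"
    and Grp :: "('a, 'n) sqmat set"
  assumes z_min: "z \<le> i" and z_notin: "z \<notin> P" and e_pos: "e > 0"
    and shape: "s \<in> Grp \<Longrightarrow> \<exists>c u. s = smat z c u \<and> u $ z = 0 \<and> (\<forall>i. i \<notin> P \<longrightarrow> u $ i = 0) \<and> c ^ e = 1"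
    and gen: "smat z \<zeta> 0 \<in> Grp" "\<zeta> ^ e = 1" "\<zeta> ^ m = 1 \<Longrightarrow> e dvd m"
    and trans: "a \<in> P \<Longrightarrow> smat z 1 (axis a 1) \<in> Grp"
    and nontriv: "P \<noteq> {} \<or> e > 1"
    and delta_cases: "d = 0 \<or> d = 1"
    and delta0: "d = 0 \<Longrightarrow> a \<in> P \<Longrightarrow>
      \<exists>w. w \<noteq> 0 \<and> w \<noteq> axis a 1 \<and> w $ z = 0 \<and> smat z 1 w \<in> Grp \<and> smat z 1 (axis a 1 + w) \<in> Grp"
    and delta1: "d = 1 \<Longrightarrow> e = 1 \<and> (1::'a) + 1 = 0 \<and>
      (\<exists>a. P = {a} \<and> (\<forall>s\<in>Grp. s = smat z 1 0 \<or> s = smat z 1 (axis a 1)))"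
begin

lemma shuffle_sign_z [simp]: "shuffle_sign {z} J = (1::'b::field)"
  using z_min by (rule shuffle_sign_min)

lemma zeta_nz: "\<zeta> \<noteq> 0"
  using gen(2) e_pos by (metis power_eq_0_iff zero_neq_one power_0_left less_not_refl)

text \<open>\<open>Th z\<close> is the Euler element \<open>\<Sum>x\<^sub>l \<otimes> v\<^sub>l\<close> of \<open>S \<otimes> V\<close>, while \<open>Idf J\<close> is the product of \<open>x\<^sub>J\<close> with the
  identity \<open>\<Sum>x\<^sub>l \<otimes> v\<^sub>l\<close> of \<open>V\<^sup>* \<otimes> V\<close>.  The products of the invariant forms \<open>Om J\<close> with the \<open>Th j\<close> have
  too large a degree in two cases: \<open>Idf\<close> replaces them where \<open>z \<in> J\<close> and \<open>J \<inter> P = {}\<close>, and \<open>Sp\<close> lowers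
  the degree by one when the group consists of a single transvection and the identity (\<open>d = 1\<close>).\<close>

definition Om :: "'n set \<Rightarrow> 'n set \<Rightarrow> ('a, 'n) pol" where
  "Om J K = (if z \<in> J then if K = J then var z ^ (e - 1) else 0
     else if J \<inter> P = {} then if K = J then 1 else 0
     else if z \<notin> K then if K = J then var z ^ e else 0
     else - (\<Sum>i\<in>-K. if insert i (K - {z}) = J then const (shuffle_sign {i} (K - {z})) * (var z ^ (e - 1) * var i) else 0))"

definition Th :: "'n \<Rightarrow> 'n \<Rightarrow> ('a, 'n) pol" where
  "Th j l = (if j \<noteq> z then if l = j then 1 else 0 else var l)"

definition Idf :: "'n set \<Rightarrow> 'n set \<Rightarrow> 'n \<Rightarrow> ('a, 'n) pol" where
  "Idf J K l = (if l \<notin> J \<and> K = insert l J then const (shuffle_sign {l} J) else 0)"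

definition Sp :: "'n set \<Rightarrow> 'n \<Rightarrow> 'n set \<Rightarrow> 'n \<Rightarrow> ('a, 'n) pol" where
  "Sp J a K l = (if K = insert a J then if l = z then var z else if l = a then var a else 0
     else if K = insert z J then if l = z \<or> l = a then var a else 0 else 0)"

definition bb :: "'n set \<times> 'n \<Rightarrow> ('a, 'n) sext" where
  "bb p = (if snd p = z \<and> z \<notin> fst p \<and> fst p \<inter> P \<noteq> {} \<and> d = 1
     then vec_lambda (\<lambda>q. Sp (fst p - P) (the_elem P) (fst q) (snd q))
     else if snd p = z \<and> z \<in> fst p \<and> fst p \<inter> P = {}
     then vec_lambda (\<lambda>q. Idf (fst p - {z}) (fst q) (snd q))
     else vec_lambda (\<lambda>q. Om (fst p) (fst q) * Th (snd p) (snd q)))"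

text \<open>Leaving \<open>v_z\<close> counts two, containing \<open>x_z\<close> counts one. The
  group passes coefficients on to higher layers only. The first step weighs more because
  \<open>Idf\<close> gives up \<open>x_z\<close> in exchange for leaving \<open>v_z\<close>, and
  this must count as going up.\<close>

definition lay :: "'n set \<times> 'n \<Rightarrow> nat" where
  "lay p = (if snd p = z then if z \<notin> fst p then 0 else 1 else if z \<notin> fst p then 2 else 3)"

text \<open>The power of \<open>x_z\<close> that invariance forces on a coefficient once all lower
  layers vanish (\<open>layer_dvd\<close>); the diagonal of the family \<open>bb\<close> attains
  it.\<close>

definition cexp :: "'n set \<times> 'n \<Rightarrow> nat" where
  "cexp p = (if z \<notin> fst p
     then if fst p \<inter> P = {} then if snd p = z then 1 else 0 else if snd p = z then e + 1 - d else e
     else if snd p = z then if fst p \<inter> P = {} then 0 else e else e - 1)"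

text \<open>If \<open>J\<close> meets \<open>P\<close> and lacks \<open>z\<close>, then
  \<open>Om J\<close> is \<open>x_z^(e-1)\<close> times the contraction of
  \<open>x_z \<and> x_J\<close> with the invariant Euler element. The form is multiplied by
  \<open>1/c\<close> and the power by \<open>(1/c)^(e-1)\<close>, together by 1. For
  \<open>z \<in> J\<close> the form \<open>x_J\<close> itself scales by \<open>1/c\<close>, and if
  \<open>J\<close> avoids both \<open>z\<close> and \<open>P\<close> it is fixed.\<close>

lemma Om_inv:
  assumes c: "c \<noteq> 0" "c ^ e = 1" and u: "u $ z = 0" "\<forall>i. i \<notin> P \<longrightarrow> u $ i = 0"
  shows "form_coord_act z c u (\<lambda>K. pol_act (smat z c u) (Om J K)) K = Om J K"
proof -
  let ?g = "pol_act (smat z c u)"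
  have gx: "?g (var z) = const (1 / c) * var z" and gi: "i \<noteq> z \<Longrightarrow> ?g (var i) = var i - const (u $ i) * var z" for i
    using c u by (simp_all add: pol_act_smat_var)
  have gp: "?g (var z ^ m) = const ((1 / c) ^ m) * var z ^ m" for m
    by (simp add: pol_act.hom_power gx power_mult_distrib const_hom.hom_power)
  have ce: "(1 / c) * (1 / c) ^ (e - 1) = 1"
    using c e_pos by (metis Suc_diff_1 power_Suc power_one_over div_by_1)
  have ge: "?g (var z ^ e) = var z ^ e" using c by (simp add: gp power_one_over)
  have gc: "const (1 / c) * ?g (var z ^ (e - 1)) = var z ^ (e - 1)"
    unfolding gp mult.assoc[symmetric] const_mult[symmetric] ce by simp
  show ?thesis
  proof (cases "z \<in> J")
    case True
    have 0: "Om J (insert i (K - {z})) = 0" if "i \<in> -K" "z \<in> K" for i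
    proof -
      have "insert i (K - {z}) \<noteq> J" using True that by auto
      then show ?thesis using True by (simp add: Om_def)
    qed
    have "form_coord_act z c u (\<lambda>K. ?g (Om J K)) K = (if z \<notin> K then ?g (Om J K) else const (1 / c) * ?g (Om J K))"
      by (auto simp: form_coord_act_def 0)
    also have "\<dots> = Om J K"
      using True gc by (auto simp: Om_def)
    finally show ?thesis .
  next
    case zJ: False
    show ?thesis
    proof (cases "J \<inter> P = {}")
      case True
      have 0: "const (u $ i * shuffle_sign {i} (K - {z})) * ?g (Om J (insert i (K - {z}))) = 0" for i
      proof (cases "insert i (K - {z}) = J")
        case eq: True
        then have "i \<notin> P" using True by auto
        then show ?thesis using u by simp
      next
        case False
        then show ?thesis using zJ True by (simp add: Om_def)
      qed
      have "form_coord_act z c u (\<lambda>K. ?g (Om J K)) K = (if z \<notin> K then ?g (Om J K) else const (1 / c) * ?g (Om J K))"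
        unfolding form_coord_act_def 0 by simp
      also have "\<dots> = Om J K" using zJ True by (auto simp: Om_def)
      finally show ?thesis .
    next
      case False
      show ?thesis
      proof (cases "z \<in> K")
        case zK: True
        let ?t = "\<lambda>i f. if insert i (K - {z}) = J then const (shuffle_sign {i} (K - {z})) * (var z ^ (e - 1) * f) else 0"
        have O: "Om J K = - (\<Sum>i\<in>-K. ?t i (var i))" using zJ False zK by (simp add: Om_def)
        have "const (1 / c) * ?g (?t i (var i)) = ?t i (var i - const (u $ i) * var z)" if "i \<in> -K" for i
        proof -
          have "i \<noteq> z" using that zK by auto
          have "const (1 / c) * (const s * (?g (var z ^ (e - 1)) * f)) = const s * ((const (1 / c) * ?g (var z ^ (e - 1))) * f)" for s f
            by (simp only: mult_ac)
          then have h: "const (1 / c) * (const s * (?g (var z ^ (e - 1)) * f)) = const s * (var z ^ (e - 1) * f)" for s f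
            unfolding gc .
          show ?thesis
            by (cases "insert i (K - {z}) = J")
              (simp_all only: if_True if_False simp_thms pol_act.hom_mult pol_act_const gi[OF \<open>i \<noteq> z\<close>] h pol_act.hom_zero mult_zero_right)
        qed
        then have A: "(\<Sum>i\<in>-K. const (1 / c) * ?g (?t i (var i))) = (\<Sum>i\<in>-K. ?t i (var i - const (u $ i) * var z))"
          by (intro sum.cong refl)
        have 1: "const (1 / c) * ?g (Om J K) = - (\<Sum>i\<in>-K. ?t i (var i - const (u $ i) * var z))"
          unfolding A[symmetric] by (simp only: O pol_act.hom_uminus pol_act.hom_sum mult_minus_right sum_distrib_left)
        have "const (u $ i * shuffle_sign {i} (K - {z})) * ?g (Om J (insert i (K - {z}))) =
            ?t i (const (u $ i) * var z)" if "i \<in> -K" for i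
        proof -
          have "z \<notin> insert i (K - {z})" using that zK by auto
          then have O': "Om J (insert i (K - {z})) = (if insert i (K - {z}) = J then var z ^ e else 0)"
            using zJ False by (simp add: Om_def)
          have ve: "var z ^ e = var z ^ (e - 1) * (var z :: ('a, 'n) pol)"
            by (simp only: power_Suc2[symmetric] Suc_diff_1[OF e_pos])
          have "const (a * b) * var z ^ e = const b * (var z ^ (e - 1) * (const a * (var z :: ('a, 'n) pol)))" for a b
            by (simp only: const_mult ve mult_ac)
          then show ?thesis unfolding O'
            by (cases "insert i (K - {z}) = J") (simp_all only: if_True if_False simp_thms ge pol_act.hom_zero mult_zero_right)
        qed
        then have 2: "(\<Sum>i\<in>-K. const (u $ i * shuffle_sign {i} (K - {z})) * ?g (Om J (insert i (K - {z})))) =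
            (\<Sum>i\<in>-K. ?t i (const (u $ i) * var z))" by (intro sum.cong refl)
        have "form_coord_act z c u (\<lambda>K. ?g (Om J K)) K =
            - ((\<Sum>i\<in>-K. ?t i (var i - const (u $ i) * var z)) + (\<Sum>i\<in>-K. ?t i (const (u $ i) * var z)))"
          using zK 1 2 by (simp add: form_coord_act_def)
        also have "\<dots> = - (\<Sum>i\<in>-K. ?t i (var i))"
          unfolding sum.distrib[symmetric] by (intro arg_cong[of _ _ uminus] sum.cong) (auto simp: algebra_simps)
        finally show ?thesis unfolding O .
      next
        case zK: False
        then show ?thesis using zJ False ge by (simp add: form_coord_act_def Om_def)
      qed
    qed
  qed
qed

lemma Th_inv:
  assumes c: "c \<noteq> 0" and u: "u $ z = 0"
  shows "vec_coord_act z c u (\<lambda>l. pol_act (smat z c u) (Th j l)) l = Th j l"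
proof -
  have "const (c * x) * (const (1 / c) * f) = const x * (f :: ('a, 'n) pol)" for x f
    using c by (simp flip: mult.assoc const_mult)
  from this[of 1] this show ?thesis using c u by (auto simp: vec_coord_act_def Th_def pol_act_smat_var)
qed

lemma Idf_inv:
  assumes c: "c \<noteq> 0" and u: "u $ z = 0" "\<forall>i. i \<notin> P \<longrightarrow> u $ i = 0" and J: "z \<notin> J" "J \<inter> P = {}"
  shows "form_coord_act z c u (\<lambda>I. vec_coord_act z c u (\<lambda>j. pol_act (smat z c u) (Idf J I j)) l) K = Idf J K l"
proof -
  have g: "pol_act (smat z c u) (Idf J I j) = Idf J I j" for I j by (simp add: Idf_def)
  have cc: "const (1 / c) * (const c * f) = f" for f :: "('a, 'n) pol"
    using c by (simp flip: mult.assoc const_mult)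
  show ?thesis
  proof (cases "z \<in> K")
    case False
    then have "Idf J K z = 0" by (auto simp: Idf_def)
    then show ?thesis using False unfolding g by (auto simp: form_coord_act_def vec_coord_act_def)
  next
    case zK: True
    have out: "Idf J (insert i (K - {z})) z = 0" if "i \<in> -K" for i
      using that zK by (auto simp: Idf_def)
    show ?thesis
    proof (cases "l = z")
      case True
      then show ?thesis using zK unfolding g by (simp add: form_coord_act_def vec_coord_act_def out cc)
    next
      case lz: False
      have Kl: "Idf J K l = 0" using zK J lz by (auto simp: Idf_def)
      \<comment> \<open>As \<open>u\<close> is supported on \<open>P\<close>, which \<open>J\<close>
        avoids, every \<open>i\<close> with \<open>u $ i \<noteq> 0\<close> lies outside
        \<open>J\<close>; among these \<open>Idf\<close> selects \<open>i = l\<close>.\<close>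
      have t: "const (u $ i * shuffle_sign {i} (K - {z})) * Idf J (insert i (K - {z})) l =
          (if i = l then if K - {z} = J then const (u $ l) else 0 else 0)" if i: "i \<in> -K" for i
      proof (cases "u $ i = 0")
        case True
        then show ?thesis by (auto simp: Idf_def)
      next
        case False
        then have iJ: "i \<notin> J" using u J by auto
        have iK: "i \<notin> K - {z}" using i by auto
        have "l \<notin> J \<and> insert i (K - {z}) = insert l J \<longleftrightarrow> i = l \<and> K - {z} = J"
          using iJ iK by (metis insert_iff insert_ident)
        then have I: "Idf J (insert i (K - {z})) l = (if i = l \<and> K - {z} = J then const (shuffle_sign {l} J) else 0)"
          unfolding Idf_def by simp
        show ?thesis unfolding I by (simp add: mult.assoc flip: const_mult)
      qed
      have "(\<Sum>i\<in>-K. const (u $ i * shuffle_sign {i} (K - {z})) * Idf J (insert i (K - {z})) l) =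
          (\<Sum>i\<in>-K. if i = l then if K - {z} = J then const (u $ l) else 0 else 0)"
        by (intro sum.cong refl t)
      also have "\<dots> = (if l \<notin> K \<and> K - {z} = J then const (u $ l) else 0)" by simp
      also have "\<dots> = const (u $ l) * Idf J K z"
      proof -
        have "K = insert z J \<longleftrightarrow> K - {z} = J" using zK J by blast
        moreover have "u $ l = 0" if "l \<in> K" "K - {z} = J"
          using that lz u J by auto
        ultimately show ?thesis using J by (auto simp: Idf_def)
      qed
      finally have S: "(\<Sum>i\<in>-K. const (u $ i * shuffle_sign {i} (K - {z})) * Idf J (insert i (K - {z})) l) = const (u $ l) * Idf J K z" .
      have "const (1 / c) * (const (c * u $ l) * f) = const (u $ l) * f" for f :: "('a, 'n) pol"
        using c by (simp flip: mult.assoc const_mult)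
      then show ?thesis using zK lz unfolding g by (simp add: form_coord_act_def vec_coord_act_def out Kl S)
    qed
  qed
qed

text \<open>Take \<open>e = 1\<close>, \<open>P = {a}\<close> and empty \<open>J\<close>. In
  characteristic 2, \<open>x_z\<close> times \<open>Sp\<close> is the product of
  \<open>Om {a}\<close> with the invariant part \<open>x_z v_z + x_a v_a\<close> of the Euler
  element, minus \<open>x_a (x_a + x_z)\<close> times the invariant \<open>x_z\<close> (as a form)
  tensor \<open>v_a\<close>. The polynomial \<open>x_a (x_a + x_z)\<close> is the norm of
  \<open>x_a\<close>, and the difference becomes divisible by \<open>x_z\<close>. For general
  \<open>J\<close> everything is multiplied by the invariant form \<open>x_J\<close>; signs
  disappear as \<open>-1 = 1\<close>.\<close>

lemma Sp_inv:
  assumes char2: "(1::'a) + 1 = 0" and J: "z \<notin> J" "a \<notin> J" "a \<noteq> z"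
  shows "form_coord_act z 1 (axis a 1) (\<lambda>I. vec_coord_act z 1 (axis a 1) (\<lambda>j. pol_act (smat z 1 (axis a 1)) (Sp J a I j)) l) K = Sp J a K l"
proof -
  let ?u = "axis a (1::'a)" and ?g = "pol_act (smat z 1 (axis a (1::'a)))"
  have u: "?u $ z = 0" "?u $ a = 1" "\<And>i. i \<noteq> a \<Longrightarrow> ?u $ i = 0" using J by (auto simp: axis_def)
  have gx: "?g (var z) = var z" "?g (var a) = var a - var z"
    using J u by (simp_all add: pol_act_smat_var)
  have m1: "(-1::'a) = 1" using char2 by (metis add_eq_0_iff)
  have ff: "f + f = 0" for f :: "('a, 'n) pol"
  proof -
    have "f + f = const 1 * f + const 1 * f" by simp
    also have "\<dots> = const (1 + 1) * f" by (simp only: const_add distrib_right)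
    finally show ?thesis by (simp only: char2 const_0 mult_zero_left)
  qed
  then have neg: "- f = f" for f :: "('a, 'n) pol" by (intro minus_unique ff)
  have minus: "f - g = f + g" for f g :: "('a, 'n) pol" by (simp only: diff_conv_add_uminus neg)
  have ffg: "g + f + f = g" for f g :: "('a, 'n) pol" by (simp only: add.assoc ff add_0_right)
  have sg: "shuffle_sign A B = (1::'a)" for A B :: "'n set"
    unfolding shuffle_sign_def m1 by simp
  have ne: "insert z J \<noteq> insert a J" using J by auto
  have gS: "?g (Sp J a K' l') = (if K' = insert a J then if l' = z then var z else if l' = a then var a + var z else 0
     else if K' = insert z J then if l' = z \<or> l' = a then var a + var z else 0 else 0)" for K' l'
    by (simp add: Sp_def gx minus)
  have va: "vec_coord_act z 1 ?u (\<lambda>j. ?g (Sp J a K' j)) l = (if K' = insert a J then if l = z then var z else if l = a then var a else 0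
     else if K' = insert z J then if l = z then var a + var z else 0 else 0)" for K'
    unfolding vec_coord_act_def gS using J ne ne[symmetric]
    by (cases "K' = insert a J"; cases "K' = insert z J"; cases "l = z"; cases "l = a") (simp_all add: u ff ffg)
  have sum: "(\<Sum>i\<in>-K. const (?u $ i * shuffle_sign {i} (K - {z})) * h (insert i (K - {z}))) =
      (if a \<in> K then 0 else h (insert a (K - {z})))" for h :: "_ \<Rightarrow> ('a, 'n) pol"
  proof -
    have "(\<Sum>i\<in>-K. const (?u $ i * shuffle_sign {i} (K - {z})) * h (insert i (K - {z}))) =
        (\<Sum>i\<in>-K. if i = a then h (insert a (K - {z})) else 0)"
      using u by (intro sum.cong) (auto simp: sg)
    then show ?thesis by simp
  qed
  have F: "form_coord_act z 1 ?u h K = (if z \<notin> K then h K else h K - (if a \<in> K then 0 else h (insert a (K - {z}))))" for h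
    unfolding form_coord_act_def sum[of h] by simp
  show ?thesis
  proof (cases "z \<in> K")
    case False
    then have "K \<noteq> insert z J" by auto
    then show ?thesis unfolding F va unfolding Sp_def using False by simp
  next
    case True
    have 1: "K \<noteq> insert a J" using True J by (metis insert_iff)
    have 2: "insert a (K - {z}) \<noteq> insert z J" using J by (metis insert_iff)
    have K': "K - {z} = J \<longleftrightarrow> K = insert z J"
      using True J(1) by (metis Diff_insert_absorb insert_Diff)
    have 3: "insert a (K - {z}) = insert a J \<longleftrightarrow> K = insert z J" if "a \<notin> K"
      using insert_ident[of a "K - {z}" J] that J K' by simp
    show ?thesis
    proof (cases "K = insert z J")
      case K: True
      have "K - {z} = J" "a \<notin> K" using K J K' by simp_all
      then show ?thesis using K True 1 J ne ne[symmetric]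
        unfolding F va unfolding Sp_def by (simp add: minus ffg)
    next
      case False
      then have "a \<notin> K \<Longrightarrow> insert a (K - {z}) \<noteq> insert a J" by (simp only: 3 not_False_eq_True)
      then show ?thesis using True False 1 2
        unfolding F va unfolding Sp_def by simp
    qed
  qed
qed

lemma shape_nz: "c ^ e = 1 \<Longrightarrow> c \<noteq> (0::'a)"
  using e_pos by (metis less_not_refl power_0_left zero_neq_one)

lemma bb_inv:
  assumes "s \<in> Grp"
  shows "sext_act s (bb p) = bb p"
proof -
  obtain c u where s: "s = smat z c u" and u: "u $ z = 0" "\<forall>i. i \<notin> P \<longrightarrow> u $ i = 0" and ce: "c ^ e = 1"
    using shape[OF assms] by blast
  have c: "c \<noteq> 0" using shape_nz[OF ce] .
  note act = sext_act_smat[OF z_min c u(1)]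
  have "sext_act s (bb p) $ (K, l) = bb p $ (K, l)" for K l
  proof -
    consider (sp) "snd p = z" "z \<notin> fst p" "fst p \<inter> P \<noteq> {}" "d = 1"
      | (id) "snd p = z" "z \<in> fst p" "fst p \<inter> P = {}"
      | (te) "bb p = vec_lambda (\<lambda>q. Om (fst p) (fst q) * Th (snd p) (snd q))"
      unfolding bb_def by argo
    then show ?thesis
    proof cases
      case sp
      then obtain a where a: "P = {a}" "\<forall>s\<in>Grp. s = smat z 1 0 \<or> s = smat z 1 (axis a 1)" and c2: "(1::'a) + 1 = 0"
        using delta1 by blast
      have tp: "the_elem P = a" and aP: "a \<in> P" using a(1) by simp_all
      have b: "bb p = vec_lambda (\<lambda>q. Sp (fst p - P) a (fst q) (snd q))" unfolding bb_def using sp tp by simp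
      from a assms consider "s = smat z 1 0" | "s = smat z 1 (axis a 1)" by blast
      then show ?thesis
      proof cases
        case 1
        then show ?thesis by simp
      next
        case 2
        have ax: "axis a (1::'a) $ z = 0" and az: "a \<noteq> z" using z_notin aP by (auto simp: axis_def)
        then show ?thesis
          unfolding 2 b using sext_act_smat[OF z_min one_neq_zero ax, of "vec_lambda (\<lambda>q. Sp (fst p - P) a (fst q) (snd q))" K l]
            Sp_inv[OF c2 _ _ az, of "fst p - P" l K] sp(2) aP by simp
      qed
    next
      case id
      then have b: "bb p = vec_lambda (\<lambda>q. Idf (fst p - {z}) (fst q) (snd q))" by (simp add: bb_def)
      have "(fst p - {z}) \<inter> P = {}" "z \<notin> fst p - {z}" using id by auto
      then show ?thesis unfolding s b act using Idf_inv[OF c u, of "fst p - {z}" l K] by simp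
    next
      case te
      show ?thesis
        unfolding s te act using Om_inv[OF c ce u, of "fst p" K] Th_inv[OF c u(1), of "snd p" l]
        by (simp add: pol_act.hom_mult vec_coord_act_mult form_coord_act_mult)
    qed
  qed
  then show ?thesis by (simp add: vec_eq_iff)
qed

end

lemma idom_cancel: "f * a = f * b \<Longrightarrow> f \<noteq> 0 \<Longrightarrow> a = (b :: 'r::idom)"
  by simp

lemma var_nz [simp]: "var i \<noteq> (0 :: ('a::field, 'n) pol)"
  unfolding var_def by (metis lookup_single_eq lookup_zero one_neq_zero)

lemma ring_rearrange:
  fixes D T w C q S :: "'r::comm_ring"
  shows "C = T - q \<Longrightarrow> T = C + q" and "D = (T + w * (C + q)) - S \<Longrightarrow> D - T = w * C - S + w * q"
  by (simp_all add: algebra_simps)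

section \<open>Triangularity of the explicit family and leading coefficients of invariants\<close>

context std_group
begin

lemma Om_neq_0D:
  assumes "Om J K \<noteq> 0" "K \<noteq> J"
  shows "z \<notin> J \<and> z \<in> K \<and> card K = card J"
proof -
  have zJ: "z \<notin> J" and zK: "z \<in> K" using assms by (auto simp: Om_def split: if_splits)
  have "\<exists>i\<in>-K. insert i (K - {z}) = J"
  proof (rule ccontr)
    assume *: "\<not> (\<exists>i\<in>-K. insert i (K - {z}) = J)"
    have "(\<Sum>i\<in>-K. if insert i (K - {z}) = J then const (shuffle_sign {i} (K - {z})) * (var z ^ (e - 1) * var i) else 0) = (0 :: ('a, 'n) pol)"
      using * by (intro sum.neutral ballI) (simp only: if_False bex_simps)
    then show False using assms zJ zK unfolding Om_def by (simp split: if_splits)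
  qed
  then obtain i where i: "i \<notin> K" "J = insert i (K - {z})" by blast
  have "card J = Suc (card (K - {z}))" unfolding i(2) using i(1) by (intro card_insert_disjoint) auto
  also have "\<dots> = card K" by (rule card.remove[OF finite zK, symmetric])
  finally show ?thesis using zJ zK by simp
qed

lemma Om_diag: "Om J J = var z ^ (if z \<in> J then e - 1 else if J \<inter> P = {} then 0 else e)"
  by (simp add: Om_def)

lemma Th_neq_0D: "Th j l \<noteq> 0 \<Longrightarrow> l \<noteq> j \<Longrightarrow> j = z"
  by (auto simp: Th_def split: if_splits)

lemma bb_cases:
  obtains (sp) a where "snd p = z" "z \<notin> fst p" "fst p \<inter> P \<noteq> {}" "d = 1" "P = {a}" "e = 1" "a \<in> fst p" "a \<noteq> z"
      "bb p = vec_lambda (\<lambda>q. Sp (fst p - {a}) a (fst q) (snd q))"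
  | (id) "snd p = z" "z \<in> fst p" "fst p \<inter> P = {}" "bb p = vec_lambda (\<lambda>q. Idf (fst p - {z}) (fst q) (snd q))"
  | (te) "bb p = vec_lambda (\<lambda>q. Om (fst p) (fst q) * Th (snd p) (snd q))"
      "\<not> (snd p = z \<and> z \<notin> fst p \<and> fst p \<inter> P \<noteq> {} \<and> d = 1)" "\<not> (snd p = z \<and> z \<in> fst p \<and> fst p \<inter> P = {})"
proof -
  consider "snd p = z" "z \<notin> fst p" "fst p \<inter> P \<noteq> {}" "d = 1" | "snd p = z" "z \<in> fst p" "fst p \<inter> P = {}"
    | "\<not> (snd p = z \<and> z \<notin> fst p \<and> fst p \<inter> P \<noteq> {} \<and> d = 1)" "\<not> (snd p = z \<and> z \<in> fst p \<and> fst p \<inter> P = {})"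
    by argo
  then show thesis
  proof cases
    case 1
    then obtain a where a: "P = {a}" "e = 1" using delta1 by blast
    have "a \<in> P" using a by simp
    then have az: "a \<in> fst p" "a \<noteq> z" using 1(3) a(1) z_notin by auto
    have eqs: "fst p - P = fst p - {a}" "the_elem P = a" using a by simp_all
    have "bb p = vec_lambda (\<lambda>q. Sp (fst p - P) (the_elem P) (fst q) (snd q))"
      unfolding bb_def using 1 by simp
    note b = this[unfolded eqs]
    show thesis by (rule sp[OF 1 a az b])
  next
    case 2
    then show thesis by (intro id) (simp_all add: bb_def)
  next
    case 3
    show thesis
      by (rule te[OF _ 3]) (simp only: bb_def if_not_P[OF 3(1)] if_not_P[OF 3(2)])
  qed
qed

lemma Idf_neq_0D: "Idf J K l \<noteq> 0 \<Longrightarrow> l \<notin> J \<and> K = insert l J"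
  by (simp add: Idf_def split: if_splits)

lemma Sp_neq_0D: "Sp J a K l \<noteq> 0 \<Longrightarrow> (K = insert a J \<and> (l = z \<or> l = a)) \<or> (K = insert z J \<and> (l = z \<or> l = a))"
  by (auto simp: Sp_def split: if_splits)

lemma bb_card:
  assumes "bb p $ q \<noteq> 0"
  shows "card (fst q) = card (fst p)"
proof (cases p rule: bb_cases)
  case (sp a)
  let ?J = "fst p - {a}"
  have "card (insert a ?J) = card (fst p)" by (simp only: insert_Diff[OF sp(7)])
  moreover have "card (insert z ?J) = Suc (card ?J)" by (rule card_insert_disjoint) (use sp(2) in simp_all)
  moreover have "card (insert a ?J) = Suc (card ?J)" by (rule card_insert_disjoint) simp_all
  moreover have "fst q = insert a ?J \<or> fst q = insert z ?J"
    using assms Sp_neq_0D[of ?J a "fst q" "snd q"] unfolding sp(9) vec_lambda_beta by metis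
  ultimately show ?thesis by metis
next
  case id
  have "snd q \<notin> fst p - {z} \<and> fst q = insert (snd q) (fst p - {z})"
    using assms unfolding id(4) vec_lambda_beta by (rule Idf_neq_0D)
  then have "card (fst q) = Suc (card (fst p - {z}))" by simp
  then show ?thesis using card.remove[OF finite id(2)] by simp
next
  case te
  then have "Om (fst p) (fst q) \<noteq> 0" using assms by simp
  then show ?thesis using Om_neq_0D by (cases "fst q = fst p") auto
qed

lemma bb_S_ext_V:
  assumes "p \<in> basis_index k" shows "bb p \<in> S_ext_V k"
proof -
  have "bb p $ q = 0" if "q \<notin> basis_index k" for q
  proof (rule ccontr)
    assume "bb p $ q \<noteq> 0"
    then have "card (fst q) = card (fst p)" by (rule bb_card)
    moreover have "card (fst p) = k" "card (fst q) \<noteq> k"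
      using assms that unfolding basis_index_def mem_Times_iff by simp_all
    ultimately show False by simp
  qed
  then show ?thesis unfolding S_ext_V_def by blast
qed

lemma bb_diag: "bb p $ p = var z ^ cexp p"
proof (cases p rule: bb_cases)
  case (sp a)
  have ins: "fst p = insert a (fst p - {a})" by (rule insert_Diff[OF sp(7), symmetric])
  have "bb p $ p = Sp (fst p - {a}) a (fst p) (snd p)" by (simp only: sp(9) vec_lambda_beta)
  also have "\<dots> = var z" by (simp only: Sp_def if_P[OF ins] if_P[OF sp(1)])
  also have "cexp p = 1" unfolding cexp_def using sp(1-4,6) by simp
  then have "var z = var z ^ cexp p" by simp
  finally show ?thesis .
next
  case id
  have ins: "fst p = insert z (fst p - {z})" by (rule insert_Diff[OF id(2), symmetric])
  have "bb p $ p = Idf (fst p - {z}) (fst p) z" by (simp only: id(4) vec_lambda_beta id(1))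
  also have "\<dots> = 1" unfolding Idf_def using ins by simp
  also have "cexp p = 0" unfolding cexp_def using id(1-3) by simp
  then have "1 = var z ^ cexp p" by simp
  finally show ?thesis .
next
  case te
  have "e + 1 - d = Suc e" if "d \<noteq> 1" using that delta_cases by auto
  then show ?thesis using te e_pos
    by (auto simp: Om_diag Th_def cexp_def power_Suc2[symmetric] simp del: power_Suc)
qed

text \<open>Off the diagonal \<open>Om\<close> brings in \<open>x_z\<close>, \<open>Th\<close>
  leaves \<open>v_z\<close>, \<open>Sp\<close> does at least one of the two, and \<open>Idf\<close>
  loses \<open>x_z\<close> only while leaving \<open>v_z\<close>. So each step goes to a higher
  layer.\<close>

lemma bb_layer:
  assumes "q \<noteq> p" "lay q \<le> lay p"
  shows "bb p $ q = 0"
proof (rule ccontr)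
  assume nz: "bb p $ q \<noteq> 0"
  show False
  proof (cases p rule: bb_cases)
    case (sp a)
    let ?J = "fst p - {a}"
    have ins: "fst p = insert a ?J" by (rule insert_Diff[OF sp(7), symmetric])
    have "lay p = 0" using sp(1,2) by (simp add: lay_def)
    then have q: "snd q = z" "z \<notin> fst q" using assms(2) by (auto simp: lay_def split: if_splits)
    have "fst q = insert a ?J \<or> fst q = insert z ?J"
      using nz Sp_neq_0D[of ?J a "fst q" "snd q"] unfolding sp(9) vec_lambda_beta by metis
    then have "fst q = fst p" using q ins by (metis insertI1)
    then show False using q sp(1) assms(1) by (simp add: prod_eq_iff)
  next
    case id
    have *: "snd q \<notin> fst p - {z} \<and> fst q = insert (snd q) (fst p - {z})"
      using nz unfolding id(4) vec_lambda_beta by (rule Idf_neq_0D)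
    have "snd q \<noteq> z"
    proof
      assume z: "snd q = z"
      then have "fst q = insert z (fst p - {z})" using * by simp
      also have "\<dots> = fst p" by (rule insert_Diff[OF id(2)])
      finally show False using z id assms(1) by (simp add: prod_eq_iff)
    qed
    moreover have "lay p = 1" using id by (simp add: lay_def)
    ultimately show False using assms(2) by (simp add: lay_def split: if_splits)
  next
    case te
    then have O: "Om (fst p) (fst q) \<noteq> 0" and T: "Th (snd p) (snd q) \<noteq> 0" using nz by simp_all
    have O': "fst q = fst p \<or> (z \<notin> fst p \<and> z \<in> fst q)" using Om_neq_0D[OF O] by blast
    have T': "snd q = snd p \<or> (snd p = z \<and> snd q \<noteq> z)" using Th_neq_0D[OF T] by metis
    have "\<not> (fst q = fst p \<and> snd q = snd p)" using assms(1) by (simp add: prod_eq_iff)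
    then show False using O' T' assms(2) unfolding lay_def by (auto split: if_splits)
  qed
qed

lemma det_bb:
  assumes "distinct ps" "set ps = basis_index k"
  shows "Determinant.det (coef_mat (map bb ps) ps) = var z ^ (\<Sum>p\<in>basis_index k. cexp p)"
proof -
  have "coef_mat (map bb ps) ps = Matrix.mat (length ps) (length ps) (\<lambda>(i, j). bb (ps ! i) $ (ps ! j))"
    by (rule eq_matI) (auto simp: coef_mat_def)
  also have "Determinant.det \<dots> = (\<Prod>p\<in>set ps. bb p $ p)"
    by (rule det_layered[of ps lay "\<lambda>p q. bb p $ q", OF assms(1)]) (simp add: bb_layer)
  finally show ?thesis using assms(2) by (simp add: bb_diag power_sum)
qed

text \<open>The eigenvalue of \<open>smat z c 0\<close> on the basis element \<open>p\<close>:
  \<open>v_z\<close> scales by \<open>c\<close> and the form \<open>x_z\<close> by its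
  inverse.\<close>

definition kappa :: "'a \<Rightarrow> 'n set \<times> 'n \<Rightarrow> 'a" where
  "kappa c p = (if snd p = z then c else 1) * (if z \<in> fst p then 1 / c else 1)"

text \<open>Multiplied by the forced power of \<open>x_z\<close> the basis element gets weight 1, so
  a leading coefficient divided by that power is an invariant polynomial. The exponent
  \<open>e + 1 - d\<close> fits because \<open>d = 1\<close> forces \<open>e = 1\<close>.\<close>

lemma kappa_cexp:
  assumes "c ^ e = 1"
  shows "kappa c p * (1 / c) ^ cexp p = 1"
proof -
  have c: "c \<noteq> 0" using shape_nz[OF assms] .
  have e1: "(1 / c) ^ e = 1" using assms by (simp add: power_one_over)
  have e2: "(1 / c) * (1 / c) ^ (e - 1) = 1"
    unfolding power_Suc[symmetric] Suc_diff_1[OF e_pos] by (rule e1)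
  have e3: "c * (1 / c) ^ (e + 1 - d) = 1"
  proof (cases "d = 0")
    case True
    have "c * (1 / c) ^ (e + 1 - d) = (c * (1 / c)) * (1 / c) ^ e"
      unfolding True by (simp only: diff_zero power_add power_one_right mult_ac)
    then show ?thesis using c e1 by simp
  next
    case False
    then have "e = 1" "d = 1" using delta1 delta_cases by auto
    then show ?thesis using c by simp
  qed
  show ?thesis using c e1 e2 e3 by (auto simp: kappa_def cexp_def)
qed

text \<open>A coefficient of the transformed element is assembled from its own position and from
  lower layers. With these zero, only the scalar \<open>kappa c p\<close> remains besides the action
  on polynomials.\<close>

lemma lead:
  assumes s: "s = smat z c u" "c \<noteq> 0" "u $ z = 0" and inv: "sext_act s \<eta> = \<eta>"
    and lower: "\<And>q. lay q < lay p \<Longrightarrow> \<eta> $ q = 0"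
  shows "\<eta> $ p = const (kappa c p) * pol_act s (\<eta> $ p)"
proof -
  obtain K l where p: "p = (K, l)" by (cases p)
  have eq: "\<eta> $ (K, l) = form_coord_act z c u (\<lambda>I. vec_coord_act z c u (\<lambda>j. pol_act s (\<eta> $ (I, j))) l) K"
    using sext_act_smat[OF z_min s(2,3), of \<eta> K l] inv s(1) by simp
  have low: "\<eta> $ (J, j) = 0" if "lay (J, j) < lay (K, l)" for J j
    using lower[of "(J, j)"] that p by simp
  show ?thesis
  proof (cases "z \<in> K")
    case False
    show ?thesis
    proof (cases "l = z")
      case True
      then show ?thesis using eq False by (simp add: p form_coord_act_def vec_coord_act_def kappa_def)
    next
      case l: False
      have "\<eta> $ (K, z) = 0" using False l by (intro low) (simp add: lay_def)
      then show ?thesis using eq False l by (simp add: p form_coord_act_def vec_coord_act_def kappa_def)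
    qed
  next
    case True
    have out: "z \<notin> insert i (K - {z})" if "i \<in> -K" for i using that True by auto
    have F: "\<eta> $ (K, l) = const (1 / c) * vec_coord_act z c u (\<lambda>j. pol_act s (\<eta> $ (K, j))) l"
      if 0: "\<And>i. i \<in> -K \<Longrightarrow> vec_coord_act z c u (\<lambda>j. pol_act s (\<eta> $ (insert i (K - {z}), j))) l = 0"
    proof -
      have S: "(\<Sum>i\<in>-K. const (u $ i * shuffle_sign {i} (K - {z})) *
          vec_coord_act z c u (\<lambda>j. pol_act s (\<eta> $ (insert i (K - {z}), j))) l) = 0"
        by (intro sum.neutral ballI) (simp only: 0 mult_zero_right)
      show ?thesis
        by (subst eq) (simp only: form_coord_act_def S True not_True_eq_False if_False diff_zero)
    qed
    show ?thesis
    proof (cases "l = z")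
      case l: True
      have "\<eta> $ (insert i (K - {z}), z) = 0" if "i \<in> -K" for i
        using out[OF that] True l by (intro low) (simp add: lay_def)
      then have "\<eta> $ (K, l) = const (1 / c) * vec_coord_act z c u (\<lambda>j. pol_act s (\<eta> $ (K, j))) l"
        using l by (intro F) (simp add: vec_coord_act_def)
      moreover have "vec_coord_act z c u (\<lambda>j. pol_act s (\<eta> $ (K, j))) l = const c * pol_act s (\<eta> $ (K, l))"
        using l by (simp add: vec_coord_act_def)
      moreover have "kappa c (K, l) = 1 / c * c" using True l by (simp add: kappa_def)
      ultimately show ?thesis unfolding p by (simp only: const_mult mult.assoc)
    next
      case l: False
      have "\<eta> $ (insert i (K - {z}), l) = 0" "\<eta> $ (insert i (K - {z}), z) = 0" if "i \<in> -K" for i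
        using out[OF that] True l by (auto intro!: low simp: lay_def)
      then have "\<eta> $ (K, l) = const (1 / c) * vec_coord_act z c u (\<lambda>j. pol_act s (\<eta> $ (K, j))) l"
        by (intro F) (simp add: vec_coord_act_def)
      moreover have "\<eta> $ (K, z) = 0" using True l by (intro low) (simp add: lay_def)
      ultimately have "\<eta> $ (K, l) = const (1 / c) * pol_act s (\<eta> $ (K, l))"
        using l by (simp add: vec_coord_act_def)
      then show ?thesis using True l unfolding p by (simp add: kappa_def)
    qed
  qed
qed

text \<open>The leading coefficients divided by the forced powers are invariant polynomials, so
  subtracting the corresponding combination of the family clears the layer within the invariants.
  Only higher layers are disturbed.\<close>

lemma eliminate_layer:
  assumes \<eta>: "\<eta> \<in> invars Grp k" and ps: "set ps = basis_index k"
    and lower: "\<And>q. lay q < t \<Longrightarrow> \<eta> $ q = 0"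
    and dvd: "\<And>p. p \<in> basis_index k \<Longrightarrow> lay p = t \<Longrightarrow> var z ^ cexp p dvd \<eta> $ p"
  shows "\<exists>\<eta>'\<in>invars Grp k. (\<forall>q. lay q < Suc t \<longrightarrow> \<eta>' $ q = 0) \<and> \<eta> - \<eta>' \<in> S_span (map bb ps)"
proof -
  let ?T = "{p \<in> basis_index k. lay p = t}"
  have "\<forall>p\<in>?T. \<exists>a. \<eta> $ p = var z ^ cexp p * a" using dvd unfolding dvd_def by blast
  from bchoice[OF this] obtain a where a: "\<And>p. p \<in> ?T \<Longrightarrow> \<eta> $ p = var z ^ cexp p * a p" by blast
  have a_inv: "pol_act s (a p) = a p" if sG: "s \<in> Grp" and pT: "p \<in> ?T" for s p
  proof -
    obtain c u where s: "s = smat z c u" and u: "u $ z = 0" and ce: "c ^ e = 1"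
      using shape[OF sG] by blast
    have c: "c \<noteq> 0" using shape_nz[OF ce] .
    have "sext_act s \<eta> = \<eta>" using \<eta> sG by (simp add: invars_def)
    then have "\<eta> $ p = const (kappa c p) * pol_act s (\<eta> $ p)"
      using pT by (intro lead[OF s c u] lower) auto
    also have "pol_act s (\<eta> $ p) = const ((1 / c) ^ cexp p) * (var z ^ cexp p * pol_act s (a p))"
      unfolding a[OF pT] s using c u
      by (simp add: pol_act.hom_mult pol_act.hom_power pol_act_smat_var power_mult_distrib const_hom.hom_power mult.assoc)
    also have "const (kappa c p) * \<dots> = var z ^ cexp p * pol_act s (a p)"
      unfolding mult.assoc[symmetric] const_mult[symmetric] kappa_cexp[OF ce] by simp
    finally have "var z ^ cexp p * pol_act s (a p) = var z ^ cexp p * a p" unfolding a[OF pT] by (rule sym)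
    then show ?thesis by (rule idom_cancel) simp
  qed
  define \<theta> where "\<theta> = (\<Sum>p\<in>?T. a p *s bb p)"
  have \<theta>_inv: "sext_act s \<theta> = \<theta>" if "s \<in> Grp" for s
    unfolding \<theta>_def sext_act_sum by (intro sum.cong refl) (simp only: sext_act_scale bb_inv[OF that] a_inv[OF that])
  have \<theta>S: "\<theta> \<in> S_ext_V k"
    unfolding \<theta>_def by (intro S_ext_V_sum S_ext_V_scale bb_S_ext_V) simp
  have "\<eta> - \<theta> \<in> invars Grp k"
    using \<eta> \<theta>_inv \<theta>S by (simp add: invars_def sext_act_diff S_ext_V_diff)
  moreover have "(\<eta> - \<theta>) $ q = 0" if q: "lay q < Suc t" for q
  proof (cases "q \<in> basis_index k")
    case False
    have "\<eta> $ q = 0" "\<theta> $ q = 0" using False \<eta> \<theta>S unfolding invars_def S_ext_V_def by blast+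
    then show ?thesis by simp
  next
    case True
    have "\<theta> $ q = (\<Sum>p\<in>?T. a p * bb p $ q)" by (simp add: \<theta>_def)
    also have "\<dots> = (\<Sum>p\<in>?T. if p = q then a q * var z ^ cexp q else 0)"
      using q by (intro sum.cong refl) (auto simp: bb_diag bb_layer)
    also have "\<dots> = (if lay q = t then \<eta> $ q else 0)"
      using True a[of q] by (simp add: mult.commute)
    finally show ?thesis using lower[of q] q by simp
  qed
  moreover have "\<eta> - (\<eta> - \<theta>) \<in> S_span (map bb ps)"
    unfolding diff_diff_eq2 \<theta>_def using ps
    by (simp, intro S_span_sum S_span_scale S_span_base) auto
  ultimately show ?thesis by blast
qed

text \<open>Write \<open>f = x_z^m h\<close>. Then \<open>h\<close> is
  \<open>\<kappa> \<zeta>^(-m)\<close> times its own transform, and it agrees with this transform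
  modulo \<open>x_z\<close>. If the scalar is not 1, \<open>x_z\<close> divides
  \<open>h\<close>.\<close>

lemma lift_dvd:
  assumes f: "f = const \<kappa> * pol_act (smat z \<zeta> 0) f" and m0: "var z ^ m0 dvd f"
    and ne: "\<And>m. m0 \<le> m \<Longrightarrow> m < m1 \<Longrightarrow> \<kappa> * (1 / \<zeta>) ^ m \<noteq> 1" and "m0 \<le> m1"
  shows "var z ^ m1 dvd f"
  using \<open>m0 \<le> m1\<close> ne
proof (induction m1 rule: dec_induct)
  case base
  show ?case by (rule m0)
next
  case (step m)
  let ?g = "pol_act (smat z \<zeta> 0)" and ?l = "\<kappa> * (1 / \<zeta>) ^ m"
  have "var z ^ m dvd f" using step by simp
  then obtain h where h: "f = var z ^ m * h" by (rule dvdE)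
  have "var z ^ m * h = const \<kappa> * ?g (var z ^ m * h)" using f unfolding h .
  also have "\<dots> = var z ^ m * (const ?l * ?g h)"
    using zeta_nz by (simp add: pol_act.hom_mult pol_act.hom_power pol_act_smat_var power_mult_distrib const_hom.hom_power const_mult mult_ac)
  finally have hg: "h = const ?l * ?g h" by (rule idom_cancel) simp
  have "h - ?g h = const (?l - 1) * ?g h"
    by (subst hg) (simp only: const_diff const_1 left_diff_distrib mult_1)
  then have "const (?l - 1) * ?g h = h - ?g h" by (rule sym)
  moreover have "var z dvd h - ?g h" using zeta_nz by (intro var_dvd_diff_pol_act_smat) simp_all
  ultimately have "var z dvd const (inverse (?l - 1)) * (const (?l - 1) * ?g h)" by simp
  moreover have "?l - 1 \<noteq> 0" using step by simp
  ultimately have "var z dvd ?g h" by (simp flip: mult.assoc const_mult)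
  then have "var z dvd h" by (subst hg) (rule dvd_mult)
  then show ?case unfolding h power_Suc2 by (intro mult_dvd_mono dvd_refl)
qed

text \<open>Coefficients of the fixed element at \<open>x_J\<close> and at
  \<open>x_z \<and> x_J\<close>, both tensor \<open>v_l\<close>. Since the left sides are divisible
  by \<open>x_z\<close>, each relation yields divisibility of the coefficients on its right
  side.\<close>

lemma transvection_relations:
  assumes \<eta>: "\<eta> \<in> invars Grp k" and u: "smat z 1 u \<in> Grp" "u $ z = 0" and J: "z \<notin> J" and l: "l \<noteq> z"
  shows "\<eta> $ (J, l) - pol_act (smat z 1 u) (\<eta> $ (J, l)) = const (u $ l) * \<eta> $ (J, z)"
    and "\<eta> $ (insert z J, l) - pol_act (smat z 1 u) (\<eta> $ (insert z J, l)) =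
      const (u $ l) * \<eta> $ (insert z J, z)
      - (\<Sum>i\<in>- insert z J. const (u $ i * shuffle_sign {i} J) * \<eta> $ (insert i J, l))
      + const (u $ l) * (\<Sum>i\<in>- insert z J. const (u $ i * shuffle_sign {i} J) * \<eta> $ (insert i J, z))"
proof -
  let ?t = "pol_act (smat z 1 u)"
  have "sext_act (smat z 1 u) \<eta> = \<eta>" using \<eta> u(1) by (simp add: invars_def)
  then have eq: "\<eta> $ (K, j) = form_coord_act z 1 u (\<lambda>I. vec_coord_act z 1 u (\<lambda>j. ?t (\<eta> $ (I, j))) j) K" for K j
    using sext_act_smat[OF z_min one_neq_zero u(2), of \<eta> K j] by simp
  have A: "?t (\<eta> $ (M, z)) = \<eta> $ (M, z)" if "z \<notin> M" for M
    using eq[of M z] that by (simp add: form_coord_act_def vec_coord_act_def)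
  have B: "?t (\<eta> $ (M, l)) + const (u $ l) * ?t (\<eta> $ (M, z)) = \<eta> $ (M, l)" if "z \<notin> M" for M
    using eq[of M l] that l by (simp add: form_coord_act_def vec_coord_act_def)
  have B': "\<eta> $ (J, l) = ?t (\<eta> $ (J, l)) + const (u $ l) * \<eta> $ (J, z)"
    using B[OF J] A[OF J] by simp
  show "\<eta> $ (J, l) - ?t (\<eta> $ (J, l)) = const (u $ l) * \<eta> $ (J, z)"
    by (subst B') simp
  have out: "z \<notin> insert i J" if "i \<in> - insert z J" for i using that J by auto
  have K: "insert z J - {z} = J" using J by simp
  let ?S = "\<Sum>i\<in>- insert z J. const (u $ i * shuffle_sign {i} J) * \<eta> $ (insert i J, z)"
  have C: "\<eta> $ (insert z J, z) = ?t (\<eta> $ (insert z J, z)) - ?S"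
  proof -
    have "(\<Sum>i\<in>- insert z J. const (u $ i * shuffle_sign {i} J) * ?t (\<eta> $ (insert i J, z))) = ?S"
      by (intro sum.cong refl) (simp only: A[OF out])
    then show ?thesis by (subst eq) (simp add: form_coord_act_def vec_coord_act_def K)
  qed
  have "\<eta> $ (insert z J, l) = (?t (\<eta> $ (insert z J, l)) + const (u $ l) * ?t (\<eta> $ (insert z J, z)))
      - (\<Sum>i\<in>- insert z J. const (u $ i * shuffle_sign {i} J) * \<eta> $ (insert i J, l))"
  proof -
    have "(\<Sum>i\<in>- insert z J. const (u $ i * shuffle_sign {i} J) * (?t (\<eta> $ (insert i J, l)) + const (u $ l) * ?t (\<eta> $ (insert i J, z)))) =
        (\<Sum>i\<in>- insert z J. const (u $ i * shuffle_sign {i} J) * \<eta> $ (insert i J, l))"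
      by (intro sum.cong refl) (simp only: B[OF out])
    then show ?thesis by (subst eq) (simp add: form_coord_act_def vec_coord_act_def K l)
  qed
  moreover have "?t (\<eta> $ (insert z J, z)) = \<eta> $ (insert z J, z) + ?S" using C by (rule ring_rearrange(1))
  ultimately have "\<eta> $ (insert z J, l) = (?t (\<eta> $ (insert z J, l)) + const (u $ l) * (\<eta> $ (insert z J, z) + ?S))
      - (\<Sum>i\<in>- insert z J. const (u $ i * shuffle_sign {i} J) * \<eta> $ (insert i J, l))" by (simp only:)
  then show "\<eta> $ (insert z J, l) - ?t (\<eta> $ (insert z J, l)) = const (u $ l) * \<eta> $ (insert z J, z)
      - (\<Sum>i\<in>- insert z J. const (u $ i * shuffle_sign {i} J) * \<eta> $ (insert i J, l)) + const (u $ l) * ?S"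
    by (rule ring_rearrange(2))
qed

end

section \<open>Powers of the hyperplane form forced on leading coefficients\<close>

lemma const_mult_dvdD:
  assumes "r \<noteq> 0" "x dvd const r * (f :: ('a::field, 'n::{finite, linorder}) pol)"
  shows "x dvd f"
proof -
  have "x dvd const (inverse r) * (const r * f)" using assms(2) by (rule dvd_mult)
  then show ?thesis using assms(1) by (simp flip: mult.assoc const_mult)
qed

context std_group
begin

lemma axis_z: "a \<in> P \<Longrightarrow> axis a (1::'a) $ z = 0"
  using z_notin by (auto simp: axis_def)

text \<open>With the Taylor expansion, the second transvection relation becomes
  \<open>u_l q(u) = L_l(u)\<close> modulo \<open>x_z^2\<close>, where \<open>q\<close> and
  \<open>L_l\<close> are linear in \<open>u\<close>. The left side is quadratic and the right side
  linear, so the relations for two different roots isolate \<open>q\<close> at the root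
  \<open>v_a\<close>, which is the wanted coefficient up to sign.\<close>

lemma quadratic_dvd:
  assumes d: "d = 0" and a: "a \<in> P" "a \<notin> J" and J: "z \<notin> J" and \<eta>: "\<eta> \<in> invars Grp k"
  shows "var z ^ 2 dvd \<eta> $ (insert a J, z)"
proof -
  define q where "q u = (\<Sum>i\<in>- insert z J. const (u $ i * shuffle_sign {i} J) * \<eta> $ (insert i J, z))" for u
  have "\<forall>l. \<exists>D. \<forall>u. u $ z = 0 \<longrightarrow> var z ^ 2 dvd \<eta> $ (insert z J, l) - pol_act (smat z 1 u) (\<eta> $ (insert z J, l))
      - var z * (\<Sum>i\<in>UNIV. const (u $ i) * D i)"
    by (intro allI pol_act_smat_taylor)
  from choice[OF this] obtain D where D: "\<And>l u. u $ z = 0 \<Longrightarrow>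
      var z ^ 2 dvd \<eta> $ (insert z J, l) - pol_act (smat z 1 u) (\<eta> $ (insert z J, l)) - var z * (\<Sum>i\<in>UNIV. const (u $ i) * D l i)"
    by blast
  define L where "L l u = (\<Sum>i\<in>- insert z J. const (u $ i * shuffle_sign {i} J) * \<eta> $ (insert i J, l))
      + var z * (\<Sum>i\<in>UNIV. const (u $ i) * D l i) - const (u $ l) * \<eta> $ (insert z J, z)" for l u
  have key: "var z ^ 2 dvd const (u $ l) * q u - L l u" if "smat z 1 u \<in> Grp" "u $ z = 0" "l \<noteq> z" for u l
  proof -
    have "\<eta> $ (insert z J, l) - pol_act (smat z 1 u) (\<eta> $ (insert z J, l)) - var z * (\<Sum>i\<in>UNIV. const (u $ i) * D l i)
        = const (u $ l) * q u - L l u"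
      unfolding transvection_relations(2)[OF \<eta> that(1,2) J that(3)] L_def q_def by (simp only: algebra_simps)
    then show ?thesis using D[OF that(2), of l] by (simp only:)
  qed
  have q_add: "q (v + w) = q v + q w" for v w
    by (simp add: q_def distrib_right const_add sum.distrib)
  have L_add: "L l (v + w) = L l v + L l w" for l v w
    by (simp add: L_def distrib_right distrib_left const_add sum.distrib)
  have q_scale: "q (r *s v) = const r * q v" for r v
    by (simp add: q_def sum_distrib_left const_mult mult_ac)
  have L_scale: "L l (r *s v) = const r * L l v" for l r v
    by (simp add: L_def sum_distrib_left const_mult distrib_left right_diff_distrib mult_ac)
  let ?v = "axis a (1::'a)"
  have az: "a \<noteq> z" using a z_notin by auto
  have v: "smat z 1 ?v \<in> Grp" "?v $ z = 0" using trans axis_z a by blast+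
  obtain w where w: "w \<noteq> 0" "w \<noteq> ?v" "w $ z = 0" "smat z 1 w \<in> Grp" "smat z 1 (?v + w) \<in> Grp"
    using delta0[OF d a(1)] by blast
  have "var z ^ 2 dvd q ?v"
  proof (cases "\<exists>l. l \<noteq> a \<and> w $ l \<noteq> 0")
    case True
    then obtain l where l: "l \<noteq> a" "w $ l \<noteq> 0" by blast
    then have lz: "l \<noteq> z" using w(3) by auto
    have vl: "?v $ l = 0" "(?v + w) $ l = w $ l" using l by (auto simp: axis_def)
    \<comment> \<open>At an index \<open>l\<close> where \<open>v_a\<close> vanishes and
      \<open>w\<close> does not, the relation for \<open>v_a + w\<close> minus those for
      \<open>v_a\<close> and \<open>w\<close> leaves \<open>w_l q(v_a)\<close>.\<close>
    have 1: "var z ^ 2 dvd - L l ?v" using key[OF v lz] unfolding vl by simp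
    have 2: "var z ^ 2 dvd const (w $ l) * q w - L l w" using key[OF w(4,3) lz] .
    have "(?v + w) $ z = 0" using v w by simp
    from key[OF w(5) this lz] have 3: "var z ^ 2 dvd const (w $ l) * (q ?v + q w) - (L l ?v + L l w)"
      unfolding vl q_add L_add .
    have "const (w $ l) * q ?v = (const (w $ l) * (q ?v + q w) - (L l ?v + L l w)) - (- L l ?v) - (const (w $ l) * q w - L l w)"
      by (simp only: algebra_simps) simp
    also have "var z ^ 2 dvd \<dots>" by (intro dvd_diff 1 2 3)
    finally show ?thesis using l(2) by (rule const_mult_dvdD[rotated])
  next
    case False
    \<comment> \<open>Now \<open>w = r v_a\<close> with \<open>r\<close> neither 0 nor 1. Scaling
      multiplies the quadratic side by \<open>r^2\<close> and the linear side by \<open>r\<close>,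
      so \<open>(r^2 - r) q(v_a)\<close> vanishes modulo \<open>x_z^2\<close>.\<close>
    let ?r = "w $ a"
    have wr: "w = ?r *s ?v" using False by (auto simp: vec_eq_iff axis_def)
    have r: "?r \<noteq> 0" "?r \<noteq> 1"
      using w(1,2) wr by (metis vector_smult_lzero, metis vector_smult_lid)
    have v1: "?v $ a = 1" by (simp add: axis_def)
    have 1: "var z ^ 2 dvd const ?r * (q ?v - L a ?v)"
      using key[OF v az] unfolding v1 const_1 mult_1 by (rule dvd_mult)
    have "var z ^ 2 dvd const ?r * q (?r *s ?v) - L a (?r *s ?v)"
      using key[OF w(4,3) az] unfolding wr[symmetric] .
    then have 2: "var z ^ 2 dvd const ?r * (const ?r * q ?v) - const ?r * L a ?v"
      unfolding q_scale L_scale .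
    have "const (?r * ?r - ?r) * q ?v = (const ?r * (const ?r * q ?v) - const ?r * L a ?v) - const ?r * (q ?v - L a ?v)"
      unfolding const_diff const_mult by (simp only: algebra_simps)
    also have "var z ^ 2 dvd \<dots>" by (intro dvd_diff 1 2)
    finally have "var z ^ 2 dvd const (?r * ?r - ?r) * q ?v" .
    moreover have "?r * ?r - ?r \<noteq> 0" using r by simp
    ultimately show ?thesis by (rule const_mult_dvdD[rotated])
  qed
  also have "q ?v = (\<Sum>i\<in>- insert z J. if i = a then const (shuffle_sign {a} J) * \<eta> $ (insert a J, z) else 0)"
    unfolding q_def by (intro sum.cong refl) (simp add: axis_def)
  also have "\<dots> = const (shuffle_sign {a} J) * \<eta> $ (insert a J, z)" using a az by simp
  finally show ?thesis by (rule const_mult_dvdD[rotated]) (simp add: shuffle_sign_def)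
qed

lemma inv_zeta_power: "0 < m \<Longrightarrow> m < e \<Longrightarrow> (1 / \<zeta>) ^ m \<noteq> 1"
proof
  assume m: "0 < m" "m < e" and "(1 / \<zeta>) ^ m = 1"
  then have "\<zeta> ^ m = 1" using zeta_nz by (simp add: power_one_over)
  then have "e dvd m" by (rule gen(3))
  then show False using m by (simp add: dvd_imp_le leD)
qed

text \<open>The diagonal element admits only exact exponents \<open>m\<close> with
  \<open>\<kappa> \<zeta>^(-m) = 1\<close>, that is, one residue class modulo \<open>e\<close>: 1 in
  the first layer, 0 in the next two, -1 in the last. Transvections push the exponent past the
  smallest admissible value where this is possible, and \<open>lift_dvd\<close> carries it to the
  next one.\<close>

lemma layer_dvd:
  assumes \<eta>: "\<eta> \<in> invars Grp k" and lower: "\<And>q. lay q < lay p \<Longrightarrow> \<eta> $ q = 0"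
  shows "var z ^ cexp p dvd \<eta> $ p"
proof -
  obtain K j where p: "p = (K, j)" by (cases p)
  have "sext_act (smat z \<zeta> 0) \<eta> = \<eta>" using \<eta> gen(1) by (simp add: invars_def)
  then have f: "\<eta> $ p = const (kappa \<zeta> p) * pol_act (smat z \<zeta> 0) (\<eta> $ p)"
    using zeta_nz by (intro lead[OF refl _ _ _ lower]) simp_all
  note lift = lift_dvd[OF f]
  have low: "lay (K', l) < lay (K, j) \<Longrightarrow> \<eta> $ (K', l) = 0" for K' l using lower p by simp
  have vd: "var z dvd g - pol_act (smat z 1 u) g" if "u $ z = 0" for g u
    using that by (intro var_dvd_diff_pol_act_smat) simp_all
  consider (L0) "j = z" "z \<notin> K" | (L1) "j = z" "z \<in> K" | (L2) "j \<noteq> z" "z \<notin> K" | (L3) "j \<noteq> z" "z \<in> K" by blast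
  then show ?thesis
  proof cases
    case L0
    have k: "kappa \<zeta> p = \<zeta>" using L0 by (simp add: p kappa_def)
    have x1: "var z ^ 1 dvd \<eta> $ p"
    proof (cases "P = {}")
      case True
      then have "e > 1" using nontriv by simp
      then have "\<zeta> \<noteq> 1" using inv_zeta_power[of 1] by auto
      then have ne: "kappa \<zeta> p * (1 / \<zeta>) ^ m \<noteq> 1" if "0 \<le> m" "m < 1" for m
      proof -
        have "m = 0" using that by simp
        then show ?thesis using \<open>\<zeta> \<noteq> 1\<close> unfolding k by simp
      qed
      show ?thesis by (rule lift[of 0], simp, rule ne) simp_all
    next
      case False
      then obtain a where a: "a \<in> P" by blast
      then have "a \<noteq> z" using z_notin by auto
      note transvection_relations(1)[OF \<eta> trans[OF a] axis_z[OF a] L0(2) this]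
      moreover have "axis a (1::'a) $ a = 1" by (simp add: axis_def)
      ultimately have "\<eta> $ p = \<eta> $ (K, a) - pol_act (smat z 1 (axis a 1)) (\<eta> $ (K, a))"
        unfolding p L0(1) by simp
      then show ?thesis using vd[OF axis_z[OF a]] by (simp only: power_one_right)
    qed
    show ?thesis
    proof (cases "K \<inter> P = {} \<or> d = 1")
      case True
      then have "cexp p = 1" using L0 delta1 by (auto simp: p cexp_def)
      then show ?thesis using x1 by simp
    next
      case False
      then have d: "d = 0" using delta_cases by blast
      obtain a where a: "a \<in> K" "a \<in> P" using False by blast
      have K: "insert a (K - {a}) = K" using a by auto
      have "var z ^ 2 dvd \<eta> $ (insert a (K - {a}), z)"
        using L0 by (intro quadratic_dvd[OF d a(2) _ _ \<eta>]) simp_all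
      then have x2: "var z ^ 2 dvd \<eta> $ p" unfolding K p L0(1) .
      \<comment> \<open>Admissible exponents are congruent to 1 modulo \<open>e\<close>; having
        passed 1, the next is \<open>e + 1\<close>.\<close>
      have ne: "kappa \<zeta> p * (1 / \<zeta>) ^ m \<noteq> 1" if "2 \<le> m" "m < e + 1" for m
      proof -
        have "\<zeta> * (1 / \<zeta>) ^ Suc (m - 1) = (1 / \<zeta>) ^ (m - 1)" using zeta_nz by simp
        moreover have "(1 / \<zeta>) ^ (m - 1) \<noteq> 1" using that by (intro inv_zeta_power) auto
        moreover have "Suc (m - 1) = m" using that by simp
        ultimately show ?thesis unfolding k by metis
      qed
      have le: "2 \<le> e + 1" using e_pos by simp
      have "var z ^ (e + 1) dvd \<eta> $ p" by (rule lift[OF x2 _ le], rule ne)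
      moreover have "cexp p = e + 1" unfolding p cexp_def using False L0 d by simp
      ultimately show ?thesis by (simp only:)
    qed
  next
    case L1
    have k: "kappa \<zeta> p = 1" using L1 zeta_nz by (simp add: p kappa_def)
    show ?thesis
    proof (cases "K \<inter> P = {}")
      case True
      then show ?thesis using L1 by (simp add: p cexp_def)
    next
      case False
      then obtain a where a: "a \<in> K" "a \<in> P" by blast
      then have az: "a \<noteq> z" using z_notin by auto
      let ?J = "K - {z}" and ?u = "axis a (1::'a)"
      have K: "insert z ?J = K" using L1 by auto
      \<comment> \<open>The root is \<open>v_a\<close> with \<open>a \<in> K\<close>, while the sum
        runs over indices outside \<open>K\<close>; the relation reduces to the coefficient at
        \<open>v_z\<close>.\<close>
      have 0: "const (?u $ i * shuffle_sign {i} ?J) = 0" if "i \<in> - K" for i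
        using that a by (auto simp: axis_def)
      have s0: "(\<Sum>i\<in>-K. const (?u $ i * shuffle_sign {i} ?J) * h i) = 0" for h
        by (intro sum.neutral ballI) (simp only: 0 mult_zero_left)
      have "z \<notin> ?J" by simp
      note transvection_relations(2)[OF \<eta> trans[OF a(2)] axis_z[OF a(2)] this az]
      moreover have "?u $ a = 1" by (simp add: axis_def)
      ultimately have "\<eta> $ p = \<eta> $ (K, a) - pol_act (smat z 1 ?u) (\<eta> $ (K, a))"
        unfolding K s0 p L1(1) by simp
      then have x1: "var z ^ 1 dvd \<eta> $ p" using vd[OF axis_z[OF a(2)]] by (simp only: power_one_right)
      have ne: "kappa \<zeta> p * (1 / \<zeta>) ^ m \<noteq> 1" if "1 \<le> m" "m < e" for m
        unfolding k mult_1 using that by (intro inv_zeta_power) simp_all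
      have le: "1 \<le> e" using e_pos by simp
      have "var z ^ e dvd \<eta> $ p" by (rule lift[OF x1 _ le], rule ne)
      then show ?thesis using False L1 by (simp add: p cexp_def)
    qed
  next
    case L2
    have k: "kappa \<zeta> p = 1" using L2 by (simp add: p kappa_def)
    show ?thesis
    proof (cases "K \<inter> P = {}")
      case True
      then show ?thesis using L2 by (simp add: p cexp_def)
    next
      case False
      then obtain a where a: "a \<in> K" "a \<in> P" by blast
      then have az: "a \<noteq> z" using z_notin by auto
      let ?J = "K - {a}" and ?u = "axis a (1::'a)"
      have K: "insert a ?J = K" using a by auto
      have zJ: "z \<notin> ?J" using L2 by simp
      \<comment> \<open>The relation is used at \<open>K\<close> with \<open>a\<close> exchanged for
        \<open>z\<close>. Its terms at \<open>v_z\<close> lie in lower layers, and of the remaining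
        sum only \<open>i = a\<close> survives, which restores \<open>K\<close>.\<close>
      have C: "\<eta> $ (insert z ?J, z) = 0" using L2 by (intro low) (simp add: lay_def)
      have "\<eta> $ (insert i ?J, z) = 0" if "i \<in> - insert z ?J" for i
        using L2 that zJ by (intro low) (auto simp: lay_def)
      then have s0: "(\<Sum>i\<in>- insert z ?J. const (?u $ i * shuffle_sign {i} ?J) * \<eta> $ (insert i ?J, z)) = 0"
        by (intro sum.neutral ballI) (simp only: mult_zero_right)
      have "(\<Sum>i\<in>- insert z ?J. const (?u $ i * shuffle_sign {i} ?J) * \<eta> $ (insert i ?J, j)) =
          (\<Sum>i\<in>- insert z ?J. if i = a then const (shuffle_sign {a} ?J) * \<eta> $ p else 0)"
        by (intro sum.cong refl) (auto simp: axis_def p insert_absorb[OF a(1)])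
      also have "\<dots> = const (shuffle_sign {a} ?J) * \<eta> $ p" using az by simp
      finally have s1: "(\<Sum>i\<in>- insert z ?J. const (?u $ i * shuffle_sign {i} ?J) * \<eta> $ (insert i ?J, j)) =
          const (shuffle_sign {a} ?J) * \<eta> $ p" .
      have E: "\<eta> $ (insert z ?J, j) - pol_act (smat z 1 ?u) (\<eta> $ (insert z ?J, j)) = - (const (shuffle_sign {a} ?J) * \<eta> $ p)"
        unfolding transvection_relations(2)[OF \<eta> trans[OF a(2)] axis_z[OF a(2)] zJ L2(1)] C s0 s1 by simp
      have "var z dvd - (const (shuffle_sign {a} ?J) * \<eta> $ p)"
        using vd[OF axis_z[OF a(2)], of "\<eta> $ (insert z ?J, j)"] unfolding E .
      then have "var z dvd const (shuffle_sign {a} ?J) * \<eta> $ p" by (simp only: dvd_minus_iff)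
      then have "var z dvd \<eta> $ p" by (rule const_mult_dvdD[rotated]) (simp add: shuffle_sign_def)
      then have x1: "var z ^ 1 dvd \<eta> $ p" by (simp only: power_one_right)
      have ne: "kappa \<zeta> p * (1 / \<zeta>) ^ m \<noteq> 1" if "1 \<le> m" "m < e" for m
        unfolding k mult_1 using that by (intro inv_zeta_power) simp_all
      have le: "1 \<le> e" using e_pos by simp
      have "var z ^ e dvd \<eta> $ p" by (rule lift[OF x1 _ le], rule ne)
      then show ?thesis using False L2 by (simp add: p cexp_def)
    qed
  next
    case L3
    have k: "kappa \<zeta> p = 1 / \<zeta>" using L3 by (simp add: p kappa_def)
    \<comment> \<open>Here the smallest admissible exponent is already \<open>e - 1\<close>, reached
      from 0 without any transvection.\<close>
    have ne: "kappa \<zeta> p * (1 / \<zeta>) ^ m \<noteq> 1" if "0 \<le> m" "m < e - 1" for m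
      unfolding k power_Suc[symmetric] using that by (intro inv_zeta_power) simp_all
    have "var z ^ (e - 1) dvd \<eta> $ p" by (rule lift[of 0], simp, rule ne) simp_all
    then show ?thesis using L3 by (simp add: p cexp_def)
  qed
qed

lemma invars_span:
  assumes \<eta>: "\<eta> \<in> invars Grp k" and ps: "set ps = basis_index k"
  shows "\<eta> \<in> S_span (map bb ps)"
proof -
  have "\<exists>\<eta>'\<in>invars Grp k. (\<forall>q. lay q < t \<longrightarrow> \<eta>' $ q = 0) \<and> \<eta> - \<eta>' \<in> S_span (map bb ps)" for t
  proof (induction t)
    case 0
    show ?case using \<eta> S_span_0 by (intro bexI[of _ \<eta>]) auto
  next
    case (Suc t)
    then obtain \<eta>' where \<eta>': "\<eta>' \<in> invars Grp k" "\<And>q. lay q < t \<Longrightarrow> \<eta>' $ q = 0" "\<eta> - \<eta>' \<in> S_span (map bb ps)"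
      by blast
    have "\<exists>\<theta>\<in>invars Grp k. (\<forall>q. lay q < Suc t \<longrightarrow> \<theta> $ q = 0) \<and> \<eta>' - \<theta> \<in> S_span (map bb ps)"
      using \<eta>'(2) by (intro eliminate_layer[OF \<eta>'(1) ps] layer_dvd[OF \<eta>'(1)]) auto
    then obtain \<theta> where \<theta>: "\<theta> \<in> invars Grp k" "\<forall>q. lay q < Suc t \<longrightarrow> \<theta> $ q = 0" "\<eta>' - \<theta> \<in> S_span (map bb ps)"
      by blast
    have "\<eta> - \<theta> = (\<eta> - \<eta>') + (\<eta>' - \<theta>)" by simp
    then have "\<eta> - \<theta> \<in> S_span (map bb ps)" using S_span_add[OF \<eta>'(3) \<theta>(3)] by (simp only:)
    then show ?case using \<theta> by blast
  qed
  from this[of 4] obtain \<eta>' where \<eta>': "\<And>q. lay q < 4 \<Longrightarrow> \<eta>' $ q = 0" "\<eta> - \<eta>' \<in> S_span (map bb ps)" by blast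
  have "lay q < 4" for q by (simp add: lay_def)
  then have "\<eta>' = 0" using \<eta>'(1) unfolding vec_eq_iff zero_index by blast
  then show ?thesis using \<eta>'(2) by simp
qed

end

section \<open>Orders in finite multiplicative groups of a field\<close>

definition has_order :: "'a::field \<Rightarrow> nat \<Rightarrow> bool" where
  "has_order c e \<longleftrightarrow> e > 0 \<and> (\<forall>m. c ^ m = 1 \<longleftrightarrow> e dvd m)"

lemma has_order_unique: "has_order c e \<Longrightarrow> has_order c e' \<Longrightarrow> e = e'"
  unfolding has_order_def by (metis dvd_antisym dvd_refl)

lemma has_order_mult:
  assumes a: "has_order a m" and b: "has_order b n" and co: "coprime m n"
  shows "has_order (a * b) (m * n)"
proof -
  have "(a * b) ^ t = 1 \<longleftrightarrow> m * n dvd t" for t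
  proof
    assume t: "(a * b) ^ t = 1"
    have bn: "b ^ (t * n) = 1" and am: "a ^ (t * m) = 1"
      using a b unfolding has_order_def by simp_all
    have "a ^ (t * n) * b ^ (t * n) = 1" "a ^ (t * m) * b ^ (t * m) = 1"
      using t by (simp_all add: power_mult flip: power_mult_distrib)
    then have "a ^ (t * n) = 1" "b ^ (t * m) = 1" using bn am by simp_all
    then have "m dvd t * n" "n dvd t * m" using a b unfolding has_order_def by simp_all
    then have "m dvd t" "n dvd t"
      using co by (simp_all add: coprime_dvd_mult_left_iff coprime_commute)
    then show "m * n dvd t" using co by (simp add: divides_mult)
  next
    assume "m * n dvd t"
    then have "m dvd t" "n dvd t" by (auto elim: dvd_mult_left dvd_mult_right)
    then have "a ^ t = 1" "b ^ t = 1" using a b unfolding has_order_def by blast+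
    then show "(a * b) ^ t = 1" by (simp add: power_mult_distrib)
  qed
  then show ?thesis using a b unfolding has_order_def by simp
qed

lemma has_order_power:
  assumes "has_order c (x * y)" shows "has_order (c ^ x) y"
proof -
  have xy: "x * y > 0" and o: "\<And>m. c ^ m = 1 \<longleftrightarrow> x * y dvd m" using assms unfolding has_order_def by auto
  have "(c ^ x) ^ m = 1 \<longleftrightarrow> y dvd m" for m
    using o[of "x * m"] xy by (simp add: power_mult)
  then show ?thesis using xy unfolding has_order_def by simp
qed

lemma has_order_exists:
  assumes fin: "finite C" and nz: "0 \<notin> C" and mult: "\<And>a b. a \<in> C \<Longrightarrow> b \<in> C \<Longrightarrow> a * b \<in> C" and c: "c \<in> C"
  shows "\<exists>e. has_order c e"
proof -
  have C: "c ^ Suc m \<in> C" for m using c mult by (induction m) auto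
  have "\<not> inj (\<lambda>m. c ^ Suc m)"
  proof
    assume "inj (\<lambda>m. c ^ Suc m)"
    moreover have "range (\<lambda>m. c ^ Suc m) \<subseteq> C" using C by auto
    ultimately show False using fin by (meson finite_subset range_inj_infinite)
  qed
  then obtain i j where ij: "i < j" "c ^ Suc i = c ^ Suc j"
    unfolding inj_def by (metis nat_neq_iff)
  have c0: "c \<noteq> 0" using c nz by auto
  have "c ^ Suc j = c ^ Suc i * c ^ (j - i)" using ij(1) by (simp flip: power_add)
  then have ex: "0 < j - i \<and> c ^ (j - i) = 1" using ij c0 by auto
  define e where "e = (LEAST m. 0 < m \<and> c ^ m = 1)"
  have e: "0 < e" "c ^ e = 1" using LeastI[of "\<lambda>m. 0 < m \<and> c ^ m = 1", OF ex] unfolding e_def by auto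
  have "e dvd m" if "c ^ m = 1" for m
  proof -
    have "c ^ m = (c ^ e) ^ (m div e) * c ^ (m mod e)"
      by (metis power_add power_mult mult_div_mod_eq)
    then have "c ^ (m mod e) = 1" using that e by simp
    moreover have "m mod e < e" using e by simp
    ultimately have "m mod e = 0" using not_less_Least[of "m mod e" "\<lambda>m. 0 < m \<and> c ^ m = 1"] unfolding e_def by auto
    then show ?thesis by auto
  qed
  moreover have "c ^ m = 1" if "e dvd m" for m using that e by (auto simp: power_mult)
  ultimately show ?thesis using e unfolding has_order_def by blast
qed

text \<open>If some prime \<open>p\<close> occurred in \<open>a\<close> with higher multiplicity
  than in \<open>e\<close>, a power of \<open>c\<close> carrying the p-part of \<open>a\<close>
  times a power of \<open>\<zeta>\<close> carrying the rest of \<open>e\<close> would have order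
  greater than \<open>e\<close>.\<close>

lemma order_dvd_max_order:
  assumes fin: "finite C" and nz: "0 \<notin> C" and mult: "\<And>a b. a \<in> C \<Longrightarrow> b \<in> C \<Longrightarrow> a * b \<in> C" and one: "1 \<in> C"
    and \<zeta>: "\<zeta> \<in> C" "has_order \<zeta> e" and max: "\<And>c m. c \<in> C \<Longrightarrow> has_order c m \<Longrightarrow> m \<le> e"
    and c: "c \<in> C" "has_order c a"
  shows "a dvd e"
proof (rule multiplicity_le_imp_dvd)
  have pos: "a > 0" "e > 0" using \<zeta> c unfolding has_order_def by auto
  then show "a \<noteq> 0" by simp
  have pow: "x ^ m \<in> C" if "x \<in> C" for x m using that mult one by (induction m) auto
  fix p :: nat assume p: "prime p"
  show "multiplicity p a \<le> multiplicity p e"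
  proof (rule ccontr)
    assume "\<not> ?thesis"
    then have less: "multiplicity p e < multiplicity p a" by simp
    have np: "\<not> is_unit p" using p not_prime_unit by blast
    have a0: "a \<noteq> 0" and e0: "e \<noteq> 0" using pos by simp_all
    obtain a' where a': "a = p ^ multiplicity p a * a'" "\<not> p dvd a'"
      by (rule multiplicity_decompose'[OF a0 np]) (rule that)
    obtain e' where e': "e = p ^ multiplicity p e * e'" "\<not> p dvd e'"
      by (rule multiplicity_decompose'[OF e0 np]) (rule that)
    have "a' * p ^ multiplicity p a = a" using a'(1) by (simp only: mult.commute)
    then have "has_order (c ^ a') (p ^ multiplicity p a)"
      by (intro has_order_power) (simp only: c(2))
    moreover have "p ^ multiplicity p e * e' = e" using e'(1) by (rule sym)
    then have "has_order (\<zeta> ^ (p ^ multiplicity p e)) e'"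
      by (intro has_order_power) (simp only: \<zeta>(2))
    moreover have "coprime (p ^ multiplicity p a) e'"
      using prime_imp_coprime[OF p e'(2)] by (rule coprime_power_left_iff[THEN iffD2, OF disjI1])
    ultimately have "has_order (c ^ a' * \<zeta> ^ (p ^ multiplicity p e)) (p ^ multiplicity p a * e')"
      by (rule has_order_mult)
    moreover have "c ^ a' * \<zeta> ^ (p ^ multiplicity p e) \<in> C" by (intro mult pow c(1) \<zeta>(1))
    ultimately have "p ^ multiplicity p a * e' \<le> e" using max by blast
    moreover have "e' > 0" using e'(2) by (cases e') auto
    moreover have "p ^ multiplicity p e < p ^ multiplicity p a"
      using less prime_gt_1_nat[OF p] by simp
    then have "p ^ multiplicity p e * e' < p ^ multiplicity p a * e'"
      using \<open>e' > 0\<close> by (rule mult_less_mono1)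
    ultimately show False using e'(1) by linarith
  qed
qed

section \<open>The sum of the exponents\<close>

lemma card_subsets_avoiding:
  fixes A :: "'n::finite set"
  shows "card {K. card K = k \<and> K \<inter> A = {}} = (CARD('n) - card A) choose k"
proof -
  have "{K. card K = k \<and> K \<inter> A = {}} = {K. K \<subseteq> - A \<and> card K = k}" by auto
  then show ?thesis using n_subsets[of "- A" k] by (simp add: Compl_eq_Diff_UNIV card_Diff_subset)
qed

lemma card_subsets_containing:
  fixes A :: "'n::finite set"
  assumes "z \<notin> A"
  shows "card {K. card K = k \<and> z \<in> K \<and> K \<inter> A = {}} =
    (if k = 0 then 0 else (CARD('n) - 1 - card A) choose (k - 1))"
proof (cases "k = 0")
  case True
  then have "{K :: 'n set. card K = k \<and> z \<in> K \<and> K \<inter> A = {}} = {}" by auto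
  then show ?thesis using True by simp
next
  case False
  have "bij_betw (insert z) {K. card K = k - 1 \<and> K \<inter> insert z A = {}} {K :: 'n set. card K = k \<and> z \<in> K \<and> K \<inter> A = {}}"
  proof (rule bij_betwI[where g = "\<lambda>K. K - {z}"])
    show "insert z \<in> {K. card K = k - 1 \<and> K \<inter> insert z A = {}} \<rightarrow> {K. card K = k \<and> z \<in> K \<and> K \<inter> A = {}}"
      using False assms by (auto simp: card_insert_if)
    show "(\<lambda>K. K - {z}) \<in> {K. card K = k \<and> z \<in> K \<and> K \<inter> A = {}} \<rightarrow> {K. card K = k - 1 \<and> K \<inter> insert z A = {}}"
      by (auto simp: card_Diff_singleton)
  qed auto
  then have "card {K :: 'n set. card K = k \<and> z \<in> K \<and> K \<inter> A = {}} = card {K :: 'n set. card K = k - 1 \<and> K \<inter> insert z A = {}}"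
    by (rule bij_betw_same_card[symmetric])
  also have "\<dots> = (CARD('n) - card (insert z A)) choose (k - 1)"
    by (rule card_subsets_avoiding)
  also have "CARD('n) - card (insert z A) = CARD('n) - 1 - card A" using assms by simp
  finally show ?thesis using False by (simp only: if_False)
qed

lemma binom_nat: "binom (int a) (int b) = a choose b"
  by (simp add: binom_def binomial_eq_0)

lemma binom_pred: "binom (int a) (int k - 1) = (if k = 0 then 0 else a choose (k - 1))"
  using binom_nat[of a "k - 1"] by (cases k) (simp_all add: binom_def)

text \<open>\<open>d = 1\<close> comes with \<open>e = 1\<close>, so \<open>e (n - d)\<close> equals
  \<open>n e - d\<close>; this is how the factor \<open>n - d\<close> of the exponent formula
  arises.\<close>

lemma exponent_arith:
  fixes A0 A1 B0 B1 n e d :: nat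
  assumes "A1 \<le> A0" "B1 \<le> B0" "d = 0 \<or> (d = 1 \<and> e = 1)" "e > 0" "n > 0"
  shows "A0 + (A0 - A1) * (n * e - d) + (B0 * ((n - 1) * (e - 1)) + (B0 - B1) * e) =
    A0 + (e - 1) * ((n - 1) * B0) + e * ((n - d) * (A0 - A1) + (B0 - B1))"
proof -
  have "e * (n - d) = n * e - d" using assms(3) by (auto simp: mult.commute)
  then have "e * ((n - d) * (A0 - A1)) = (A0 - A1) * (n * e - d)" by (metis mult.assoc mult.commute)
  then show ?thesis by (simp add: algebra_simps)
qed

context std_group
begin

text \<open>The sets \<open>K\<close> fall into four classes, according to whether they contain
  \<open>z\<close> and whether they meet \<open>P\<close>, with constant row sums of the exponents.
  The binomials with \<open>n - b - 1\<close> count the sets avoiding \<open>P\<close>.\<close>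

lemma sum_cexp:
  fixes b :: nat
  defines "b \<equiv> card P"
  shows "(\<Sum>p\<in>basis_index k. cexp p) =
    binom (int CARD('n) - 1) (int k) + (e - 1) * ((CARD('n) - 1) * binom (int CARD('n) - 1) (int k - 1))
    + e * ((CARD('n) - d) * (binom (int CARD('n) - 1) (int k) - binom (int CARD('n) - int b - 1) (int k))
       + (binom (int CARD('n) - 1) (int k - 1) - binom (int CARD('n) - int b - 1) (int k - 1)))"
proof -
  let ?n = "CARD('n)"
  let ?S = "{K :: 'n set. card K = k}"
  have n0: "?n > 0" by simp
  have bn: "b \<le> ?n - 1"
  proof -
    have "card P \<le> card (UNIV - {z})" using z_notin by (intro card_mono) auto
    then show ?thesis by (simp add: b_def card_Diff_singleton)
  qed
  \<comment> \<open>For a set without \<open>z\<close> that meets \<open>P\<close>, the column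
    \<open>z\<close> gives \<open>e + 1 - d\<close> and each of the other \<open>n - 1\<close>
    columns gives \<open>e\<close>. The summand 1 occurs for all sets without \<open>z\<close> and
    becomes the leading binomial.\<close>
  have row: "(\<Sum>j\<in>UNIV. cexp (K, j)) = (if z \<notin> K then 1 + (if K \<inter> P \<noteq> {} then ?n * e - d else 0)
     else (?n - 1) * (e - 1) + (if K \<inter> P \<noteq> {} then e else 0))" for K
  proof -
    have cU: "card (UNIV - {z}) = ?n - 1" by (simp add: card_Diff_singleton)
    have "(\<Sum>j\<in>UNIV - {z}. cexp (K, j)) = (\<Sum>j\<in>UNIV - {z}. if z \<notin> K then if K \<inter> P = {} then 0 else e else e - 1)"
      by (intro sum.cong) (auto simp: cexp_def)
    then have "(\<Sum>j\<in>UNIV. cexp (K, j)) = cexp (K, z) + (?n - 1) * (if z \<notin> K then if K \<inter> P = {} then 0 else e else e - 1)"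
      unfolding sum.remove[of UNIV z "\<lambda>j. cexp (K, j)", OF finite UNIV_I] by (simp only: sum_constant cU of_nat_id)
    moreover have "e + 1 - d + (?n - 1) * e = 1 + (?n * e - d)"
    proof -
      have "d \<le> e" using delta_cases e_pos by auto
      moreover have "?n * e = e + (?n - 1) * e" using n0 by (metis Suc_diff_1 mult_Suc)
      ultimately show ?thesis by simp
    qed
    ultimately show ?thesis by (simp add: cexp_def)
  qed
  let ?Az = "card {K \<in> ?S. z \<notin> K}" and ?A = "card {K \<in> ?S. z \<notin> K \<and> K \<inter> P \<noteq> {}}"
  let ?Bz = "card {K \<in> ?S. z \<in> K}" and ?B = "card {K \<in> ?S. z \<in> K \<and> K \<inter> P \<noteq> {}}"
  have "(\<Sum>p\<in>basis_index k. cexp p) = (\<Sum>K\<in>?S. \<Sum>j\<in>UNIV. cexp (K, j))"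
    unfolding basis_index_def by (simp add: sum.cartesian_product)
  also have "\<dots> = (\<Sum>K\<in>?S. ((if z \<notin> K then 1 else 0) + (if z \<notin> K \<and> K \<inter> P \<noteq> {} then ?n * e - d else 0)) +
     ((if z \<in> K then (?n - 1) * (e - 1) else 0) + (if z \<in> K \<and> K \<inter> P \<noteq> {} then e else 0)))"
    unfolding row by (intro sum.cong) auto
  also have "\<dots> = (?Az * 1 + ?A * (?n * e - d)) + (?Bz * ((?n - 1) * (e - 1)) + ?B * e)"
  proof -
    have "(\<Sum>K\<in>?S. if R K then c else 0) = card {K \<in> ?S. R K} * c" for R and c :: nat
      by (subst sum.inter_filter[symmetric]) simp_all
    then show ?thesis unfolding sum.distrib by (simp only:)
  qed
  finally have tot: "(\<Sum>p\<in>basis_index k. cexp p) = ?Az + ?A * (?n * e - d) + (?Bz * ((?n - 1) * (e - 1)) + ?B * e)"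
    by simp
  define A1 where "A1 = card {K \<in> ?S. z \<notin> K \<and> K \<inter> P = {}}"
  define B1 where "B1 = card {K \<in> ?S. z \<in> K \<and> K \<inter> P = {}}"
  have A: "?Az = A1 + ?A"
    unfolding A1_def by (subst card_Un_disjoint[symmetric]) (auto intro!: arg_cong[of _ _ card])
  have B: "?Bz = B1 + ?B"
    unfolding B1_def by (subst card_Un_disjoint[symmetric]) (auto intro!: arg_cong[of _ _ card])
  have nm: "int ?n - 1 = int (?n - 1)" "int ?n - int b - 1 = int (?n - 1 - b)" using n0 bn by linarith+
  have "{K \<in> ?S. z \<notin> K} = {K. card K = k \<and> K \<inter> {z} = {}}" by auto
  then have cA0: "?Az = binom (int ?n - 1) (int k)"
    unfolding nm binom_nat using card_subsets_avoiding[of k "{z}"] by simp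
  have "{K \<in> ?S. z \<notin> K \<and> K \<inter> P = {}} = {K. card K = k \<and> K \<inter> insert z P = {}}" by auto
  then have cA1: "A1 = binom (int ?n - int b - 1) (int k)"
    unfolding nm binom_nat A1_def using card_subsets_avoiding[of k "insert z P"] z_notin by (simp add: b_def)
  have cB0: "?Bz = binom (int ?n - 1) (int k - 1)"
    unfolding nm binom_pred using card_subsets_containing[of z "{}" k] by simp
  have cB1: "B1 = binom (int ?n - int b - 1) (int k - 1)"
  proof -
    have "B1 = (if k = 0 then 0 else (?n - 1 - b) choose (k - 1))"
      unfolding B1_def b_def using card_subsets_containing[OF z_notin, of k] by simp
    then show ?thesis unfolding nm binom_pred .
  qed
  have "(\<Sum>p\<in>basis_index k. cexp p) = ?Az + (?Az - A1) * (?n * e - d) + (?Bz * ((?n - 1) * (e - 1)) + (?Bz - B1) * e)"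
    unfolding tot A B by simp
  also have "\<dots> = ?Az + (e - 1) * ((?n - 1) * ?Bz) + e * ((?n - d) * (?Az - A1) + (?Bz - B1))"
    using A B delta_cases delta1 e_pos n0 by (intro exponent_arith) auto
  finally show ?thesis unfolding cA0 cA1 cB0 cB1 .
qed

end

section \<open>Pointwise stabilizers of hyperplanes\<close>

lemma subgroup_GL_D:
  fixes G :: "('a::field, 'n::finite) sqmat set"
  assumes "subgroup G GL"
  shows "g \<in> G \<Longrightarrow> invertible g" "g \<in> G \<Longrightarrow> h \<in> G \<Longrightarrow> g ** h \<in> G"
    "Finite_Cartesian_Product.mat 1 \<in> G" "g \<in> G \<Longrightarrow> matrix_inv g \<in> G"
proof -
  show inv: "invertible g" if "g \<in> G" for g
    using subgroup.subset[OF assms] that by (auto simp: GL_def)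
  show "g \<in> G \<Longrightarrow> h \<in> G \<Longrightarrow> g ** h \<in> G"
    using subgroup.m_closed[OF assms, of g h] by (simp add: GL_def)
  show "Finite_Cartesian_Product.mat 1 \<in> G"
    using subgroup.one_closed[OF assms] by (simp add: GL_def)
  assume g: "g \<in> G"
  have "inv\<^bsub>GL\<^esub> g = matrix_inv g"
    using matrix_inv_props[OF inv[OF g]] inv[OF g] invertible_matrix_inv[OF inv[OF g]]
    by (intro group.inv_equality[OF group_GL]) (simp_all add: GL_def)
  then show "matrix_inv g \<in> G" using subgroup.m_inv_closed[OF assms g] by simp
qed

lemma scalar_product_add: "scalar_product l (v + w) = scalar_product l v + scalar_product l (w :: 'a::field ^ 'n)"
  and scalar_product_scale: "scalar_product l (c *s v) = c * scalar_product l v"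
  and scalar_product_diff: "scalar_product l (v - w) = scalar_product l v - scalar_product l w"
  by (simp_all add: scalar_product_def algebra_simps sum.distrib sum_distrib_left sum_subtractf)

lemma scalar_product_sum: "scalar_product l (\<Sum>x\<in>A. h x) = (\<Sum>x\<in>A. scalar_product l (h x :: 'a::field ^ 'n))"
  by (induction A rule: infinite_finite_induct) (simp_all add: scalar_product_add, simp_all add: scalar_product_def)

lemma matrix_mult_expand: "A *v v = (\<Sum>j\<in>UNIV. (v $ j) *s (A *v axis j 1))" for A :: "('a::field, 'n::finite) sqmat"
  by (simp add: vec_eq_iff matrix_vector_mult_axis) (simp add: matrix_vector_mult_def mult.commute)

lemma matrix_eq_iff_axis: "(\<And>j. A *v axis j 1 = B *v axis j 1) \<Longrightarrow> A = B" for A B :: "('a::field, 'n::finite) sqmat"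
  by (simp add: vec_eq_iff matrix_vector_mult_axis)

text \<open>The columns of the frame are \<open>y\<close> in place \<open>z\<close> and a basis of
  \<open>H\<close> extending \<open>B0\<close> in the other places; \<open>S\<close> records where
  \<open>B0\<close> went.\<close>

lemma frame_exists:
  fixes l y :: "('a::field, 'n::finite) space"
  assumes H: "{v. scalar_product l v = 0} = H" "vec.dim H = CARD('n) - 1"
    and y: "scalar_product l y = 1" and B0: "vec.independent B0" "B0 \<subseteq> H"
  shows "\<exists>(P :: ('a, 'n) sqmat) S. invertible P \<and> P *v axis z 1 = y \<and> (\<forall>v. scalar_product l (P *v v) = v $ z) \<and>
     z \<notin> S \<and> bij_betw (\<lambda>j. P *v axis j 1) S B0"
proof -
  obtain B1 where B1: "B0 \<subseteq> B1" "B1 \<subseteq> H" "vec.independent B1" "H \<subseteq> vec.span B1"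
    using vec.maximal_independent_subset_extend[OF B0(2,1)] by blast
  have fin: "finite B1" using B1(3) by (rule vec.finiteI_independent)
  have "card B1 = CARD('n) - 1" using vec.basis_card_eq_dim[OF B1(2,4,3)] H(2) by simp
  then have "card (UNIV - {z}) = card B1" by (simp add: card_Diff_singleton)
  then obtain h where h: "bij_betw h (UNIV - {z}) B1" using finite_same_card_bij[of "UNIV - {z}" B1] fin by auto
  define f where "f j = (if j = z then y else h j)" for j
  define P where "P = (\<chi> i j. f j $ i)"
  have Pax: "P *v axis j 1 = f j" for j by (simp add: vec_eq_iff matrix_vector_mult_axis P_def)
  have hH: "scalar_product l (h j) = 0" if "j \<noteq> z" for j
    using h that B1(2) H(1) by (auto simp: bij_betw_def)
  have lP: "scalar_product l (P *v v) = v $ z" for v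
  proof -
    have "scalar_product l (P *v v) = (\<Sum>j\<in>UNIV. if j = z then v $ z else 0)"
      unfolding matrix_mult_expand[of P v] Pax scalar_product_sum scalar_product_scale
      by (intro sum.cong) (auto simp: f_def y hH)
    then show ?thesis by simp
  qed
  have "v = 0" if v: "P *v v = 0" for v
  proof -
    have vz: "v $ z = 0" using lP[of v] v by (simp add: scalar_product_def)
    have inj: "inj_on h (UNIV - {z})" and im: "h ` (UNIV - {z}) = B1" using h by (auto simp: bij_betw_def)
    let ?u = "\<lambda>b. v $ the_inv_into (UNIV - {z}) h b"
    have inv: "the_inv_into (UNIV - {z}) h (h j) = j" if "j \<noteq> z" for j
      using inj that by (intro the_inv_into_f_f) auto
    have "(\<Sum>b\<in>B1. ?u b *s b) = (\<Sum>j\<in>UNIV - {z}. ?u (h j) *s h j)"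
      by (rule sum.reindex_bij_betw[OF h, symmetric])
    also have "\<dots> = (\<Sum>j\<in>UNIV - {z}. (v $ j) *s f j)"
      by (intro sum.cong) (auto simp: inv f_def)
    also have "\<dots> = (\<Sum>j\<in>UNIV. (v $ j) *s f j)"
      using vz by (simp add: sum.remove[of UNIV z "\<lambda>j. (v $ j) *s f j"])
    also have "\<dots> = 0" using v unfolding matrix_mult_expand[of P v] Pax .
    finally have 0: "(\<Sum>b\<in>B1. ?u b *s b) = 0" .
    have "v $ j = 0" for j
    proof (cases "j = z")
      case False
      then have "h j \<in> B1" using im by auto
      then have "?u (h j) = 0" using vec.independentD[OF B1(3) fin subset_refl 0] by blast
      then show ?thesis using inv[OF False] by simp
    qed (simp add: vz)
    then show "v = 0" by (simp add: vec_eq_iff)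
  qed
  then have "inj ((*v) P)" unfolding inj_def by (metis eq_iff_diff_eq_0 matrix_vector_mult_diff_distrib)
  then have "invertible P" using matrix_left_invertible_injective[of P] invertible_left_inverse[of P] by blast
  moreover have "bij_betw (\<lambda>j. P *v axis j 1) {j. j \<noteq> z \<and> h j \<in> B0} B0"
  proof (rule bij_betw_imageI)
    show "inj_on (\<lambda>j. P *v axis j 1) {j. j \<noteq> z \<and> h j \<in> B0}"
      using h unfolding Pax by (auto simp: f_def bij_betw_def inj_on_def)
    have "B0 \<subseteq> h ` (UNIV - {z})" using h B1(1) by (simp add: bij_betw_def)
    then show "(\<lambda>j. P *v axis j 1) ` {j. j \<noteq> z \<and> h j \<in> B0} = B0"
      unfolding Pax by (auto simp: f_def image_iff)
  qed
  moreover have "P *v axis z 1 = y" unfolding Pax by (simp add: f_def)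
  ultimately show ?thesis using lP by (intro exI[of _ P] exI[of _ "{j. j \<noteq> z \<and> h j \<in> B0}"]) auto
qed

section \<open>Determinants and root vectors of a pointwise stabilizer\<close>

locale hyperplane_stabilizer =
  fixes G :: "('a::field, 'n::{finite, linorder}) sqmat set" and l :: "('a, 'n) space" and H :: "('a, 'n) space set"
  assumes G: "subgroup G GL" and finG: "finite G" and H: "{v. scalar_product l v = 0} = H"
    and HA: "H \<in> reflection_arrangement G"
begin

abbreviation "St \<equiv> pointwise_stabilizer G H"

lemma dimH: "vec.dim H = CARD('n) - 1"
  using HA by (auto simp: reflection_arrangement_def reflection_about_def hyperplane_def)

lemma hypH: "hyperplane H"
  using HA by (auto simp: reflection_arrangement_def reflection_about_def)

lemma ex_w0: "\<exists>w. scalar_product l w = 1"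
proof -
  have "l \<noteq> 0"
  proof
    assume "l = 0"
    then have "H = UNIV" using H by (auto simp: scalar_product_def)
    then have "vec.dim H = CARD('n)" by (simp add: vec.dim_UNIV card_cart_basis)
    moreover have "CARD('n) > 0" by simp
    ultimately show False using dimH by linarith
  qed
  then obtain i where i: "l $ i \<noteq> 0" by (auto simp: vec_eq_iff)
  have "scalar_product l (axis i 1) = l $ i"
    by (simp add: scalar_product_def axis_def if_distrib cong: if_cong)
  then have "scalar_product l (inverse (l $ i) *s axis i 1) = 1" using i by (simp add: scalar_product_scale)
  then show ?thesis by blast
qed

lemma St_D:
  "s \<in> St \<Longrightarrow> s \<in> G" "s \<in> St \<Longrightarrow> scalar_product l v = 0 \<Longrightarrow> s *v v = v"
  using H by (auto simp: pointwise_stabilizer_def)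

lemma St_I: "s \<in> G \<Longrightarrow> (\<And>v. scalar_product l v = 0 \<Longrightarrow> s *v v = v) \<Longrightarrow> s \<in> St"
  using H by (auto simp: pointwise_stabilizer_def)

lemma St_mult: "s \<in> St \<Longrightarrow> t \<in> St \<Longrightarrow> s ** t \<in> St"
  by (rule St_I) (auto intro: subgroup_GL_D(2)[OF G] St_D simp flip: matrix_vector_mul_assoc simp: St_D)

lemma St_1: "Finite_Cartesian_Product.mat 1 \<in> St"
  by (rule St_I) (simp_all add: subgroup_GL_D(3)[OF G])

lemma St_inv: assumes s: "s \<in> St" shows "matrix_inv s \<in> St"
proof (rule St_I)
  show "matrix_inv s \<in> G" using subgroup_GL_D(4)[OF G] St_D(1)[OF s] by blast
  fix v assume v: "scalar_product l v = 0"
  have "matrix_inv s *v v = matrix_inv s *v (s *v v)" using St_D(2)[OF s v] by simp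
  then show "matrix_inv s *v v = v"
    using matrix_inv_props(2)[OF subgroup_GL_D(1)[OF G St_D(1)[OF s]]] by (simp add: matrix_vector_mul_assoc)
qed

lemma St_invertible: "s \<in> St \<Longrightarrow> invertible s"
  using subgroup_GL_D(1)[OF G] St_D(1) by blast

lemma St_reflection: "s \<in> St \<Longrightarrow> s \<noteq> Finite_Cartesian_Product.mat 1 \<Longrightarrow> reflection_about H s"
  using hypH St_invertible by (auto simp: reflection_about_def pointwise_stabilizer_def)

lemma reflection_St: "s \<in> G \<Longrightarrow> reflection_about H s \<Longrightarrow> s \<in> St \<and> s \<noteq> Finite_Cartesian_Product.mat 1"
  by (auto simp: reflection_about_def pointwise_stabilizer_def)

definition w0 :: "('a, 'n) space" where "w0 = (SOME w. scalar_product l w = 1)"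

lemma w0: "scalar_product l w0 = 1"
  unfolding w0_def using ex_w0 by (rule someI_ex)

text \<open>Independent of the choice of \<open>w0\<close>, since every element of the stabilizer is
  \<open>v -> v + l(v) root s\<close> (\<open>St_act\<close>).\<close>

definition root :: "('a, 'n) sqmat \<Rightarrow> ('a, 'n) space" where "root s = s *v w0 - w0"

text \<open>The scalar by which \<open>s\<close> acts on the quotient of \<open>V\<close> by
  \<open>H\<close> (\<open>chr_act\<close>); as \<open>s\<close> is trivial on \<open>H\<close>,
  this is its determinant.\<close>

definition chr :: "('a, 'n) sqmat \<Rightarrow> 'a" where "chr s = 1 + scalar_product l (root s)"

lemma St_act: assumes "s \<in> St" shows "s *v v = v + scalar_product l v *s root s"
proof -
  let ?h = "v - scalar_product l v *s w0"
  have "s *v ?h = ?h" by (rule St_D(2)[OF assms]) (simp add: scalar_product_diff scalar_product_scale w0)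
  moreover have "s *v ?h = s *v v - scalar_product l v *s (s *v w0)"
    by (simp add: matrix_vector_mult_diff_distrib vector_scalar_commute)
  ultimately have "s *v v = v - scalar_product l v *s w0 + scalar_product l v *s (s *v w0)"
    by (metis diff_add_cancel)
  then show ?thesis by (simp add: root_def vec_eq_iff right_diff_distrib)
qed

lemma chr_act: "s \<in> St \<Longrightarrow> scalar_product l (s *v v) = chr s * scalar_product l v"
  by (simp add: St_act scalar_product_add scalar_product_scale chr_def algebra_simps)

lemma chr_mult: assumes "s \<in> St" "t \<in> St" shows "chr (s ** t) = chr s * chr t"
  using chr_act[OF St_mult[OF assms], of w0] chr_act[OF assms(1), of "t *v w0"] chr_act[OF assms(2), of w0]
  by (simp add: w0 flip: matrix_vector_mul_assoc)

lemma chr_1: "chr (Finite_Cartesian_Product.mat 1) = 1"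
  using chr_act[OF St_1, of w0] by (simp add: w0)

lemma chr_image_mult:
  assumes "a \<in> chr ` St" "b \<in> chr ` St" shows "a * b \<in> chr ` St"
proof -
  obtain s t where st: "s \<in> St" "t \<in> St" and ab: "a = chr s" "b = chr t" using assms by blast
  show ?thesis unfolding ab chr_mult[OF st, symmetric] by (rule imageI[OF St_mult[OF st]])
qed

lemma chr_nz: assumes "s \<in> St" shows "chr s \<noteq> 0"
  using chr_mult[OF assms St_inv[OF assms]] matrix_inv_props(1)[OF St_invertible[OF assms]] chr_1 by auto

lemma St_eqI: "s \<in> St \<Longrightarrow> t \<in> St \<Longrightarrow> root s = root t \<Longrightarrow> s = t"
  by (rule matrix_eq_iff_axis) (simp add: St_act)

lemma root_1: "root (Finite_Cartesian_Product.mat 1) = 0" by (simp add: root_def)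

lemma chr_eq_1: "chr s = 1 \<longleftrightarrow> scalar_product l (root s) = 0"
  by (simp add: chr_def)

lemma root_mult: "s \<in> St \<Longrightarrow> t \<in> St \<Longrightarrow> root (s ** t) = chr t *s root s + root t"
proof -
  assume s: "s \<in> St" and t: "t \<in> St"
  have "root (s ** t) = s *v (t *v w0) - w0" by (simp add: root_def matrix_vector_mul_assoc)
  also have "\<dots> = t *v w0 + scalar_product l (t *v w0) *s root s - w0" by (simp add: St_act[OF s])
  also have "\<dots> = chr t *s root s + root t" by (simp add: chr_act[OF t] w0 root_def)
  finally show ?thesis .
qed

lemma root_vector_eq: assumes "s \<in> St" shows "root_vector l s = root s"
  unfolding root_vector_def
proof (rule the_equality)
  show "\<forall>v. s *v v = v + scalar_product l v *s root s" using St_act[OF assms] by blast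
  fix u assume "\<forall>v. s *v v = v + scalar_product l v *s u"
  then have "s *v w0 = w0 + u" using w0 by simp
  then show "u = root s" by (simp add: root_def)
qed

text \<open>A reflection fixing \<open>H\<close> is diagonalizable iff its determinant \<open>chr s\<close> is not 1.\<close>

lemma chr_1_not_diagonalizable:
  assumes s: "s \<in> St" and c: "chr s = 1" and d: "diagonalizable s"
  shows "s = Finite_Cartesian_Product.mat 1"
proof -
  obtain P D :: "('a, 'n) sqmat" where PD: "invertible P \<and> (\<forall>i j. i \<noteq> j \<longrightarrow> D $ i $ j = 0) \<and> s = P ** D ** matrix_inv P"
    using d unfolding diagonalizable_def by (elim exE) (rule that, assumption)
  note P = PD[THEN conjunct1] and eq = PD[THEN conjunct2, THEN conjunct2]
  have D: "D $ i $ j = 0" if "i \<noteq> j" for i j using PD that by simp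
  have "s ** P = P ** (D ** (matrix_inv P ** P))" unfolding eq by (simp only: matrix_mul_assoc)
  then have sP: "s ** P = P ** D" by (simp only: matrix_inv_props(2)[OF P] matrix_mul_rid)
  have Dax: "D *v axis i 1 = (D $ i $ i) *s axis i 1" for i
  proof -
    have "(D *v axis i 1) $ j = ((D $ i $ i) *s axis i 1) $ j" for j
      using D[of j i] by (cases "j = i") (simp_all add: matrix_vector_mult_axis, simp_all add: axis_def)
    then show ?thesis by (simp add: vec_eq_iff)
  qed
  have col: "s *v (P *v axis i 1) = (D $ i $ i) *s (P *v axis i 1)" for i
    using arg_cong[OF sP, of "\<lambda>M. M *v axis i 1"]
    by (simp add: Dax vector_scalar_commute flip: matrix_vector_mul_assoc)
  have "\<exists>i. scalar_product l (P *v axis i 1) \<noteq> 0"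
  proof (rule ccontr)
    assume "\<not> ?thesis"
    then have "scalar_product l (P *v v) = 0" for v
      unfolding matrix_mult_expand[of P v] scalar_product_sum scalar_product_scale by simp
    from this[of "matrix_inv P *v w0"] show False
      using matrix_inv_props(1)[OF P] w0 by (simp add: matrix_vector_mul_assoc)
  qed
  then obtain i where i: "scalar_product l (P *v axis i 1) \<noteq> 0" by blast
  let ?x = "P *v axis i 1"
  have "scalar_product l ?x = D $ i $ i * scalar_product l ?x"
    using chr_act[OF s, of ?x] c col[of i] by (simp add: scalar_product_scale)
  then have "D $ i $ i = 1" using i by simp
  then have "?x + scalar_product l ?x *s root s = ?x" using col[of i] St_act[OF s, of ?x] by simp
  then have "root s = 0" using i by (simp add: vec_eq_iff)
  then show ?thesis using St_eqI[OF s St_1] root_1 by simp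
qed

text \<open>The root vector itself is an eigenvector outside \<open>H\<close>, and dividing by
  \<open>chr s - 1\<close> normalises its value under \<open>l\<close>.\<close>

lemma chr_eigenvector:
  assumes s: "s \<in> St" and c: "chr s \<noteq> 1"
  shows "\<exists>y. scalar_product l y = 1 \<and> s *v y = chr s *s y"
proof -
  let ?y = "inverse (chr s - 1) *s root s"
  have c0: "chr s - 1 \<noteq> 0" using c by simp
  have r: "scalar_product l (root s) = chr s - 1" by (simp add: chr_def)
  have y: "scalar_product l ?y = 1" unfolding scalar_product_scale r using c0 by simp
  have "root s = (chr s - 1) *s ?y" using c0 by (simp add: vec_eq_iff)
  then have "s *v ?y = ?y + (chr s - 1) *s ?y" unfolding St_act[OF s, of ?y] y by simp
  also have "\<dots> = chr s *s ?y" by (simp add: vec_eq_iff algebra_simps)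
  finally show ?thesis using y by blast
qed

lemma diagonalizable_St:
  assumes s: "s \<in> St" and c: "chr s \<noteq> 1"
  shows "diagonalizable s"
proof -
  obtain y where y: "scalar_product l y = 1" "s *v y = chr s *s y" using chr_eigenvector[OF assms] by blast
  fix z :: 'n
  obtain P :: "('a, 'n) sqmat" where P: "invertible P" "P *v axis z 1 = y" "\<And>v. scalar_product l (P *v v) = v $ z"
    using frame_exists[OF H dimH y(1) vec.independent_empty, of z] by blast
  define D :: "('a, 'n) sqmat" where "D = (\<chi> i j. if i = j then if i = z then chr s else 1 else 0)"
  have "s ** P = P ** D"
  proof (rule matrix_eq_iff_axis)
    fix j
    have "D *v axis j 1 = (if j = z then chr s else 1) *s axis j 1"
      by (simp add: vec_eq_iff matrix_vector_mult_axis) (simp add: D_def axis_def)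
    moreover have "s *v (P *v axis j 1) = P *v axis j 1" if "j \<noteq> z"
      by (rule St_D(2)[OF s]) (use P(3)[of "axis j 1"] that in \<open>simp add: axis_def\<close>)
    ultimately show "(s ** P) *v axis j 1 = (P ** D) *v axis j 1"
      using P(2) y(2) by (auto simp: vector_scalar_commute simp flip: matrix_vector_mul_assoc)
  qed
  then have "s ** P ** matrix_inv P = P ** D ** matrix_inv P" by simp
  moreover have "s ** P ** matrix_inv P = s"
    using matrix_inv_props(1)[OF P(1)] by (simp flip: matrix_mul_assoc)
  ultimately have "s = P ** D ** matrix_inv P" by simp
  moreover have "\<forall>i j. i \<noteq> j \<longrightarrow> D $ i $ j = 0" by (simp add: D_def)
  ultimately show ?thesis unfolding diagonalizable_def using P(1) by blast
qed

lemma diag_reflection_iff: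
  "s \<in> G \<and> reflection_about H s \<and> diagonalizable s \<longleftrightarrow> s \<in> St \<and> chr s \<noteq> 1"
  using diagonalizable_St chr_1_not_diagonalizable reflection_St St_reflection St_D(1) chr_1 by metis

lemma transvection_iff:
  "s \<in> G \<and> transvection_about H s \<longleftrightarrow> s \<in> St \<and> chr s = 1 \<and> s \<noteq> Finite_Cartesian_Product.mat 1"
  unfolding transvection_about_def
  using diagonalizable_St chr_1_not_diagonalizable reflection_St St_reflection St_D(1) by metis

text \<open>Powers of \<open>s\<close> act on the eigenvector \<open>y\<close> by powers of
  \<open>chr s\<close>. A power that fixes \<open>y\<close> has root 0, hence is the identity, so
  \<open>s\<close> and \<open>chr s\<close> have the same order; finiteness of the group makes it
  positive.\<close>

lemma has_order_GL_ord:
  assumes s: "s \<in> St" and c: "chr s \<noteq> 1"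
  shows "has_order (chr s) (group.ord GL s)"
proof -
  interpret GL: group "GL :: ('a, 'n) sqmat monoid" by (rule group_GL)
  have sc: "s \<in> carrier GL" using St_invertible[OF s] by (simp add: GL_def)
  have pw: "s [^]\<^bsub>GL\<^esub> m \<in> St \<and> chr (s [^]\<^bsub>GL\<^esub> m) = chr s ^ m" for m :: nat
  proof (induction m)
    case 0
    then show ?case using St_1 chr_1 by (simp add: GL_def)
  next
    case (Suc m)
    have "s [^]\<^bsub>GL\<^esub> Suc m = s [^]\<^bsub>GL\<^esub> m ** s" by (simp add: GL_def)
    then show ?case using Suc St_mult s chr_mult by simp
  qed
  obtain y where y: "scalar_product l y = 1" "s *v y = chr s *s y" using chr_eigenvector[OF assms] by blast
  have pwy: "(s [^]\<^bsub>GL\<^esub> m) *v y = chr s ^ m *s y" for m :: nat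
  proof (induction m)
    case 0
    then show ?case by (simp add: GL_def)
  next
    case (Suc m)
    have "s [^]\<^bsub>GL\<^esub> Suc m = s [^]\<^bsub>GL\<^esub> m ** s" by (simp add: GL_def)
    then show ?case using Suc y by (simp add: vector_scalar_commute mult.commute flip: matrix_vector_mul_assoc)
  qed
  have iff: "chr s ^ m = 1 \<longleftrightarrow> s [^]\<^bsub>GL\<^esub> m = \<one>\<^bsub>GL\<^esub>" for m :: nat
  proof
    let ?t = "s [^]\<^bsub>GL\<^esub> m"
    assume "chr s ^ m = 1"
    then have "?t *v y = y" using pwy[of m] by simp
    moreover have "?t *v y = y + scalar_product l y *s root ?t" using St_act pw by blast
    ultimately have "root ?t = 0" using y(1) by simp
    then have "?t = Finite_Cartesian_Product.mat 1" using St_eqI[OF _ St_1] pw root_1 by simp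
    then show "?t = \<one>\<^bsub>GL\<^esub>" by (simp add: GL_def)
  next
    assume "s [^]\<^bsub>GL\<^esub> m = \<one>\<^bsub>GL\<^esub>"
    then have "chr (s [^]\<^bsub>GL\<^esub> m) = 1" using chr_1 by (simp add: GL_def)
    then show "chr s ^ m = 1" using pw by simp
  qed
  have "\<exists>e. has_order (chr s) e"
  proof (rule has_order_exists[of "chr ` St"])
    show "finite (chr ` St)" using finG by (simp add: pointwise_stabilizer_def)
    show "0 \<notin> chr ` St" using chr_nz by auto
    show "a * b \<in> chr ` St" if "a \<in> chr ` St" "b \<in> chr ` St" for a b
      using that by (rule chr_image_mult)
    show "chr s \<in> chr ` St" using s by blast
  qed
  then obtain e where e: "has_order (chr s) e" by blast
  have "chr s ^ m = 1 \<longleftrightarrow> GL.ord s dvd m" for m :: nat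
    unfolding iff using GL.pow_eq_id[OF sc] by blast
  moreover have "GL.ord s > 0" using e calculation unfolding has_order_def
    by (metis dvd_0_left_iff dvd_refl gr0I)
  ultimately show ?thesis unfolding has_order_def by blast
qed

text \<open>\<open>e_diag\<close> is a maximum of orders, but the local computation needs a common
  exponent of all determinants. The determinants form a finite multiplicatively closed set in the
  field, where the maximal order is divisible by all others.\<close>

lemma e_diag_order:
  "\<exists>g\<in>St. has_order (chr g) (e_diag G H) \<and> (\<forall>s\<in>St. chr s ^ e_diag G H = 1) \<and> (e_diag G H = 1 \<longrightarrow> (\<forall>s\<in>St. chr s = 1))"
proof (cases "\<exists>s\<in>St. chr s \<noteq> 1")
  case False
  then have "\<not> (\<exists>s\<in>G. reflection_about H s \<and> diagonalizable s)" using diag_reflection_iff by blast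
  then have "e_diag G H = 1" unfolding e_diag_def by (rule if_not_P)
  moreover have "has_order 1 1" by (simp add: has_order_def)
  ultimately show ?thesis using False St_1 chr_1 by (intro bexI[of _ "Finite_Cartesian_Product.mat 1"]) auto
next
  case True
  let ?M = "{group.ord GL s | s. s \<in> G \<and> reflection_about H s \<and> diagonalizable s}"
  have M: "?M = group.ord GL ` {s \<in> St. chr s \<noteq> 1}" using diag_reflection_iff by blast
  have finSt: "finite St" using finG by (simp add: pointwise_stabilizer_def)
  have "\<exists>s\<in>G. reflection_about H s \<and> diagonalizable s" using True diag_reflection_iff by blast
  then have e: "e_diag G H = Max ?M" unfolding e_diag_def by (rule if_P)
  have "finite ?M" "?M \<noteq> {}" unfolding M using finSt True by auto
  then have "e_diag G H \<in> ?M" unfolding e by (rule Max_in)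
  then obtain g where g: "g \<in> St" "chr g \<noteq> 1" "e_diag G H = group.ord GL g" unfolding M by blast
  have og: "has_order (chr g) (e_diag G H)" unfolding g(3) by (rule has_order_GL_ord[OF g(1,2)])
  have fin: "finite (chr ` St)" using finSt by simp
  have nz: "0 \<notin> chr ` St" using chr_nz by auto
  note mult = chr_image_mult
  have one: "1 \<in> chr ` St" using imageI[OF St_1, of chr] unfolding chr_1 .
  have max: "m \<le> e_diag G H" if c: "c \<in> chr ` St" "has_order c m" for c m
  proof (cases "c = 1")
    case True
    then have "m = 1" using c(2) unfolding has_order_def by (metis nat_dvd_1_iff_1 power_one)
    then show ?thesis using og unfolding has_order_def by simp
  next
    case False
    then obtain s where s: "s \<in> St" "chr s = c" "chr s \<noteq> 1" using c(1) by blast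
    then have "m = group.ord GL s" using has_order_GL_ord[OF s(1,3)] c(2) has_order_unique by blast
    then have "m \<in> ?M" unfolding M using s by blast
    then show ?thesis unfolding e using \<open>finite ?M\<close> by simp
  qed
  have "chr s ^ e_diag G H = 1" if s: "s \<in> St" for s
  proof -
    have cs: "chr s \<in> chr ` St" using s by (rule imageI)
    have "\<exists>a. has_order (chr s) a" by (rule has_order_exists[OF fin nz _ cs]) (rule mult)
    then obtain a where a: "has_order (chr s) a" by (elim exE) (rule that)
    have "a dvd e_diag G H"
    proof (rule order_dvd_max_order[OF fin nz _ one _ og _ cs a])
      show "chr g \<in> chr ` St" using g(1) by (rule imageI)
    qed (rule mult max, assumption+)+
    then show ?thesis using a unfolding has_order_def by blast
  qed
  moreover have "e_diag G H \<noteq> 1"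
  proof
    assume "e_diag G H = 1"
    then have "chr g ^ 1 = 1" using og unfolding has_order_def by (metis dvd_refl)
    then show False using g(2) by simp
  qed
  ultimately show ?thesis using g(1) og by blast
qed

definition T :: "('a, 'n) space set" where "T = {root s | s. s \<in> St \<and> chr s = 1 \<and> s \<noteq> Finite_Cartesian_Product.mat 1}"

lemma b_root_eq: "b_root G l H = vec.dim (vec.span T)"
proof -
  have "{root_vector l s | s. s \<in> G \<and> transvection_about H s} = T"
    unfolding T_def using transvection_iff root_vector_eq by metis
  then show ?thesis by (simp only: b_root_def)
qed

lemma T_H: "T \<subseteq> H"
  using H chr_eq_1 by (auto simp: T_def)

lemma root_eq_0_iff: "s \<in> St \<Longrightarrow> root s = 0 \<longleftrightarrow> s = Finite_Cartesian_Product.mat 1"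
  using St_eqI[OF _ St_1] root_1 by metis

lemma T_nz: "0 \<notin> T"
  unfolding T_def using root_eq_0_iff by auto

lemma chr_1_root: "s \<in> St \<Longrightarrow> chr s = 1 \<Longrightarrow> root s = 0 \<or> root s \<in> T"
  unfolding T_def using root_eq_0_iff by blast

lemma conj_smat:
  fixes P0 :: "('a, 'n) sqmat"
  assumes P0: "invertible P0" "\<And>v. scalar_product l (P0 *v v) = v $ z"
    and s: "s \<in> St" and sy: "s *v (P0 *v axis z 1) = c *s (P0 *v axis z 1 + P0 *v u)"
  shows "matrix_inv P0 ** s ** P0 = smat z c u"
proof (rule smat_eqI)
  have inv: "matrix_inv P0 *v (P0 *v v) = v" for v
    using matrix_inv_props(2)[OF P0(1)] by (simp add: matrix_vector_mul_assoc)
  have cj: "(matrix_inv P0 ** s ** P0) *v v = matrix_inv P0 *v (s *v (P0 *v v))" for v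
    by (simp only: matrix_vector_mul_assoc matrix_mul_assoc)
  show "(matrix_inv P0 ** s ** P0) *v axis j 1 = axis j 1" if "j \<noteq> z" for j
  proof -
    have "scalar_product l (P0 *v axis j 1) = 0" using that unfolding P0(2) by (simp add: axis_def)
    then show ?thesis unfolding cj St_D(2)[OF s] inv by (simp only: St_D(2)[OF s] inv)
  qed
  show "(matrix_inv P0 ** s ** P0) *v axis z 1 = c *s (axis z 1 + u)"
    unfolding cj sy by (simp only: vector_scalar_commute matrix_vector_right_distrib inv)
qed

lemma span_T_coords:
  fixes P0 :: "('a, 'n) sqmat"
  assumes P0: "invertible P0" and bij: "bij_betw (\<lambda>j. P0 *v axis j 1) S B0"
    and B0: "T \<subseteq> vec.span B0" and r: "r \<in> vec.span T"
  shows "\<exists>u. r = P0 *v u \<and> (\<forall>i. i \<notin> S \<longrightarrow> u $ i = 0)"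
proof -
  let ?W = "{P0 *v u | u. \<forall>i. i \<notin> S \<longrightarrow> u $ i = 0}"
  have W: "vec.subspace ?W"
  proof (rule vec.subspaceI)
    show "0 \<in> ?W" by (rule CollectI, rule exI[of _ 0]) simp
  next
    fix x y assume "x \<in> ?W" "y \<in> ?W"
    then obtain u v where uv: "x = P0 *v u" "y = P0 *v v" "\<forall>i. i \<notin> S \<longrightarrow> u $ i = 0" "\<forall>i. i \<notin> S \<longrightarrow> v $ i = 0"
      by blast
    then show "x + y \<in> ?W" by (intro CollectI exI[of _ "u + v"]) (simp add: matrix_vector_right_distrib)
  next
    fix c x assume "x \<in> ?W"
    then obtain u where u: "x = P0 *v u" "\<forall>i. i \<notin> S \<longrightarrow> u $ i = 0" by blast
    then show "c *s x \<in> ?W" by (intro CollectI exI[of _ "c *s u"]) (simp add: vector_scalar_commute)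
  qed
  have "B0 \<subseteq> ?W"
  proof
    fix b assume "b \<in> B0"
    then have "b \<in> (\<lambda>j. P0 *v axis j 1) ` S" using bij by (simp add: bij_betw_def)
    then obtain j where j: "j \<in> S" "b = P0 *v axis j 1" by blast
    then show "b \<in> ?W" by (intro CollectI exI[of _ "axis j 1"]) (auto simp: axis_def)
  qed
  then have "vec.span B0 \<subseteq> ?W" using W by (rule vec.span_minimal)
  then have "T \<subseteq> ?W" using B0 by (rule subset_trans[rotated])
  then have "vec.span T \<subseteq> ?W" using W by (rule vec.span_minimal)
  then show ?thesis using r by blast
qed

text \<open>When \<open>chr g = 1\<close> the identity has the same determinant and fixes any
  \<open>y\<close>; otherwise the eigenvector of \<open>g\<close> is taken. In both cases
  \<open>g\<close> becomes diagonal in coordinates containing \<open>y\<close>.\<close>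

lemma adapted_generator:
  "\<exists>g y. g \<in> St \<and> has_order (chr g) (e_diag G H) \<and> scalar_product l y = 1 \<and> g *v y = chr g *s y"
proof -
  obtain g where g: "g \<in> St" "has_order (chr g) (e_diag G H)" using e_diag_order by (elim bexE conjE) (rule that)
  show ?thesis
  proof (cases "chr g = 1")
    case True
    then have "has_order (chr (Finite_Cartesian_Product.mat 1)) (e_diag G H)" using g(2) chr_1 by simp
    then show ?thesis using St_1 w0
      by (intro exI[of _ "Finite_Cartesian_Product.mat 1"] exI[of _ w0]) (simp add: chr_1)
  next
    case False
    obtain y where "scalar_product l y = 1" "g *v y = chr g *s y" using chr_eigenvector[OF g(1) False] by blast
    then show ?thesis using g by blast
  qed
qed

lemma root_y: "s \<in> St \<Longrightarrow> scalar_product l y = 1 \<Longrightarrow> s *v y = y + root s"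
  by (simp add: St_act)

lemma has_order_1: "has_order (1 :: 'a) e \<Longrightarrow> e = 1"
  unfolding has_order_def by (metis nat_dvd_1_iff_1 power_one)

text \<open>Modulo \<open>y\<close>, the image of \<open>y\<close> under \<open>s\<close> is controlled by the commutator of \<open>s\<close> with the
  diagonalizable reflection \<open>g\<close>, which is a transvection.\<close>

lemma remainder_in_span_T:
  assumes g: "g \<in> St" "has_order (chr g) (e_diag G H)" and y: "scalar_product l y = 1" "g *v y = chr g *s y"
    and s: "s \<in> St"
  shows "s *v y - chr s *s y \<in> vec.span T"
proof (cases "chr g = 1")
  case True
  then have "e_diag G H = 1" using g(2) has_order_1 by simp
  then have c: "chr s = 1" using e_diag_order s by blast
  then have eq: "s *v y - chr s *s y = root s" by (simp add: root_y[OF s y(1)])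
  show ?thesis unfolding eq using chr_1_root[OF s c] vec.span_zero vec.span_base by auto
next
  case False
  let ?r = "s *v y - chr s *s y"
  let ?h = "(s ** g) ** matrix_inv (g ** s)"
  have gs: "g ** s \<in> St" and sg: "s ** g \<in> St" using St_mult g s by blast+
  have h: "?h \<in> St" by (rule St_mult[OF sg St_inv[OF gs]])
  have hgs: "?h ** (g ** s) = s ** g"
    using matrix_inv_props(2)[OF St_invertible[OF gs]] by (simp flip: matrix_mul_assoc[of "s ** g"])
  have "chr ?h * chr (g ** s) = chr (s ** g)" unfolding chr_mult[OF h gs, symmetric] hgs ..
  then have "chr ?h * (chr g * chr s) = 1 * (chr g * chr s)"
    unfolding chr_mult[OF g(1) s] chr_mult[OF s g(1)] by (simp add: mult.commute)
  then have ch: "chr ?h = 1" using chr_nz[OF g(1)] chr_nz[OF s] by simp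
  have lr: "scalar_product l ?r = 0"
    by (simp only: scalar_product_diff scalar_product_scale chr_act[OF s] y(1)) simp
  have r: "s *v y = chr s *s y + ?r" by simp
  have 1: "(s ** g) *v y = chr g *s (chr s *s y) + chr g *s ?r"
    by (simp only: y(2) vector_scalar_commute flip: matrix_vector_mul_assoc) (subst r, rule vector_add_ldistrib)
  have 2: "(g ** s) *v y = chr g *s (chr s *s y) + ?r"
  proof -
    have "(g ** s) *v y = g *v (chr s *s y + ?r)" by (simp only: r[symmetric] matrix_vector_mul_assoc)
    also have "\<dots> = chr s *s (chr g *s y) + ?r"
      by (simp only: matrix_vector_right_distrib vector_scalar_commute St_D(2)[OF g(1) lr] y(2))
    finally show ?thesis by (simp add: mult.commute)
  qed
  have "(s ** g) *v y = ?h *v ((g ** s) *v y)" by (simp only: matrix_vector_mul_assoc hgs)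
  also have "\<dots> = (g ** s) *v y + scalar_product l ((g ** s) *v y) *s root ?h" by (rule St_act[OF h])
  also have "scalar_product l ((g ** s) *v y) = chr g * chr s"
    unfolding chr_act[OF gs] chr_mult[OF g(1) s] y(1) by simp
  finally have "chr g *s ?r = ?r + (chr g * chr s) *s root ?h" unfolding 1 2 by (simp add: add.assoc)
  then have "chr g *s ?r - ?r = (chr g * chr s) *s root ?h" by (simp only: add_diff_cancel_left')
  then have eq: "(chr g - 1) *s ?r = (chr g * chr s) *s root ?h"
    by (simp only: vec.scale_left_diff_distrib vector_smult_lid)
  have "root ?h \<in> vec.span T" using chr_1_root[OF h ch] vec.span_zero vec.span_base by auto
  then have "inverse (chr g - 1) *s ((chr g - 1) *s ?r) \<in> vec.span T"
    unfolding eq by (intro vec.span_scale)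
  moreover have "inverse (chr g - 1) * (chr g - 1) = 1" using False by simp
  ultimately show ?thesis by (simp only: vec.scale_scale vector_smult_lid)
qed

text \<open>If \<open>chr g\<close> is not 1, conjugating a transvection by \<open>g\<close> scales
  its root by \<open>chr g\<close>. Otherwise all determinants are 1, and a single root would make
  the stabilizer a transvection with the identity, against \<open>delta G H = 0\<close>.\<close>

lemma second_root:
  assumes g: "g \<in> St" "has_order (chr g) (e_diag G H)" and d: "delta G H = 0" and t: "t \<in> T"
  shows "\<exists>w\<in>T. w \<noteq> t"
proof -
  obtain s0 where s0: "s0 \<in> St" "chr s0 = 1" "s0 \<noteq> Finite_Cartesian_Product.mat 1" "t = root s0"
    using t unfolding T_def by blast
  have t0: "t \<noteq> 0" using t T_nz by auto
  show ?thesis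
  proof (cases "chr g = 1")
    case False
    let ?h = "matrix_inv g ** (s0 ** g)"
    note gi = St_inv[OF g(1)] and sg = St_mult[OF s0(1) g(1)]
    have h: "?h \<in> St" by (rule St_mult[OF gi sg])
    have gg: "matrix_inv g ** g = Finite_Cartesian_Product.mat 1" by (rule matrix_inv_props(2)[OF St_invertible[OF g(1)]])
    have 1: "chr g *s root (matrix_inv g) + root g = 0"
      using root_mult[OF gi g(1)] unfolding gg root_1 by simp
    have csg: "chr (s0 ** g) = chr g" unfolding chr_mult[OF s0(1) g(1)] s0(2) by simp
    have "chr (matrix_inv g) * chr g = 1" using chr_mult[OF gi g(1)] unfolding gg chr_1 by simp
    then have ch: "chr ?h = 1" unfolding chr_mult[OF gi sg] csg .
    have "root ?h = chr g *s root (matrix_inv g) + (chr g *s t + root g)"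
      unfolding root_mult[OF gi sg] csg root_mult[OF s0(1) g(1)] s0(4) ..
    also have "\<dots> = (chr g *s root (matrix_inv g) + root g) + chr g *s t" by (simp add: add.assoc add.left_commute add.commute)
    finally have rh: "root ?h = chr g *s t" unfolding 1 by simp
    have nz: "chr g *s t \<noteq> 0" using t0 chr_nz[OF g(1)] by (simp only: vec.scale_eq_0_iff) blast
    then have "chr g *s t \<in> T" using chr_1_root[OF h ch] unfolding rh by blast
    moreover have "chr g *s t \<noteq> t"
    proof
      assume "chr g *s t = t"
      then have "chr g *s t = 1 *s t" by simp
      then show False using t0 False vec.scale_right_imp_eq[of t "chr g" 1] by blast
    qed
    ultimately show ?thesis by blast
  next
    case True
    then have "e_diag G H = 1" using g(2) has_order_1 by simp
    then have c: "chr s = 1" if "s \<in> St" for s using e_diag_order that by blast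
    show ?thesis
    proof (rule ccontr)
      assume no: "\<not> ?thesis"
      have "s = Finite_Cartesian_Product.mat 1 \<or> s = s0" if s: "s \<in> St" for s
      proof (cases "root s = 0")
        case True
        then show ?thesis using root_eq_0_iff[OF s] by blast
      next
        case False
        then have "root s = root s0" using chr_1_root[OF s c[OF s]] no s0(4) by blast
        then show ?thesis using St_eqI[OF s s0(1)] by blast
      qed
      then have St: "St = {Finite_Cartesian_Product.mat 1, s0}" using St_1 s0(1) by blast
      have "transvection_about H s0" using transvection_iff s0 by blast
      then have "\<exists>t. transvection_about H t \<and> St = {Finite_Cartesian_Product.mat 1, t}"
        using St by (intro exI[of _ s0] conjI)
      then have "delta G H = 1" unfolding delta_def by (rule if_P)
      then show False using d by simp
    qed
  qed
qed

text \<open>The basis of the root span is chosen among the roots themselves, so the transvections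
  along its members belong to the group. The eigenvector \<open>y\<close> of \<open>g\<close> goes
  to place \<open>z\<close>, which makes \<open>g\<close> diagonal.\<close>

lemma std_form:
  assumes zm: "\<And>i. z \<le> i"
  shows "\<exists>(P0 :: ('a, 'n) sqmat) S \<zeta>. invertible P0 \<and> (\<forall>v. scalar_product l (P0 *v v) = v $ z) \<and> card S = b_root G l H \<and>
    std_group z S (e_diag G H) (delta G H) \<zeta> ((\<lambda>s. matrix_inv P0 ** s ** P0) ` St)"
proof -
  obtain g y where g: "g \<in> St" "has_order (chr g) (e_diag G H)" and y: "scalar_product l y = 1" "g *v y = chr g *s y"
    using adapted_generator by blast
  obtain B0 where B0: "B0 \<subseteq> T" "vec.independent B0" "T \<subseteq> vec.span B0"
    using vec.maximal_independent_subset by blast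
  have B0H: "B0 \<subseteq> H" using B0(1) T_H by blast
  obtain P0 :: "('a, 'n) sqmat" and S where P0: "invertible P0" "P0 *v axis z 1 = y" "\<And>v. scalar_product l (P0 *v v) = v $ z"
    and S: "z \<notin> S" "bij_betw (\<lambda>j. P0 *v axis j 1) S B0"
    using frame_exists[OF H dimH y(1) B0(2) B0H, of z] by blast
  have cS: "card S = b_root G l H"
    unfolding b_root_eq vec.dim_span bij_betw_same_card[OF S(2)] by (rule vec.basis_card_eq_dim[OF B0(1,3,2)])
  have finS: "finite S" by simp
  let ?c = "\<lambda>s. matrix_inv P0 ** s ** P0"
  have cj: "?c s = smat z c u" if "s \<in> St" "s *v y = c *s (y + P0 *v u)" for s c u
    using conj_smat[OF P0(1,3) that(1), of c u] that(2) unfolding P0(2) by blast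
  have cj1: "?c s = smat z 1 u" if s: "s \<in> St" "root s = P0 *v u" for s u
    by (rule cj[OF s(1)]) (simp add: root_y[OF s(1) y(1)] s(2))
  have Pinv: "P0 *v (matrix_inv P0 *v v) = v" for v
    using matrix_inv_props(1)[OF P0(1)] by (simp add: matrix_vector_mul_assoc)
  have SB: "P0 *v axis a 1 \<in> B0" if "a \<in> S" for a using S(2) that by (auto simp: bij_betw_def)
  have rt: "\<exists>s. s \<in> St \<and> chr s = 1 \<and> s \<noteq> Finite_Cartesian_Product.mat 1 \<and> root s = v" if "v \<in> T" for v
    using that unfolding T_def by blast
  have e0: "e_diag G H > 0" using g(2) unfolding has_order_def by blast
  have "std_group z S (e_diag G H) (delta G H) (chr g) (?c ` St)"
  proof (unfold_locales, goal_cases)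
    case (1 i) show ?case by (rule zm)
  next
    case 2 show ?case by (rule S(1))
  next
    case 3 show ?case by (rule e0)
  next
    case (4 s)
    then obtain s0 where s0: "s0 \<in> St" "s = ?c s0" by blast
    \<comment> \<open>This remainder lies in the span of the roots, so after division by
      \<open>chr s0\<close> its coordinates are supported on \<open>S\<close>.\<close>
    let ?r = "s0 *v y - chr s0 *s y"
    have c0: "chr s0 \<noteq> 0" by (rule chr_nz[OF s0(1)])
    have "inverse (chr s0) *s ?r \<in> vec.span T"
      by (rule vec.span_scale[OF remainder_in_span_T[OF g y s0(1)]])
    then obtain u where u: "inverse (chr s0) *s ?r = P0 *v u" "\<forall>i. i \<notin> S \<longrightarrow> u $ i = 0"
      using span_T_coords[OF P0(1) S(2) B0(3)] by blast
    have "chr s0 *s (y + P0 *v u) = chr s0 *s y + (chr s0 * inverse (chr s0)) *s ?r"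
      unfolding u(1)[symmetric] by (simp only: vector_add_ldistrib vec.scale_scale)
    then have "s0 *v y = chr s0 *s (y + P0 *v u)" using c0 by simp
    then have "s = smat z (chr s0) u" using cj[OF s0(1)] s0(2) by blast
    moreover have "chr s0 ^ e_diag G H = 1" using e_diag_order s0(1) by blast
    ultimately show ?case using u(2) S(1) by blast
  next
    case 5
    have "?c g = smat z (chr g) 0" by (rule cj[OF g(1)]) (simp add: y(2))
    then show ?case using g(1) by (intro image_eqI[of _ _ g]) simp_all
  next
    case 6 show ?case using e_diag_order g(1) by blast
  next
    case (7 m) then show ?case using g(2) unfolding has_order_def by blast
  next
    case (8 a)
    obtain s where s: "s \<in> St" "root s = P0 *v axis a 1" using rt SB[OF 8] B0(1) by blast
    show ?case using cj1[OF s] s(1) by (intro image_eqI[of _ _ s]) simp_all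
  next
    case 9
    obtain s where "s \<in> G" "reflection_about H s" using HA unfolding reflection_arrangement_def by blast
    then have s: "s \<in> St" "s \<noteq> Finite_Cartesian_Product.mat 1" using reflection_St by blast+
    show ?case
    proof (rule disjCI)
      assume "\<not> e_diag G H > 1"
      then have "e_diag G H = 1" using e0 by simp
      then have "chr s = 1" using e_diag_order s(1) by blast
      then have "root s \<in> T" using s unfolding T_def by blast
      then have "root s \<in> vec.span B0" "root s \<noteq> 0" using B0(3) T_nz by auto
      then have "B0 \<noteq> {}" by auto
      then show "S \<noteq> {}" using S(2) by (auto simp: bij_betw_def)
    qed
  next
    case 10 show ?case by (simp add: delta_def)
  next
    case (11 a)
    \<comment> \<open>Roots of transvections add under products, so the sum of the two roots again
      comes from the group.\<close>
    let ?t = "P0 *v axis a 1"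
    have t: "?t \<in> T" using SB[OF 11(2)] B0(1) by blast
    obtain w' where w': "w' \<in> T" "w' \<noteq> ?t" using second_root[OF g 11(1) t] by blast
    obtain s where s: "s \<in> St" "chr s = 1" "root s = ?t" using rt[OF t] by blast
    obtain s' where s': "s' \<in> St" "chr s' = 1" "root s' = w'" using rt[OF w'(1)] by blast
    let ?w = "matrix_inv P0 *v w'"
    have w: "w' = P0 *v ?w" by (simp only: Pinv)
    have cs': "?c s' = smat z 1 ?w" by (rule cj1[OF s'(1)]) (simp only: s'(3) Pinv)
    have "root (s ** s') = P0 *v (axis a 1 + ?w)"
      unfolding root_mult[OF s(1) s'(1)] s'(2,3) s(3) matrix_vector_right_distrib Pinv by simp
    then have css: "?c (s ** s') = smat z 1 (axis a 1 + ?w)" by (rule cj1[OF St_mult[OF s(1) s'(1)]])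
    have "?w \<noteq> 0"
    proof
      assume "?w = 0" then have "w' = 0" using w by simp
      then show False using w'(1) T_nz by simp
    qed
    moreover have "?w \<noteq> axis a 1"
    proof
      assume "?w = axis a 1" then have "w' = ?t" using w by simp
      then show False using w'(2) by simp
    qed
    moreover have "?w $ z = 0"
    proof -
      have "scalar_product l w' = 0" using w'(1) T_H H by blast
      then show ?thesis using P0(3)[of ?w] unfolding Pinv by simp
    qed
    moreover have "smat z 1 ?w \<in> ?c ` St" unfolding cs'[symmetric] by (rule imageI[OF s'(1)])
    moreover have "smat z 1 (axis a 1 + ?w) \<in> ?c ` St"
      unfolding css[symmetric] by (rule imageI[OF St_mult[OF s(1) s'(1)]])
    ultimately show ?case by blast
  next
    case 12
    have "\<exists>t. transvection_about H t \<and> St = {Finite_Cartesian_Product.mat 1, t}"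
      using 12 unfolding delta_def by (rule contrapos_pp) simp
    then obtain t where tr: "transvection_about H t" and St: "St = {Finite_Cartesian_Product.mat 1, t}" by blast
    have tS: "t \<in> St" unfolding St by simp
    have t: "chr t = 1" "t \<noteq> Finite_Cartesian_Product.mat 1" using transvection_iff tr St_D(1)[OF tS] by blast+
    have "chr g = 1" using g(1) t(1) chr_1 unfolding St by blast
    then have e: "e_diag G H = 1" using g(2) has_order_1 by simp
    have r0: "root t \<noteq> 0" using root_eq_0_iff[OF tS] t(2) by blast
    \<comment> \<open>The square of the transvection lies in the two-element stabilizer. Its root is
      twice that of \<open>t\<close>, and in either case this is zero, which forces characteristic
      2.\<close>
    have rtt: "root (t ** t) = root t + root t" unfolding root_mult[OF tS tS] t(1) by simp
    have "t ** t = Finite_Cartesian_Product.mat 1 \<or> t ** t = t" using St_mult[OF tS tS] unfolding St by blast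
    then have "root t + root t = 0"
    proof
      assume "t ** t = t" then have "root t = 0" using rtt by simp
      then show ?thesis by simp
    qed (use rtt root_1 in simp)
    then have "(1 + 1) *s root t = 0" by (simp only: vector_sadd_rdistrib vector_smult_lid)
    then have two: "(1::'a) + 1 = 0" using r0 by (simp only: vec.scale_eq_0_iff) blast
    have T: "T \<subseteq> {root t}" unfolding T_def St by blast
    have tT: "root t \<in> T" using tS t unfolding T_def by blast
    have "B0 \<noteq> {}" using tT B0(3) r0 by auto
    then have B: "B0 = {root t}" using B0(1) T by blast
    then have "card S = 1" using bij_betw_same_card[OF S(2)] by simp
    then obtain a where a: "S = {a}" by (rule card_1_singletonE)
    have "root t = P0 *v axis a 1" using SB[of a] unfolding B a by simp
    then have ct: "?c t = smat z 1 (axis a 1)" by (rule cj1[OF tS])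
    have c1: "?c (Finite_Cartesian_Product.mat 1) = smat z 1 0" by (rule cj1[OF St_1]) (simp add: root_1)
    have "\<forall>s\<in>?c ` St. s = smat z 1 0 \<or> s = smat z 1 (axis a 1)"
    proof
      fix s assume "s \<in> ?c ` St"
      then have "s = ?c (Finite_Cartesian_Product.mat 1) \<or> s = ?c t" unfolding St by blast
      then show "s = smat z 1 0 \<or> s = smat z 1 (axis a 1)" by (simp only: c1 ct)
    qed
    then show ?case using e two a by blast
  qed
  then show ?thesis using P0(1,3) cS by blast
qed

end

section \<open>Local bases\<close>

abbreviation ker :: "('a::field, 'n::finite) space \<Rightarrow> ('a, 'n) space set" where
  "ker l \<equiv> {v. scalar_product l v = 0}"

lemma scalar_product_axis:
  fixes v l :: "('a::field, 'n::finite) space"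
  shows "scalar_product l (axis i 1) = l $ i" "scalar_product (axis i 1) v = v $ i"
proof -
  have "scalar_product l (axis i 1) = (\<Sum>j\<in>UNIV. if j = i then l $ i else 0)"
    unfolding scalar_product_def by (intro sum.cong) (auto simp: axis_def)
  then show "scalar_product l (axis i 1) = l $ i" by simp
  have "scalar_product (axis i 1) v = (\<Sum>j\<in>UNIV. if j = i then v $ i else 0)"
    unfolding scalar_product_def by (intro sum.cong) (auto simp: axis_def)
  then show "scalar_product (axis i 1) v = v $ i" by simp
qed

lemma scalar_product_left: "scalar_product (a - b) v = scalar_product a v - scalar_product b (v :: 'a::field ^ 'n::finite)"
  "scalar_product (c *s a) v = c * scalar_product a v"
  by (simp_all add: scalar_product_def algebra_simps sum_distrib_left sum_subtractf)

lemma ex_unit_vector: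
  fixes l :: "('a::field, 'n::finite) space"
  assumes "l \<noteq> 0" shows "\<exists>w. scalar_product l w = 1"
proof -
  obtain i where i: "l $ i \<noteq> 0" using assms by (auto simp: vec_eq_iff)
  then have "scalar_product l (inverse (l $ i) *s axis i 1) = 1"
    by (simp add: scalar_product_scale scalar_product_axis)
  then show ?thesis by blast
qed

lemma vanishing_on_kernel:
  fixes l m :: "('a::field, 'n::finite) space"
  assumes l: "l \<noteq> 0" and m: "\<And>v. scalar_product l v = 0 \<Longrightarrow> scalar_product m v = 0"
  shows "\<exists>c. m = c *s l"
proof -
  obtain w where w: "scalar_product l w = 1" using ex_unit_vector[OF l] by blast
  have "m $ i = (scalar_product m w *s l) $ i" for i
  proof -
    have "scalar_product l (axis i 1 - l $ i *s w) = 0"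
      by (simp add: scalar_product_diff scalar_product_scale scalar_product_axis w)
    from m[OF this] show ?thesis
      by (simp add: scalar_product_diff scalar_product_scale scalar_product_axis mult.commute)
  qed
  then show ?thesis by (auto simp: vec_eq_iff)
qed

lemma hyperplane_ker:
  fixes l :: "('a::field, 'n::finite) space"
  assumes "l \<noteq> 0" shows "hyperplane (ker l)"
proof -
  obtain w where w: "scalar_product l w = 1" using ex_unit_vector[OF assms] by blast
  have sub: "vec.subspace (ker l)"
    by (rule vec.subspaceI) (simp_all add: scalar_product_add scalar_product_scale, simp add: scalar_product_def)
  have sp: "vec.span (ker l) = ker l" using sub by simp
  have "v \<in> vec.span (insert w (ker l))" for v
  proof -
    have "scalar_product l v *s w \<in> vec.span (insert w (ker l))"
      by (intro vec.span_scale vec.span_base) simp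
    moreover have "v - scalar_product l v *s w \<in> vec.span (insert w (ker l))"
      by (intro vec.span_base) (simp add: scalar_product_diff scalar_product_scale w)
    ultimately have "scalar_product l v *s w + (v - scalar_product l v *s w) \<in> vec.span (insert w (ker l))"
      by (rule vec.span_add)
    then show ?thesis by simp
  qed
  then have "vec.span (insert w (ker l)) = UNIV" by blast
  then have "vec.dim (insert w (ker l)) = CARD('n)"
    using vec.dim_span[of "insert w (ker l)"] by (simp add: vec.dim_UNIV card_cart_basis)
  moreover have "vec.dim (insert w (ker l)) = vec.dim (ker l) + 1"
    unfolding vec.dim_insert sp using w by simp
  ultimately show ?thesis unfolding hyperplane_def using sub by simp
qed

lemma dual_act_fixing_kernel:
  fixes h :: "('a::field, 'n::finite) sqmat"
  assumes l: "l \<noteq> 0" and h: "invertible h" and fixed: "\<And>v. scalar_product l v = 0 \<Longrightarrow> h *v v = v"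
  shows "\<exists>c. dual_act h a = a + c *s l"
proof -
  have "scalar_product (dual_act h a - a) v = 0" if v: "scalar_product l v = 0" for v
  proof -
    have "matrix_inv h *v v = matrix_inv h *v (h *v v)" using fixed[OF v] by simp
    also have "\<dots> = v" using matrix_inv_props(2)[OF h] by (simp add: matrix_vector_mul_assoc)
    finally show ?thesis by (simp add: scalar_product_left dual_act_apply)
  qed
  then obtain c where "dual_act h a - a = c *s l" using vanishing_on_kernel[OF l] by blast
  then have "dual_act h a = a + c *s l" by (metis add.commute diff_add_cancel)
  then show ?thesis by blast
qed

lemma fixing_kernelI:
  fixes g :: "('a::field, 'n::finite) sqmat"
  assumes g: "invertible g" and c: "\<And>i. scalar_product (dual_act g (axis i 1) - axis i 1) v = 0"
  shows "g *v v = v"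
proof -
  have "(matrix_inv g *v v) $ i = v $ i" for i
    using c[of i] by (simp add: scalar_product_left dual_act_apply scalar_product_axis)
  then have "matrix_inv g *v v = v" by (simp add: vec_eq_iff)
  then have "g *v v = g *v (matrix_inv g *v v)" by simp
  then show ?thesis using matrix_inv_props(1)[OF g] by (simp add: matrix_vector_mul_assoc)
qed

lemma prime_elem_dvd_prodD:
  fixes p :: "'r::idom"
  assumes p: "prime_elem p" and fin: "finite A" and dvd: "p dvd (\<Prod>x\<in>A. f x)"
  shows "\<exists>x\<in>A. p dvd f x"
  using fin dvd
proof (induction A)
  case empty
  then have "p dvd 1" by simp
  then show ?case using p prime_elem_not_unit by blast
next
  case (insert a A)
  then have "p dvd f a * prod f A" by simp
  then have "p dvd f a \<or> p dvd prod f A" using p by (rule prime_elem_dvd_multD[rotated])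
  then show ?case using insert.IH by blast
qed

text \<open>The trivial coset is represented by the identity, so that the corresponding term of a
  transfer is the element itself.\<close>

definition coset_rep :: "('a::field, 'n::finite) sqmat set \<Rightarrow> ('a, 'n) sqmat \<Rightarrow> ('a, 'n) sqmat" where
  "coset_rep I g = (if Finite_Cartesian_Product.mat 1 \<in> (\<lambda>h. g ** h) ` I then Finite_Cartesian_Product.mat 1
     else (SOME x. x \<in> (\<lambda>h. g ** h) ` I))"

section \<open>Relative transfers\<close>

locale matrix_subgroup =
  fixes G I :: "('a::field, 'n::{finite, linorder}) sqmat set"
  assumes G: "subgroup G GL" and finG: "finite G" and IG: "I \<subseteq> G"
    and I1: "Finite_Cartesian_Product.mat 1 \<in> I" and Imult: "g \<in> I \<Longrightarrow> h \<in> I \<Longrightarrow> g ** h \<in> I"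
    and Iinv: "h \<in> I \<Longrightarrow> matrix_inv h \<in> I"
begin

abbreviation "cs g \<equiv> (\<lambda>h. g ** h) ` I"
abbreviation "q \<equiv> coset_rep I"

lemma cs_mult: assumes h: "h \<in> I" shows "cs (g ** h) = cs g"
proof (intro equalityI subsetI)
  fix x assume "x \<in> cs (g ** h)"
  then obtain k where "k \<in> I" "x = (g ** h) ** k" by blast
  then show "x \<in> cs g" using Imult[OF h] by (intro image_eqI[of _ _ "h ** k"]) (simp_all add: matrix_mul_assoc)
next
  fix x assume "x \<in> cs g"
  then obtain k where k: "k \<in> I" "x = g ** k" by blast
  have "h ** matrix_inv h = Finite_Cartesian_Product.mat 1"
    using h IG subgroup_GL_D(1)[OF G] matrix_inv_props(1) by blast
  then have "(g ** h) ** (matrix_inv h ** k) = x" using k(2) by (metis matrix_mul_assoc matrix_mul_lid)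
  then show "x \<in> cs (g ** h)" using Imult[OF Iinv[OF h] k(1)] by (intro image_eqI[of _ _ "matrix_inv h ** k"]) simp_all
qed

lemma q_in: "q g \<in> cs g"
proof -
  have "g \<in> cs g" using I1 by (intro image_eqI[of _ _ "Finite_Cartesian_Product.mat 1"]) simp_all
  then have "(SOME x. x \<in> cs g) \<in> cs g" by (rule someI)
  then show ?thesis unfolding coset_rep_def by (cases "Finite_Cartesian_Product.mat 1 \<in> cs g") (simp_all only: if_True if_False)
qed

lemma q_cong: assumes eq: "cs g = cs g'" shows "q g = q g'"
  unfolding coset_rep_def eq ..

lemma cs_q: "cs (q g) = cs g"
proof -
  obtain h where "q g = g ** h" "h \<in> I" using q_in[of g] by (rule imageE)
  then show ?thesis by (simp only: cs_mult)
qed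

lemma q_q: "q (q g) = q g" by (rule q_cong[OF cs_q])

lemma q_I: assumes "g \<in> I" shows "q g = Finite_Cartesian_Product.mat 1"
proof -
  have "g ** matrix_inv g = Finite_Cartesian_Product.mat 1"
    using assms IG subgroup_GL_D(1)[OF G] matrix_inv_props(1) by blast
  then have "Finite_Cartesian_Product.mat 1 \<in> cs g"
    using Iinv[OF assms] by (intro image_eqI[of _ _ "matrix_inv g"]) simp_all
  then show ?thesis unfolding coset_rep_def by (rule if_P)
qed

lemma q_G: assumes "g \<in> G" shows "q g \<in> G"
proof -
  obtain h where h: "q g = g ** h" "h \<in> I" using q_in[of g] by (rule imageE)
  show ?thesis unfolding h(1) by (rule subgroup_GL_D(2)[OF G assms]) (use h(2) IG in blast)
qed

lemma q_act:
  assumes "g \<in> G" "\<phi> \<in> invars I k" shows "sext_act (q g) \<phi> = sext_act g \<phi>"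
proof -
  obtain h where h: "q g = g ** h" "h \<in> I" using q_in[of g] by (rule imageE)
  then have "sext_act (q g) \<phi> = sext_act g (sext_act h \<phi>)"
    using sext_act_mult[of g h] assms(1) IG subgroup_GL_D(1)[OF G] by auto
  also have "sext_act h \<phi> = \<phi>" using assms(2) h(2) by (simp add: invars_def)
  finally show ?thesis .
qed

text \<open>The relative transfer from \<open>I\<close> to \<open>G\<close>; on invariants of
  \<open>I\<close> it is independent of the representatives (\<open>q_act\<close>).\<close>

definition tr :: "('a, 'n) sext \<Rightarrow> ('a, 'n) sext" where
  "tr \<phi> = (\<Sum>r\<in>q ` G. sext_act r \<phi>)"

text \<open>Left multiplication by \<open>g\<close> permutes the cosets, and an
  \<open>I\<close>-invariant sees only the coset of a group element.\<close>

lemma tr_invariant: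
  assumes \<phi>: "\<phi> \<in> invars I k" shows "tr \<phi> \<in> invariants G k"
proof -
  let ?R = "q ` G"
  have RG: "?R \<subseteq> G" using q_G by blast
  have "sext_act g (tr \<phi>) = tr \<phi>" if g: "g \<in> G" for g
  proof -
    have gr: "g ** r \<in> G" if "r \<in> ?R" for r using RG that g subgroup_GL_D(2)[OF G] by blast
    have inj: "inj_on (\<lambda>r. q (g ** r)) ?R"
    proof (rule inj_onI)
      fix r r' assume r: "r \<in> ?R" "r' \<in> ?R" "q (g ** r) = q (g ** r')"
      then have "cs (g ** r) = cs (g ** r')" using cs_q[of "g ** r"] cs_q[of "g ** r'"] by (simp only:)
      then have "(\<lambda>x. matrix_inv g ** x) ` cs (g ** r) = (\<lambda>x. matrix_inv g ** x) ` cs (g ** r')" by simp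
      moreover have "matrix_inv g ** ((g ** x) ** h) = x ** h" for x h :: "('a, 'n) sqmat"
        using matrix_inv_props(2)[OF subgroup_GL_D(1)[OF G g]] by (metis matrix_mul_assoc matrix_mul_lid)
      ultimately have "cs r = cs r'" by (simp add: image_image)
      then have "q r = q r'" by (rule q_cong)
      then show "r = r'" using r(1,2) q_q by auto
    qed
    have bij: "bij_betw (\<lambda>r. q (g ** r)) ?R ?R"
      unfolding bij_betw_def using inj endo_inj_surj[OF _ _ inj] gr finG by blast
    have "sext_act g (tr \<phi>) = (\<Sum>r\<in>?R. sext_act (g ** r) \<phi>)"
      unfolding tr_def sext_act_sum
      using RG g subgroup_GL_D(1)[OF G] by (intro sum.cong refl sext_act_mult[symmetric]) auto
    also have "\<dots> = (\<Sum>r\<in>?R. sext_act (q (g ** r)) \<phi>)"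
      by (intro sum.cong refl q_act[symmetric, OF gr \<phi>])
    also have "\<dots> = tr \<phi>" unfolding tr_def by (rule sum.reindex_bij_betw[OF bij])
    finally show ?thesis .
  qed
  moreover have "tr \<phi> \<in> S_ext_V k"
    unfolding tr_def using \<phi> by (intro S_ext_V_sum S_ext_V_sext_act) (simp add: invars_def)
  ultimately show ?thesis by (simp add: invariants_def)
qed

text \<open>Consider the sum over representatives \<open>s\<close> of \<open>s \<omega>\<close>
  times the product of the factors \<open>s (f r) - r (f r)\<close>, \<open>r \<in> A\<close>.
  Expanding the product over subsets \<open>X\<close> of \<open>A\<close> turns the sum into an
  \<open>S\<close>-combination of transfers of \<open>I\<close>-invariants, hence of
  \<open>G\<close>-invariants.\<close>

lemma scaled_span:
  assumes f: "\<And>g h. g \<in> G - I \<Longrightarrow> h \<in> I \<Longrightarrow> pol_act h (f g) = f g"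
    and span: "\<And>\<eta>. \<eta> \<in> invariants G k \<Longrightarrow> \<eta> \<in> S_span bs"
  shows "\<exists>A\<subseteq>G - I. \<forall>\<omega>\<in>invars I k. (\<Prod>g\<in>A. f g - pol_act g (f g)) *s \<omega> \<in> S_span bs"
proof -
  let ?one = "Finite_Cartesian_Product.mat 1 :: ('a, 'n) sqmat"
  let ?R = "q ` G"
  define A where "A = ?R - {?one}"
  have AG: "A \<subseteq> G - I"
  proof
    fix r assume r: "r \<in> A"
    then obtain g where g: "g \<in> G" "r = q g" unfolding A_def by blast
    have "r \<notin> I"
    proof
      assume "r \<in> I" then have "r = ?one" using q_I[of r] q_q g(2) by simp
      then show False using r by (simp add: A_def)
    qed
    then show "r \<in> G - I" using q_G g by blast
  qed
  have finR: "finite ?R" and finA: "finite A" using finG by (simp_all add: A_def)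
  have oneR: "?one \<in> ?R" using q_I[OF I1] I1 IG by (intro image_eqI[of _ _ ?one]) auto
  have "(\<Prod>g\<in>A. f g - pol_act g (f g)) *s \<omega> \<in> S_span bs" if \<omega>: "\<omega> \<in> invars I k" for \<omega>
  proof -
    let ?e = "\<lambda>X. \<Prod>r\<in>A-X. - pol_act r (f r)" and ?f = "\<lambda>X. \<Prod>r\<in>X. f r"
    let ?F = "\<lambda>s. \<Prod>r\<in>A. pol_act s (f r) + - pol_act r (f r)"
    have "?e X *s tr (?f X *s \<omega>) \<in> S_span bs" if X: "X \<in> Pow A" for X
    proof -
      have "sext_act h (?f X *s \<omega>) = ?f X *s \<omega>" if h: "h \<in> I" for h
      proof -
        have "pol_act h (?f X) = ?f X"
          unfolding pol_act.hom_prod using X AG h by (intro prod.cong refl f) auto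
        moreover have "sext_act h \<omega> = \<omega>" using \<omega> h by (simp add: invars_def)
        ultimately show ?thesis by (simp only: sext_act_scale)
      qed
      then have "?f X *s \<omega> \<in> invars I k" using \<omega> by (simp add: invars_def S_ext_V_scale)
      then show ?thesis by (intro S_span_scale span tr_invariant)
    qed
    then have mem: "(\<Sum>X\<in>Pow A. ?e X *s tr (?f X *s \<omega>)) \<in> S_span bs" by (rule S_span_sum)
    have "(\<Sum>X\<in>Pow A. ?e X *s tr (?f X *s \<omega>)) =
      (\<Sum>X\<in>Pow A. \<Sum>s\<in>?R. (pol_act s (?f X) * ?e X) *s sext_act s \<omega>)"
      unfolding tr_def sext_act_scale vec.scale_sum_right by (simp add: vec_eq_iff mult.assoc mult.left_commute sum_distrib_left)
    also have "\<dots> = (\<Sum>s\<in>?R. \<Sum>X\<in>Pow A. (pol_act s (?f X) * ?e X) *s sext_act s \<omega>)" by (rule sum.swap)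
    also have "\<dots> = (\<Sum>s\<in>?R. ?F s *s sext_act s \<omega>)"
    proof (intro sum.cong refl)
      fix s
      have "?F s = (\<Sum>X\<in>Pow A. pol_act s (?f X) * ?e X)"
        unfolding prod_add[OF finA] pol_act.hom_prod ..
      then show "(\<Sum>X\<in>Pow A. (pol_act s (?f X) * ?e X) *s sext_act s \<omega>) = ?F s *s sext_act s \<omega>"
        by (simp add: vec_eq_iff sum_distrib_right)
    qed
    \<comment> \<open>For \<open>s \<in> A\<close> the factor with \<open>r = s\<close> is zero, so
      only \<open>s = 1\<close> survives and leaves the desired multiple of
      \<open>\<omega>\<close>.\<close>
    also have "\<dots> = (\<Sum>s\<in>?R. if s = ?one then ?F ?one *s \<omega> else 0)"
    proof (intro sum.cong refl)
      fix s assume s: "s \<in> ?R"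
      show "?F s *s sext_act s \<omega> = (if s = ?one then ?F ?one *s \<omega> else 0)"
      proof (cases "s = ?one")
        case False
        then have "s \<in> A" using s by (simp add: A_def)
        then have "?F s = 0" by (intro prod_zero[OF finA]) (auto intro: bexI[of _ s])
        then show ?thesis using False by simp
      qed (simp add: sext_act_1)
    qed
    also have "\<dots> = ?F ?one *s \<omega>" using finR oneR by simp
    finally show ?thesis using mem by simp
  qed
  then show ?thesis using AG by blast
qed

end

lemma pointwise_stabilizer_subgroup:
  assumes G: "subgroup G GL" "finite G"
  shows "matrix_subgroup G (pointwise_stabilizer G H)"
proof (rule matrix_subgroup.intro)
  show "subgroup G GL" "finite G" by fact+
  show "pointwise_stabilizer G H \<subseteq> G" by (auto simp: pointwise_stabilizer_def)
  show "Finite_Cartesian_Product.mat 1 \<in> pointwise_stabilizer G H"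
    using subgroup_GL_D(3)[OF G(1)] by (simp add: pointwise_stabilizer_def)
  show "g ** h \<in> pointwise_stabilizer G H"
    if "g \<in> pointwise_stabilizer G H" "h \<in> pointwise_stabilizer G H" for g h
    using that subgroup_GL_D(2)[OF G(1)] by (simp add: pointwise_stabilizer_def flip: matrix_vector_mul_assoc)
  show "matrix_inv h \<in> pointwise_stabilizer G H" if h: "h \<in> pointwise_stabilizer G H" for h
  proof -
    have hG: "h \<in> G" using h by (simp add: pointwise_stabilizer_def)
    have "matrix_inv h *v v = v" if "v \<in> H" for v
    proof -
      have "matrix_inv h *v v = matrix_inv h *v (h *v v)" using h that by (simp add: pointwise_stabilizer_def)
      then show ?thesis using matrix_inv_props(2)[OF subgroup_GL_D(1)[OF G(1) hG]] by (simp add: matrix_vector_mul_assoc)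
    qed
    then show ?thesis using subgroup_GL_D(4)[OF G(1) hG] by (simp add: pointwise_stabilizer_def)
  qed
qed

lemma trivial_subgroup:
  assumes "subgroup G GL" "finite G" shows "matrix_subgroup G {Finite_Cartesian_Product.mat 1}"
  by (rule matrix_subgroup.intro) (use assms subgroup_GL_D(3)[OF assms(1)] in simp_all)

lemma map_poly_pol_act_prod: "map_poly (pol_act g) (\<Prod>x\<in>A. p x) = (\<Prod>x\<in>A. map_poly (pol_act g) (p x))"
proof (induction A rule: infinite_finite_induct)
  case (insert a A)
  have "map_poly (pol_act g) (r * r') = map_poly (pol_act g) r * map_poly (pol_act g) r'" for r r'
    by (rule poly_eqI) (simp add: coeff_map_poly coeff_mult pol_act.hom_sum pol_act.hom_mult)
  then show ?case using insert by simp
qed (simp_all add: map_poly_1')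

text \<open>The coefficients of \<open>\<Prod>\<^bsub>h \<in> G\<^sub>H\<^esub> (Y - h x)\<close> are invariant under \<open>G\<^sub>H\<close>.  If \<open>g\<close> fixed all of them
  modulo \<open>l\<close>, evaluation at \<open>Y = g x\<close> would give \<open>g x = h x = x\<close> modulo \<open>l\<close> for some \<open>h \<in> G\<^sub>H\<close>.\<close>

lemma separating_pol:
  fixes G :: "('a::field, 'n::{finite, linorder}) sqmat set"
  assumes G: "subgroup G GL" "finite G" and l: "l \<noteq> 0" and g: "g \<in> G - pointwise_stabilizer G (ker l)"
  shows "\<exists>f. (\<forall>h\<in>pointwise_stabilizer G (ker l). pol_act h f = f) \<and> \<not> lin_form l dvd f - pol_act g f"
proof (rule ccontr)
  let ?I = "pointwise_stabilizer G (ker l)" and ?one = "Finite_Cartesian_Product.mat 1 :: ('a, 'n) sqmat"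
  interpret I: matrix_subgroup G ?I by (rule pointwise_stabilizer_subgroup[OF G])
  assume no: "\<not> ?thesis"
  have finI: "finite ?I" using I.IG G(2) by (rule finite_subset)
  have inv: "invertible h" if "h \<in> G" for h by (rule subgroup_GL_D(1)[OF G(1) that])
  have ginv: "invertible g" using g inv by blast
  have pl: "prime_elem (lin_form l)" by (rule prime_elem_lin_form[OF l])
  have "\<exists>c. dual_act g (axis i 1) - axis i 1 = c *s l" for i
  proof -
    let ?x = "var i :: ('a, 'n) pol"
    define P where "P = (\<Prod>h\<in>?I. [:- pol_act h ?x, 1:])"
    have mp: "map_poly (pol_act s) P = (\<Prod>h\<in>?I. [:- pol_act s (pol_act h ?x), 1:])" for s
      unfolding P_def map_poly_pol_act_prod by (intro prod.cong) (simp_all add: map_poly_pCons pol_act.hom_uminus)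
    have "map_poly (pol_act s) P = P" if s: "s \<in> ?I" for s
    proof -
      have sG: "s \<in> G" using s I.IG by blast
      have bij: "bij_betw (\<lambda>h. s ** h) ?I ?I"
      proof (rule bij_betwI[where g = "\<lambda>h. matrix_inv s ** h"])
        show "(\<lambda>h. s ** h) \<in> ?I \<rightarrow> ?I" using I.Imult[OF s] by blast
        show "(\<lambda>h. matrix_inv s ** h) \<in> ?I \<rightarrow> ?I" using I.Imult[OF I.Iinv[OF s]] by blast
        show "matrix_inv s ** (s ** h) = h" "s ** (matrix_inv s ** h) = h" for h
          using matrix_inv_props[OF inv[OF sG]] by (simp_all add: matrix_mul_assoc)
      qed
      have "map_poly (pol_act s) P = (\<Prod>h\<in>?I. [:- pol_act (s ** h) ?x, 1:])"
        unfolding mp using inv sG I.IG by (intro prod.cong refl) (auto simp: pol_act_mult)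
      also have "\<dots> = P" unfolding P_def by (rule prod.reindex_bij_betw[OF bij])
      finally show ?thesis .
    qed
    then have "pol_act h (coeff P m) = coeff P m" if "h \<in> ?I" for h m
      using that coeff_map_poly[of "pol_act h" P m] by simp
    then have dvd: "lin_form l dvd coeff P m - pol_act g (coeff P m)" for m using no by blast
    let ?y = "pol_act g ?x"
    let ?D = "P - map_poly (pol_act g) P"
    have "lin_form l dvd poly ?D ?y"
      unfolding poly_altdef by (intro dvd_sum dvd_mult2) (simp add: coeff_map_poly dvd)
    moreover have "poly (map_poly (pol_act g) P) ?y = 0"
      unfolding mp poly_prod using I.I1 by (intro prod_zero[OF finI] bexI[of _ ?one]) simp_all
    ultimately have "lin_form l dvd poly P ?y" by simp
    also have "poly P ?y = (\<Prod>h\<in>?I. ?y - pol_act h ?x)" unfolding P_def poly_prod by simp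
    finally obtain h where h: "h \<in> ?I" "lin_form l dvd ?y - pol_act h ?x"
      using prime_elem_dvd_prodD[OF pl finI] by blast
    have "h \<in> G" "\<And>v. scalar_product l v = 0 \<Longrightarrow> h *v v = v" using h(1) by (simp_all add: pointwise_stabilizer_def)
    then obtain c where c: "dual_act h (axis i 1) = axis i 1 + c *s l"
      using dual_act_fixing_kernel[OF l inv] by blast
    have "?y - pol_act h ?x = lin_form (dual_act g (axis i 1) - dual_act h (axis i 1))"
      by (simp only: pol_act_var lin_form_diff)
    then have "lin_form l dvd lin_form (dual_act g (axis i 1) - dual_act h (axis i 1))" using h(2) by simp
    then obtain c' where "dual_act g (axis i 1) - dual_act h (axis i 1) = c' *s l"
      by (rule lin_form_dvd_lin_form[THEN exE])
    then have "dual_act g (axis i 1) - axis i 1 = (c + c') *s l"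
      unfolding c by (simp add: vec_eq_iff algebra_simps)
    then show ?thesis by blast
  qed
  then have c: "\<exists>c. dual_act g (axis i 1) - axis i 1 = c *s l" for i by blast
  have "g *v v = v" if "scalar_product l v = 0" for v
  proof (rule fixing_kernelI[OF ginv])
    fix i
    obtain c where "dual_act g (axis i 1) - axis i 1 = c *s l" using c by blast
    then show "scalar_product (dual_act g (axis i 1) - axis i 1) v = 0"
      using that by (simp only: scalar_product_left) simp
  qed
  then have "g \<in> ?I" using g by (simp add: pointwise_stabilizer_def)
  then show False using g by blast
qed

lemma std_basis:
  fixes ps :: "('n::{finite, linorder} set \<times> 'n) list"
  assumes ps: "distinct ps" "set ps = basis_index k"
  defines "bs \<equiv> map (\<lambda>p. axis p 1 :: ('a::field, 'n) sext) ps"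
  shows "Determinant.det (coef_mat bs ps) = 1" "set bs \<subseteq> S_ext_V k" "\<eta> \<in> S_ext_V k \<Longrightarrow> \<eta> \<in> S_span bs"
proof -
  have "coef_mat bs ps = 1\<^sub>m (length ps)"
    using ps(1) by (intro eq_matI) (auto simp: coef_mat_def bs_def axis_def nth_eq_iff_index_eq)
  then show "Determinant.det (coef_mat bs ps) = 1" by simp
  show "set bs \<subseteq> S_ext_V k" using ps(2) by (auto simp: bs_def S_ext_V_def axis_def)
  assume \<eta>: "\<eta> \<in> S_ext_V k"
  have "\<eta> = (\<Sum>p\<in>set ps. \<eta> $ p *s axis p 1)"
  proof -
    have "\<eta> $ q = (\<Sum>p\<in>set ps. \<eta> $ p *s axis p 1) $ q" for q
    proof -
      have "(\<Sum>p\<in>set ps. \<eta> $ p *s axis p 1) $ q = (\<Sum>p\<in>set ps. if p = q then \<eta> $ q else 0)"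
        unfolding sum_component by (intro sum.cong) (auto simp: axis_def)
      also have "\<dots> = \<eta> $ q"
      proof (cases "q \<in> basis_index k")
        case False
        then have "\<eta> $ q = 0" using \<eta> unfolding S_ext_V_def by blast
        then show ?thesis by simp
      qed (use ps(2) in simp)
      finally show ?thesis ..
    qed
    then show ?thesis unfolding vec_eq_iff by (rule allI)
  qed
  also have "\<dots> \<in> S_span bs"
    by (intro S_span_sum S_span_scale S_span_base) (simp add: bs_def)
  finally show "\<eta> \<in> S_span bs" .
qed

definition hexp :: "('a::field, 'n::{finite, linorder}) sqmat set \<Rightarrow> ('a, 'n) space \<Rightarrow> ('a, 'n) space set \<Rightarrow> nat \<Rightarrow> nat" where
  "hexp G l H k = binom (int CARD('n) - 1) (int k)
     + (e_diag G H - 1) * (CARD('n) - 1) * binom (int CARD('n) - 1) (int k - 1) + e_diag G H * a_exp G l H k"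

text \<open>The base change \<open>P0\<close> carries invariants of the conjugated group to
  invariants of the stabilizer. It is semilinear over \<open>S\<close>, so spanning is preserved,
  and it changes the determinant by \<open>pol_act P0\<close> and a unit.\<close>

lemma (in hyperplane_stabilizer) local_basis_arrangement:
  assumes ps: "distinct ps" "set ps = basis_index k"
  shows "\<exists>bs. length bs = length ps \<and> set bs \<subseteq> invars St k \<and> (\<forall>\<eta>\<in>invars St k. \<eta> \<in> S_span bs) \<and>
    (\<exists>c. c \<noteq> 0 \<and> Determinant.det (coef_mat bs ps) = const c * lin_form l ^ hexp G l H k)"
proof -
  define z where "z = Min (UNIV :: 'n set)"
  have zm: "z \<le> i" for i unfolding z_def by (rule Min_le) simp_all
  obtain P0 :: "('a, 'n) sqmat" and S \<zeta> where P0: "invertible P0" "\<forall>v. scalar_product l (P0 *v v) = v $ z"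
    and cS: "card S = b_root G l H"
    and sg: "std_group z S (e_diag G H) (delta G H) \<zeta> ((\<lambda>s. matrix_inv P0 ** s ** P0) ` St)"
    using std_form[OF zm] by (elim exE conjE) (rule that)
  let ?Gr = "(\<lambda>s. matrix_inv P0 ** s ** P0) ` St"
  interpret sg: std_group z S "e_diag G H" "delta G H" \<zeta> ?Gr by (rule sg)
  let ?P = "sext_act P0" and ?Q = "sext_act (matrix_inv P0)"
  have Qi: "invertible (matrix_inv P0)" by (rule invertible_matrix_inv[OF P0(1)])
  have PQ: "?P (?Q \<eta>) = \<eta>" for \<eta> :: "('a, 'n) sext"
    using sext_act_mult[OF P0(1) Qi, of \<eta>] matrix_inv_props(1)[OF P0(1)] by (simp add: sext_act_1)
  have cj: "sext_act (matrix_inv P0 ** s ** P0) \<eta> = ?Q (sext_act s (?P \<eta>))" if "s \<in> St" for s and \<eta> :: "('a, 'n) sext"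
    using St_invertible[OF that] P0(1) Qi by (simp add: sext_act_mult invertible_mult)
  let ?bs = "map ?P (map sg.bb ps)"
  have bbS: "set (map sg.bb ps) \<subseteq> S_ext_V k" using sg.bb_S_ext_V ps(2) by auto
  have "?P (sg.bb p) \<in> invars St k" if p: "p \<in> set ps" for p
  proof -
    have "sext_act s (?P (sg.bb p)) = ?P (sg.bb p)" if s: "s \<in> St" for s
    proof -
      have "sext_act (matrix_inv P0 ** s ** P0) (sg.bb p) = sg.bb p" by (rule sg.bb_inv) (rule imageI[OF s])
      then have "?P (?Q (sext_act s (?P (sg.bb p)))) = ?P (sg.bb p)" unfolding cj[OF s] by simp
      then show ?thesis unfolding PQ .
    qed
    moreover have "?P (sg.bb p) \<in> S_ext_V k" using bbS p by (intro S_ext_V_sext_act) auto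
    ultimately show ?thesis by (simp add: invars_def)
  qed
  then have 1: "set ?bs \<subseteq> invars St k" by auto
  have 2: "\<eta> \<in> S_span ?bs" if \<eta>: "\<eta> \<in> invars St k" for \<eta>
  proof -
    have "sext_act g (?Q \<eta>) = ?Q \<eta>" if "g \<in> ?Gr" for g
    proof -
      obtain s where s: "s \<in> St" "g = matrix_inv P0 ** s ** P0" using \<open>g \<in> ?Gr\<close> by blast
      have "sext_act s \<eta> = \<eta>" using \<eta> s(1) by (simp add: invars_def)
      then show ?thesis unfolding s(2) cj[OF s(1)] PQ by simp
    qed
    moreover have "?Q \<eta> \<in> S_ext_V k" using \<eta> by (intro S_ext_V_sext_act) (simp add: invars_def)
    ultimately have "?Q \<eta> \<in> invars ?Gr k" unfolding invars_def by blast
    then have "?Q \<eta> \<in> S_span (map sg.bb ps)" using ps(2) by (rule sg.invars_span)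
    then obtain c where c: "?Q \<eta> = (\<Sum>s<length (map sg.bb ps). c s *s map sg.bb ps ! s)" unfolding S_span_def by blast
    have "\<eta> = ?P (?Q \<eta>)" by (rule PQ[symmetric])
    also have "\<dots> = (\<Sum>s<length (map sg.bb ps). pol_act P0 (c s) *s ?P (map sg.bb ps ! s))"
      unfolding c sext_act_sum sext_act_scale ..
    also have "\<dots> \<in> S_span ?bs"
    proof (intro S_span_sum S_span_scale S_span_base)
      fix s assume "s \<in> {..<length (map sg.bb ps)}"
      then have "map sg.bb ps ! s \<in> set (map sg.bb ps)" by (intro nth_mem) simp
      then show "?P (map sg.bb ps ! s) \<in> set ?bs" unfolding set_map[of ?P] by (rule imageI)
    qed
    finally show ?thesis .
  qed
  obtain c where c: "c \<noteq> 0" "Determinant.det (coef_mat ?bs ps) = const c * pol_act P0 (Determinant.det (coef_mat (map sg.bb ps) ps))"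
    using det_coef_mat_sext_act[OF _ ps(2,1) bbS P0(1)] by auto
  \<comment> \<open>The coordinate form of the model hyperplane goes to \<open>l\<close>, which
    turns the power of \<open>x_z\<close> into a power of \<open>l\<close>.\<close>
  have "dual_act P0 (axis z 1) = l"
  proof (rule dual_act_eqI[OF P0(1)])
    have "(l v* P0) $ j = axis z 1 $ j" for j
    proof -
      have "(l v* P0) $ j = scalar_product l (P0 *v axis j 1)"
        by (simp add: scalar_product_def vector_matrix_mult_def matrix_vector_mult_axis)
      also have "\<dots> = axis j 1 $ z" using P0(2) by blast
      finally show ?thesis by (simp add: axis_def)
    qed
    then show "l v* P0 = axis z 1" by (simp add: vec_eq_iff)
  qed
  then have Pz: "pol_act P0 (var z) = lin_form l" by (simp only: pol_act_var)
  have "(\<Sum>p\<in>basis_index k. sg.cexp p) = hexp G l H k"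
    unfolding sg.sum_cexp hexp_def a_exp_def Let_def cS by (simp add: mult.assoc)
  then have "pol_act P0 (Determinant.det (coef_mat (map sg.bb ps) ps)) = lin_form l ^ hexp G l H k"
    unfolding sg.det_bb[OF ps] pol_act.hom_power Pz by simp
  then have "Determinant.det (coef_mat ?bs ps) = const c * lin_form l ^ hexp G l H k" using c(2) by simp
  then show ?thesis using 1 2 c(1) by (intro exI[of _ ?bs]) auto
qed

text \<open>Zero off the arrangement, where the pointwise stabilizer is trivial. This makes the
  local statements uniform in all nonzero forms, so that linear factors belonging to no reflecting
  hyperplane are excluded by the same argument.\<close>

definition lexp :: "('a::field, 'n::{finite, linorder}) sqmat set \<Rightarrow> ('a, 'n) space \<Rightarrow> nat \<Rightarrow> nat" where
  "lexp G l k = (if ker l \<in> reflection_arrangement G then hexp G l (ker l) k else 0)"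

lemma local_basis:
  fixes G :: "('a::field, 'n::{finite, linorder}) sqmat set"
  assumes G: "subgroup G GL" "finite G" and l: "l \<noteq> 0" and ps: "distinct ps" "set ps = basis_index k"
  shows "\<exists>bs. length bs = length ps \<and> set bs \<subseteq> invars (pointwise_stabilizer G (ker l)) k \<and>
    (\<forall>\<eta>\<in>invars (pointwise_stabilizer G (ker l)) k. \<eta> \<in> S_span bs) \<and>
    (\<exists>c. c \<noteq> 0 \<and> Determinant.det (coef_mat bs ps) = const c * lin_form l ^ lexp G l k)"
proof (cases "ker l \<in> reflection_arrangement G")
  case True
  interpret hyperplane_stabilizer G l "ker l" by (rule hyperplane_stabilizer.intro) (use G True in simp_all)
  show ?thesis using local_basis_arrangement[OF ps] True unfolding lexp_def by simp
next
  case False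
  let ?I = "pointwise_stabilizer G (ker l)" and ?bs = "map (\<lambda>p. axis p 1 :: ('a, 'n) sext) ps"
  have "g = Finite_Cartesian_Product.mat 1" if g: "g \<in> ?I" for g
  proof (rule ccontr)
    assume n1: "g \<noteq> Finite_Cartesian_Product.mat 1"
    have gG: "g \<in> G" and fx: "\<forall>v\<in>ker l. g *v v = v" using g by (simp_all add: pointwise_stabilizer_def)
    have "reflection_about (ker l) g"
      unfolding reflection_about_def using hyperplane_ker[OF l] subgroup_GL_D(1)[OF G(1) gG] n1 fx by blast
    then show False using False gG unfolding reflection_arrangement_def by blast
  qed
  note one = this
  have "\<eta> \<in> invars ?I k" if "\<eta> \<in> S_ext_V k" for \<eta> :: "('a, 'n) sext"
  proof -
    have "sext_act g \<eta> = \<eta>" if "g \<in> ?I" for g by (simp only: one[OF that] sext_act_1)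
    then show ?thesis using that unfolding invars_def by blast
  qed
  then have 1: "set ?bs \<subseteq> invars ?I k" using std_basis(2)[OF ps] by blast
  have 2: "\<forall>\<eta>\<in>invars ?I k. \<eta> \<in> S_span ?bs" by (intro ballI std_basis(3)[OF ps]) (simp add: invars_def)
  have "lexp G l k = 0" unfolding lexp_def using False by (rule if_not_P)
  then have 3: "Determinant.det (coef_mat ?bs ps) = const 1 * lin_form l ^ lexp G l k"
    unfolding std_basis(1)[OF ps] by simp
  show ?thesis
  proof (intro exI[of _ ?bs] conjI exI[of _ "1 :: 'a"])
    show "length ?bs = length ps" "(1 :: 'a) \<noteq> 0" by simp_all
  qed (fact 1 2 3)+
qed

section \<open>The criterion\<close>

text \<open>A reflection determines its hyperplane, hence a finite group has a finite
  arrangement.\<close>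

lemma reflection_fixed_space:
  fixes s :: "('a::field, 'n::finite) sqmat"
  assumes s: "reflection_about (ker l) s" shows "ker l = {v. s *v v = v}"
proof (intro equalityI subsetI)
  show "v \<in> ker l \<Longrightarrow> v \<in> {v. s *v v = v}" for v using s by (simp add: reflection_about_def)
next
  fix v assume v: "v \<in> {v. s *v v = v}"
  have fx: "s *v w = w" if "scalar_product l w = 0" for w using s that by (simp add: reflection_about_def)
  show "v \<in> ker l"
  proof (rule ccontr)
    assume "v \<notin> ker l"
    then have nz: "scalar_product l v \<noteq> 0" by simp
    have "s *v w = w" for w
    proof -
      let ?a = "scalar_product l w / scalar_product l v"
      have "s *v (w - ?a *s v) = w - ?a *s v"
        by (rule fx) (simp add: scalar_product_diff scalar_product_scale nz)
      then have "s *v w - ?a *s (s *v v) = w - ?a *s v"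
        by (simp only: matrix_vector_mult_diff_distrib vector_scalar_commute)
      then show ?thesis using v by simp
    qed
    then have "s = Finite_Cartesian_Product.mat 1" by (intro matrix_eq_iff_axis) simp
    then show False using s by (simp add: reflection_about_def)
  qed
qed

lemma list_sum:
  fixes xs :: "('r::comm_ring_1 ^ 'm::finite) list"
  assumes "distinct xs" "T \<subseteq> set xs"
  shows "(\<Sum>x\<in>T. c x *s x) = (\<Sum>s<length xs. (if xs ! s \<in> T then c (xs ! s) else 0) *s xs ! s)"
proof -
  have "(\<Sum>s<length xs. (if xs ! s \<in> T then c (xs ! s) else 0) *s xs ! s) =
      (\<Sum>x\<in>set xs. (if x \<in> T then c x else 0) *s x)"
    by (rule sum.reindex_bij_betw[OF bij_betw_nth[OF assms(1) refl refl]])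
  also have "\<dots> = (\<Sum>x\<in>T. c x *s x)"
    using assms(2) by (intro sum.mono_neutral_cong_right) auto
  finally show ?thesis by simp
qed

lemma homogeneous_pol_degree: "homogeneous d \<eta> \<Longrightarrow> homogeneous (pol_degree \<eta>) \<eta>"
  unfolding pol_degree_def by (rule LeastI)

lemma const_unit: "c \<noteq> 0 \<Longrightarrow> (const c :: ('a::field, 'n) pol) dvd 1"
  by (rule dvdI[of _ _ "const (inverse c)"]) (simp flip: const_mult)

lemma prod_power_dvd_cases:
  fixes p :: "'i \<Rightarrow> 'r::idom"
  assumes "finite A" "\<And>x. x \<in> A \<Longrightarrow> prime_elem (p x)" "h dvd (\<Prod>x\<in>A. p x) ^ m"
  shows "h dvd 1 \<or> (\<exists>x\<in>A. p x dvd h)"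
proof -
  have "(\<Prod>x\<in>A. p x) ^ m = (\<Prod>x\<in>A. \<Prod>j<m. p x)" by (simp add: prod_power_distrib)
  also have "\<dots> = (\<Prod>(x, j)\<in>A \<times> {..<m}. p x)" by (rule prod.cartesian_product)
  also have "\<dots> = (\<Prod>y\<in>A \<times> {..<m}. p (fst y))" by (intro prod.cong) auto
  finally have dvd: "h dvd (\<Prod>y\<in>A \<times> {..<m}. p (fst y))" using assms(3) by (simp only:)
  have "h dvd 1 \<or> (\<exists>y\<in>A \<times> {..<m}. p (fst y) dvd h)"
    by (rule dvd_prod_prime_elems[OF _ _ dvd]) (use assms(1,2) in auto)
  then show ?thesis by auto
qed

section \<open>Passage from single hyperplanes to the whole arrangement\<close>

locale reflection_data =
  fixes G :: "('a::field, 'n::{finite, linorder}) sqmat set"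
    and ell :: "('a, 'n) space set \<Rightarrow> ('a, 'n) space" and k :: nat and ps :: "('n set \<times> 'n) list"
  assumes G: "subgroup G GL" and finG: "finite G"
    and ell: "H \<in> reflection_arrangement G \<Longrightarrow> ker (ell H) = H"
    and ps: "distinct ps" "set ps = basis_index k"
begin

abbreviation "arr \<equiv> reflection_arrangement G"

lemma ell_nz: assumes "H \<in> arr" shows "ell H \<noteq> 0"
proof
  assume "ell H = 0"
  then have "H = UNIV" using ell[OF assms] by (auto simp: scalar_product_def)
  then have "vec.dim H = CARD('n)" by (simp add: vec.dim_UNIV card_cart_basis)
  moreover have "vec.dim H = CARD('n) - 1"
    using assms by (auto simp: reflection_arrangement_def reflection_about_def hyperplane_def)
  moreover have "CARD('n) > 0" by simp
  ultimately show False by linarith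
qed

lemma finite_arr: "finite arr"
proof (rule finite_subset)
  show "arr \<subseteq> (\<lambda>s. {v. s *v v = v}) ` G"
  proof
    fix H assume H: "H \<in> arr"
    then obtain s where s: "s \<in> G" "reflection_about H s" unfolding reflection_arrangement_def by blast
    have "reflection_about (ker (ell H)) s" unfolding ell[OF H] by (rule s(2))
    then have "ker (ell H) = {v. s *v v = v}" by (rule reflection_fixed_space)
    then have "H = {v. s *v v = v}" unfolding ell[OF H] .
    then show "H \<in> (\<lambda>s. {v. s *v v = v}) ` G" using s(1) by (rule image_eqI)
  qed
  show "finite ((\<lambda>s. {v. s *v v = v}) ` G)" using finG by simp
qed

definition Disc :: "('a, 'n) pol" where
  "Disc = (\<Prod>H\<in>arr. lin_form (ell H) ^ hexp G (ell H) H k)"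

lemma Disc_eq: "Q G ell ^ binom (int CARD('n) - 1) (int k)
    * Q_det G ell ^ ((CARD('n) - 1) * binom (int CARD('n) - 1) (int k - 1)) * Q_exp G ell k = Disc"
  unfolding Disc_def Q_def Q_det_def Q_exp_def hexp_def
  by (simp only: prod_power_distrib prod.distrib[symmetric] power_mult[symmetric] power_add mult.assoc)

lemma Disc_nz: "Disc \<noteq> 0"
  unfolding Disc_def using finite_arr ell_nz by simp

lemma homogeneous_Disc: "homogeneous_pol (\<Sum>H\<in>arr. hexp G (ell H) H k) Disc"
  unfolding Disc_def
proof (rule homogeneous_pol_prod)
  show "homogeneous_pol (hexp G (ell H) H k) (lin_form (ell H) ^ hexp G (ell H) H k)" for H
    using homogeneous_pol_power[OF homogeneous_pol_lin_form, where k = "hexp G (ell H) H k"] by simp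
qed

lemma invariants_invars: "I \<subseteq> G \<Longrightarrow> invariants G k \<subseteq> invars I k"
  unfolding invariants_def invars_def by blast

text \<open>Each local basis gives the power of one form. Forms with different kernels are
  non-associated primes, so the powers divide jointly.\<close>

lemma Disc_dvd:
  assumes len: "length xs = length ps" and xs: "set xs \<subseteq> invariants G k"
  shows "Disc dvd Determinant.det (coef_mat xs ps)"
  unfolding Disc_def
proof (rule prod_prime_powers_dvd[OF finite_arr])
  show "prime_elem (lin_form (ell H))" if "H \<in> arr" for H by (rule prime_elem_lin_form[OF ell_nz[OF that]])
next
  fix H H' assume H: "H \<in> arr" "H' \<in> arr" "H \<noteq> H'"
  show "\<not> lin_form (ell H) dvd lin_form (ell H')"
  proof
    assume "lin_form (ell H) dvd lin_form (ell H')"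
    then obtain c where c: "ell H' = c *s ell H" by (rule lin_form_dvd_lin_form[THEN exE])
    then have "c \<noteq> 0" using ell_nz[OF H(2)] by auto
    then have "ker (ell H') = ker (ell H)" unfolding c by (simp add: scalar_product_left)
    then show False using H(3) unfolding ell[OF H(1)] ell[OF H(2)] by simp
  qed
next
  fix H assume H: "H \<in> arr"
  let ?I = "pointwise_stabilizer G (ker (ell H))"
  obtain bs c where bs: "length bs = length ps" "\<forall>\<eta>\<in>invars ?I k. \<eta> \<in> S_span bs"
    and c: "Determinant.det (coef_mat bs ps) = const c * lin_form (ell H) ^ lexp G (ell H) k"
    using local_basis[OF G finG ell_nz[OF H] ps] by (elim exE conjE) (rule that)
  have IG: "?I \<subseteq> G" by (auto simp: pointwise_stabilizer_def)
  have "lexp G (ell H) k = hexp G (ell H) H k" unfolding lexp_def ell[OF H] using H by simp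
  moreover have "Determinant.det (coef_mat bs ps) dvd Determinant.det (coef_mat xs ps)"
    by (rule det_coef_mat_dvd[OF len bs(1)]) (use bs(2) xs invariants_invars[OF IG] in blast)
  ultimately show "lin_form (ell H) ^ hexp G (ell H) H k dvd Determinant.det (coef_mat xs ps)"
    unfolding c by (simp only:) (rule dvd_mult_right)
qed

text \<open>Replacing a member of \<open>bs\<close> by any invariant leaves a family of invariants,
  whose determinant \<open>Disc\<close> still divides: this is the hypothesis of Cramer's
  rule.\<close>

lemma det_imp_free:
  assumes len: "length bs = length ps" and dist: "distinct bs" and bs: "set bs \<subseteq> invariants G k"
    and det: "Determinant.det (coef_mat bs ps) = const c * Disc" "c \<noteq> 0"
  shows "free_basis (invariant_ring G) (invariants G k) (set bs)"
proof -
  have nz: "Determinant.det (coef_mat bs ps) \<noteq> 0" unfolding det(1) using det(2) Disc_nz by simp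
  have bsS: "set bs \<subseteq> S_ext_V k" using bs by (auto simp: invariants_def)
  have rep: "\<exists>T c. finite T \<and> T \<subseteq> set bs \<and> (\<forall>\<beta>\<in>T. c \<beta> \<in> invariant_ring G) \<and> \<eta> = (\<Sum>\<beta>\<in>T. c \<beta> *s \<beta>)"
    if \<eta>: "\<eta> \<in> invariants G k" for \<eta>
  proof -
    have "\<eta> \<in> S_span bs"
    proof (rule cramer_S_span[OF len ps(2) bsS _ det Disc_nz])
      show "\<eta> \<in> S_ext_V k" using \<eta> by (simp add: invariants_def)
      show "Disc dvd Determinant.det (coef_mat (bs[i := \<eta>]) ps)" for i
        by (rule Disc_dvd) (use len bs \<eta> set_update_subset_insert[of bs i \<eta>] in auto)
    qed
    then obtain a where a: "\<eta> = (\<Sum>s<length bs. a s *s bs ! s)" unfolding S_span_def by blast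
    \<comment> \<open>Applying \<open>g\<close> to the expansion fixes \<open>\<eta>\<close> and the
      family and moves only the coefficients; by independence these do not move either.\<close>
    have inv: "a r \<in> invariant_ring G" if r: "r < length ps" for r
    proof -
      have "pol_act g (a r) = a r" if g: "g \<in> G" for g
      proof -
        have "\<eta> = sext_act g \<eta>" using \<eta> g by (simp add: invariants_def)
        also have "\<dots> = (\<Sum>s<length ps. pol_act g (a s) *s sext_act g (bs ! s))"
          unfolding a sext_act_sum sext_act_scale len ..
        also have "\<dots> = (\<Sum>s<length ps. pol_act g (a s) *s bs ! s)"
        proof (intro sum.cong refl)
          fix s assume "s \<in> {..<length ps}"
          then have "bs ! s \<in> invariants G k" using bs len nth_mem[of s bs] by auto
          then have "sext_act g (bs ! s) = bs ! s" using g by (simp add: invariants_def)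
          then show "pol_act g (a s) *s sext_act g (bs ! s) = pol_act g (a s) *s bs ! s" by simp
        qed
        finally have 1: "(\<Sum>s<length ps. pol_act g (a s) *s bs ! s) = \<eta>" by (rule sym)
        have 2: "(\<Sum>s<length ps. a s *s bs ! s) = \<eta>" unfolding len[symmetric] by (rule a[symmetric])
        have "(\<Sum>s<length ps. (pol_act g (a s) - a s) *s bs ! s) =
            (\<Sum>s<length ps. pol_act g (a s) *s bs ! s) - (\<Sum>s<length ps. a s *s bs ! s)"
          by (simp add: vec_eq_iff left_diff_distrib sum_subtractf)
        then have "(\<Sum>s<length ps. (pol_act g (a s) - a s) *s bs ! s) = 0" unfolding 1 2 by simp
        then have "pol_act g (a r) - a r = 0"
          by (rule coef_mat_independent[OF len nz _ r, where c = "\<lambda>s. pol_act g (a s) - a s"])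
        then show ?thesis by simp
      qed
      then show ?thesis by (simp add: invariant_ring_def)
    qed
    define h where "h = the_inv_into {..<length bs} ((!) bs)"
    have bij: "bij_betw ((!) bs) {..<length bs} (set bs)" by (rule bij_betw_nth[OF dist refl refl])
    have h: "h (bs ! s) = s" if "s < length bs" for s
      unfolding h_def using bij that by (intro the_inv_into_f_f) (auto simp: bij_betw_def)
    have "\<eta> = (\<Sum>s<length bs. a (h (bs ! s)) *s bs ! s)" unfolding a by (intro sum.cong) (simp_all add: h)
    also have "\<dots> = (\<Sum>\<beta>\<in>set bs. a (h \<beta>) *s \<beta>)" by (rule sum.reindex_bij_betw[OF bij])
    finally have e: "\<eta> = (\<Sum>\<beta>\<in>set bs. a (h \<beta>) *s \<beta>)" .
    have "\<forall>\<beta>\<in>set bs. a (h \<beta>) \<in> invariant_ring G"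
    proof
      fix \<beta> assume "\<beta> \<in> set bs"
      then obtain s where s: "s < length bs" "\<beta> = bs ! s" by (auto simp: in_set_conv_nth)
      then show "a (h \<beta>) \<in> invariant_ring G" using inv[of s] h[OF s(1)] len by simp
    qed
    then show ?thesis using e by (intro exI[of _ "set bs"] exI[of _ "\<lambda>\<beta>. a (h \<beta>)"] conjI) simp_all
  qed
  have ind: "\<forall>\<beta>\<in>T. a \<beta> = 0" if T: "T \<subseteq> set bs" "(\<Sum>\<beta>\<in>T. a \<beta> *s \<beta>) = 0" for T a
  proof
    fix \<beta> assume \<beta>: "\<beta> \<in> T"
    then have "\<beta> \<in> set bs" using T(1) by blast
    then obtain r where r: "r < length bs" "\<beta> = bs ! r" by (auto simp: in_set_conv_nth)
    have 0: "(\<Sum>s<length ps. (if bs ! s \<in> T then a (bs ! s) else 0) *s bs ! s) = 0"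
      using T(2) unfolding list_sum[OF dist T(1)] len .
    have "(if bs ! r \<in> T then a (bs ! r) else 0) = 0"
      by (rule coef_mat_independent[OF len nz 0]) (use r len in simp)
    then show "a \<beta> = 0" using r(2) \<beta> by simp
  qed
  show ?thesis unfolding free_basis_def
  proof (intro conjI)
    show "set bs \<subseteq> invariants G k" by (rule bs)
    show "\<forall>\<eta>\<in>invariants G k. \<exists>T c. finite T \<and> T \<subseteq> set bs \<and> (\<forall>\<beta>\<in>T. c \<beta> \<in> invariant_ring G) \<and> \<eta> = (\<Sum>\<beta>\<in>T. c \<beta> *s \<beta>)"
      by (intro ballI rep)
    show "\<forall>T c. finite T \<and> T \<subseteq> set bs \<and> (\<forall>\<beta>\<in>T. c \<beta> \<in> invariant_ring G) \<and> (\<Sum>\<beta>\<in>T. c \<beta> *s \<beta>) = 0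
        \<longrightarrow> (\<forall>\<beta>\<in>T. c \<beta> = 0)"
      by (intro allI impI) (elim conjE, rule ind)
  qed
qed

text \<open>For the trivial subgroup any polynomial may serve as \<open>f g\<close>. A variable
  moved by \<open>g\<close> makes the correction factor of \<open>g\<close> a nonzero linear
  form.\<close>

lemma det_dvd_power:
  assumes len: "length bs = length ps" and span: "\<And>\<eta>. \<eta> \<in> invariants G k \<Longrightarrow> \<eta> \<in> S_span bs"
  shows "\<exists>A m. finite A \<and> (\<forall>g\<in>A. m g \<noteq> 0) \<and>
    Determinant.det (coef_mat bs ps) dvd (\<Prod>g\<in>(A :: ('a, 'n) sqmat set). lin_form (m g)) ^ length ps"
proof -
  let ?one = "Finite_Cartesian_Product.mat 1 :: ('a, 'n) sqmat"
  interpret I: matrix_subgroup G "{?one}" by (rule trivial_subgroup[OF G finG])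
  have "\<exists>i. dual_act g (axis i 1) \<noteq> axis i 1" if g: "g \<in> G - {?one}" for g
  proof (rule ccontr)
    assume no: "\<not> ?thesis"
    have gi: "invertible g" using g subgroup_GL_D(1)[OF G] by blast
    have "g *v v = v" for v by (rule fixing_kernelI[OF gi]) (use no in \<open>simp add: scalar_product_def\<close>)
    then have "g = ?one" by (intro matrix_eq_iff_axis) simp
    then show False using g by simp
  qed
  then have "\<forall>g. \<exists>i. g \<in> G - {?one} \<longrightarrow> dual_act g (axis i 1) \<noteq> axis i 1" by blast
  then obtain i where i: "\<forall>g. g \<in> G - {?one} \<longrightarrow> dual_act g (axis (i g) 1) \<noteq> axis (i g) 1"
    by (rule choice[THEN exE])
  let ?m = "\<lambda>g. axis (i g) 1 - dual_act g (axis (i g) 1)"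
  have "\<exists>A\<subseteq>G - {?one}. \<forall>\<omega>\<in>invars {?one} k. (\<Prod>g\<in>A. var (i g) - pol_act g (var (i g))) *s \<omega> \<in> S_span bs"
  proof (rule I.scaled_span)
    show "pol_act h (var (i g)) = var (i g)" if "h \<in> {?one}" for g h using that by simp
  qed (rule span)
  then obtain A where A: "A \<subseteq> G - {?one}"
    and sp: "\<forall>\<omega>\<in>invars {?one} k. (\<Prod>g\<in>A. var (i g) - pol_act g (var (i g))) *s \<omega> \<in> S_span bs"
    by (elim exE conjE) (rule that)
  have m: "(\<Prod>g\<in>A. var (i g) - pol_act g (var (i g))) = (\<Prod>g\<in>A. lin_form (?m g))"
    by (simp add: lin_form_diff pol_act_var)
  let ?xs = "map (\<lambda>p. axis p 1 :: ('a, 'n) sext) ps"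
  have "Determinant.det (coef_mat bs ps) dvd (\<Prod>g\<in>A. lin_form (?m g)) ^ length ps * Determinant.det (coef_mat ?xs ps)"
  proof (rule det_coef_mat_dvd_scaled)
    show "(\<Prod>g\<in>A. lin_form (?m g)) *s x \<in> S_span bs" if "x \<in> set ?xs" for x
    proof -
      have "x \<in> S_ext_V k" using that std_basis(2)[OF ps] by blast
      then have "x \<in> invars {?one} k" by (simp add: invars_def sext_act_1)
      then show ?thesis using sp unfolding m by blast
    qed
  qed (simp_all add: len)
  then have "Determinant.det (coef_mat bs ps) dvd (\<Prod>g\<in>A. lin_form (?m g)) ^ length ps"
    unfolding std_basis(1)[OF ps] by simp
  moreover have "finite A" using A finG by (meson finite_Diff finite_subset)
  moreover have "\<forall>g\<in>A. ?m g \<noteq> 0" using A i by auto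
  ultimately show ?thesis by (intro exI[of _ A] exI[of _ ?m] conjI)
qed

text \<open>One factor too many of \<open>l\<close> would, after cancelling the local power, make
  \<open>l\<close> divide a unit times a power of the product of correction factors.\<close>

lemma lin_form_power_not_dvd:
  assumes len: "length bs = length ps" and span: "\<And>\<eta>. \<eta> \<in> invariants G k \<Longrightarrow> \<eta> \<in> S_span bs" and l: "l \<noteq> 0"
  shows "\<not> lin_form l ^ lexp G l k * lin_form l dvd Determinant.det (coef_mat bs ps)"
proof
  let ?I = "pointwise_stabilizer G (ker l)" and ?L = "lin_form l"
  assume dvd: "?L ^ lexp G l k * ?L dvd Determinant.det (coef_mat bs ps)"
  interpret I: matrix_subgroup G ?I by (rule pointwise_stabilizer_subgroup[OF G finG])
  have pl: "prime_elem ?L" by (rule prime_elem_lin_form[OF l])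
  have "\<forall>g. \<exists>f. g \<in> G - ?I \<longrightarrow> (\<forall>h\<in>?I. pol_act h f = f) \<and> \<not> ?L dvd f - pol_act g f"
    using separating_pol[OF G finG l] by blast
  then obtain f where f: "\<forall>g. g \<in> G - ?I \<longrightarrow> (\<forall>h\<in>?I. pol_act h (f g) = f g) \<and> \<not> ?L dvd f g - pol_act g (f g)"
    by (rule choice[THEN exE])
  have "\<exists>A\<subseteq>G - ?I. \<forall>\<omega>\<in>invars ?I k. (\<Prod>g\<in>A. f g - pol_act g (f g)) *s \<omega> \<in> S_span bs"
  proof (rule I.scaled_span)
    show "pol_act h (f g) = f g" if "g \<in> G - ?I" "h \<in> ?I" for g h using f that by blast
  qed (rule span)
  then obtain A where A: "A \<subseteq> G - ?I" "\<forall>\<omega>\<in>invars ?I k. (\<Prod>g\<in>A. f g - pol_act g (f g)) *s \<omega> \<in> S_span bs"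
    by (elim exE conjE) (rule that)
  let ?u = "\<Prod>g\<in>A. f g - pol_act g (f g)"
  have finA: "finite A" using A(1) finG by (meson finite_Diff finite_subset)
  \<comment> \<open>Each factor comes from a polynomial that separates \<open>g\<close> from the
    stabilizer modulo \<open>l\<close>, and \<open>l\<close> is prime.\<close>
  have Lu: "\<not> ?L dvd ?u" using prime_elem_dvd_prodD[OF pl finA] A(1) f by blast
  obtain xs c where xs: "length xs = length ps" "set xs \<subseteq> invars ?I k" and c: "c \<noteq> 0"
    "Determinant.det (coef_mat xs ps) = const c * ?L ^ lexp G l k"
    using local_basis[OF G finG l ps] by (elim exE conjE) (rule that)
  have "Determinant.det (coef_mat bs ps) dvd ?u ^ length ps * Determinant.det (coef_mat xs ps)"
    by (rule det_coef_mat_dvd_scaled[OF xs(1) len]) (use A(2) xs(2) in blast)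
  then have "?L ^ lexp G l k * ?L dvd ?u ^ length ps * (const c * ?L ^ lexp G l k)"
    unfolding c(2) by (rule dvd_trans[OF dvd])
  also have "?u ^ length ps * (const c * ?L ^ lexp G l k) = ?L ^ lexp G l k * (?u ^ length ps * const c)"
    by (simp only: mult.commute mult.left_commute mult.assoc)
  finally have "?L ^ lexp G l k = 0 \<or> ?L dvd ?u ^ length ps * const c" by (simp only: dvd_mult_cancel_left)
  moreover have "?L ^ lexp G l k \<noteq> 0" using l by simp
  ultimately have "?L dvd ?u ^ length ps * const c" by blast
  then have "?L dvd ?u ^ length ps \<or> ?L dvd const c" by (rule prime_elem_dvd_multD[OF pl])
  then show False
  proof
    assume "?L dvd ?u ^ length ps"
    then show False using prime_elem_dvd_power[OF pl] Lu by blast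
  next
    assume "?L dvd const c"
    then have "?L dvd 1" using const_unit[OF c(1)] by (rule dvd_trans)
    then show False using pl prime_elem_not_unit by blast
  qed
qed

text \<open>The cofactor of \<open>Disc\<close> divides a power of a product of linear forms. So it
  is a unit or has a linear factor, and the latter would exceed the local bound on
  multiplicities.\<close>

lemma free_imp_det:
  assumes len: "length bs = length ps" and dist: "distinct bs"
    and free: "free_basis (invariant_ring G) (invariants G k) (set bs)"
  shows "Determinant.det (coef_mat bs ps) \<doteq> Disc"
proof -
  let ?\<Delta> = "Determinant.det (coef_mat bs ps)"
  have bs: "set bs \<subseteq> invariants G k" using free by (simp add: free_basis_def)
  have span: "\<eta> \<in> S_span bs" if \<eta>: "\<eta> \<in> invariants G k" for \<eta>
  proof -
    note gen = free[unfolded free_basis_def, THEN conjunct2, THEN conjunct1, THEN bspec, OF \<eta>]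
    obtain T c where T: "T \<subseteq> set bs" and e: "\<eta> = (\<Sum>\<beta>\<in>T. c \<beta> *s \<beta>)"
      using gen by (elim exE conjE) (rule that)
    show ?thesis by (rule S_span_I) (rule e[unfolded list_sum[OF dist T]])
  qed
  have "\<exists>A m. finite A \<and> (\<forall>g\<in>A. m g \<noteq> 0) \<and>
      ?\<Delta> dvd (\<Prod>g\<in>(A :: ('a, 'n) sqmat set). lin_form (m g)) ^ length ps"
    by (rule det_dvd_power[OF len]) (rule span)
  then obtain A m where A: "finite A" "\<forall>g\<in>A. m g \<noteq> 0" "?\<Delta> dvd (\<Prod>g\<in>(A :: ('a, 'n) sqmat set). lin_form (m g)) ^ length ps"
    by (elim exE conjE) (rule that)
  obtain h where h: "?\<Delta> = Disc * h" using Disc_dvd[OF len bs] by (rule dvdE)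
  have "h dvd ?\<Delta>" unfolding h by (rule dvd_triv_right)
  then have "h dvd (\<Prod>g\<in>A. lin_form (m g)) ^ length ps" using A(3) by (rule dvd_trans)
  then have "h dvd 1 \<or> (\<exists>g\<in>A. lin_form (m g) dvd h)"
    by (rule prod_power_dvd_cases[OF A(1), rotated]) (use A(2) prime_elem_lin_form in blast)
  moreover have "\<not> lin_form (m g) dvd h" if g: "g \<in> A" for g
  proof
    assume dvd: "lin_form (m g) dvd h"
    have mg: "m g \<noteq> 0" using A(2) g by blast
    \<comment> \<open>On the arrangement the form is replaced by the proportional
      \<open>ell\<close>, whose local power is a factor of \<open>Disc\<close>; off the arrangement
      the local power is 1.\<close>
    have "\<exists>l. l \<noteq> 0 \<and> lin_form l dvd h \<and> lin_form l ^ lexp G l k dvd Disc"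
    proof (cases "ker (m g) \<in> arr")
      case True
      let ?l = "ell (ker (m g))"
      have l: "ker ?l = ker (m g)" by (rule ell[OF True])
      then have "\<exists>c. m g = c *s ?l" by (intro vanishing_on_kernel[OF ell_nz[OF True]]) blast
      then obtain c where "m g = c *s ?l" by blast
      then have "lin_form (m g) = lin_form (c *s ?l)" by (rule arg_cong)
      also have "\<dots> = const c * lin_form ?l" by (rule lin_form_scale)
      finally have eq: "lin_form (m g) = const c * lin_form ?l" .
      have "lin_form ?l dvd lin_form (m g)" by (subst eq) (rule dvd_triv_right)
      then have "lin_form ?l dvd h" using dvd by (rule dvd_trans)
      moreover have "lexp G ?l k = hexp G ?l (ker (m g)) k" unfolding lexp_def l using True by simp
      then have "lin_form ?l ^ lexp G ?l k dvd Disc"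
        unfolding Disc_def by (simp only:) (rule dvd_prodI[OF finite_arr True])
      ultimately show ?thesis using ell_nz[OF True] by blast
    next
      case False
      then have "lexp G (m g) k = 0" by (simp add: lexp_def)
      then show ?thesis using mg dvd by (intro exI[of _ "m g"]) simp
    qed
    then obtain l where l: "l \<noteq> 0" "lin_form l dvd h" "lin_form l ^ lexp G l k dvd Disc" by blast
    have "lin_form l ^ lexp G l k * lin_form l dvd ?\<Delta>" unfolding h by (rule mult_dvd_mono[OF l(3,2)])
    then show False using lin_form_power_not_dvd[OF len span l(1)] by blast
  qed
  ultimately have "h dvd 1" by blast
  then obtain c where "c \<noteq> 0" "h = const c" using unit_pol_const by blast
  then show ?thesis unfolding eq_upto_unit_def h by (intro exI[of _ c]) (simp add: mult.commute)
qed

text \<open>The determinant is homogeneous of degree the sum of the row degrees, and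
  \<open>Disc\<close> divides it in any case. If it is nonzero of the same degree as
  \<open>Disc\<close>, the cofactor is constant; conversely the degree of a nonzero homogeneous
  polynomial is unique.\<close>

lemma det_iff_degree:
  assumes len: "length bs = length ps" and dist: "distinct bs" and bs: "set bs \<subseteq> invariants G k"
    and hom: "\<And>\<eta>. \<eta> \<in> set bs \<Longrightarrow> \<exists>d. homogeneous d \<eta>"
  shows "Determinant.det (coef_mat bs ps) \<doteq> Disc \<longleftrightarrow>
    vec.independent (to_fract_vec ` set bs) \<and> (\<Sum>\<eta>\<in>set bs. pol_degree \<eta>) = (\<Sum>H\<in>arr. hexp G (ell H) H k)"
proof -
  let ?\<Delta> = "Determinant.det (coef_mat bs ps)" and ?N = "\<Sum>H\<in>arr. hexp G (ell H) H k"
  have bsS: "set bs \<subseteq> S_ext_V k" using bs by (auto simp: invariants_def)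
  note ind = independent_to_fract_iff[OF len dist ps(2) bsS]
  have "homogeneous (pol_degree (bs ! r)) (bs ! r)" if "r < length ps" for r
  proof -
    have "bs ! r \<in> set bs" using that len by simp
    then obtain d where "homogeneous d (bs ! r)" using hom by blast
    then show ?thesis by (rule homogeneous_pol_degree)
  qed
  then have "homogeneous_pol (\<Sum>r<length ps. pol_degree (bs ! r)) ?\<Delta>" by (rule homogeneous_det_coef_mat[OF len])
  moreover have "(\<Sum>r<length ps. pol_degree (bs ! r)) = (\<Sum>\<eta>\<in>set bs. pol_degree \<eta>)"
    unfolding len[symmetric] by (rule sum.reindex_bij_betw[OF bij_betw_nth[OF dist refl refl]])
  ultimately have hd: "homogeneous_pol (\<Sum>\<eta>\<in>set bs. pol_degree \<eta>) ?\<Delta>" by simp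
  show ?thesis unfolding ind
  proof
    assume "?\<Delta> \<doteq> Disc"
    then obtain c where c: "c \<noteq> 0" "?\<Delta> = const c * Disc" unfolding eq_upto_unit_def by blast
    then have nz: "?\<Delta> \<noteq> 0" using Disc_nz by simp
    have "homogeneous_pol (0 + ?N) ?\<Delta>" unfolding c(2) by (rule homogeneous_pol_mult[OF homogeneous_pol_const homogeneous_Disc])
    from homogeneous_pol_unique[OF hd this nz] have "(\<Sum>\<eta>\<in>set bs. pol_degree \<eta>) = 0 + ?N" .
    then show "?\<Delta> \<noteq> 0 \<and> (\<Sum>\<eta>\<in>set bs. pol_degree \<eta>) = ?N" using nz by simp
  next
    assume c: "?\<Delta> \<noteq> 0 \<and> (\<Sum>\<eta>\<in>set bs. pol_degree \<eta>) = ?N"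
    obtain h where h: "?\<Delta> = Disc * h" using Disc_dvd[OF len bs] by (rule dvdE)
    have x: "homogeneous_pol ?N (Disc * h)" and y: "Disc * h \<noteq> 0" using hd c unfolding h by simp_all
    obtain a where "a \<noteq> 0" "h = const a"
      using homogeneous_cofactor_const[OF homogeneous_Disc x y] by (elim exE conjE) (rule that)
    then show "?\<Delta> \<doteq> Disc" unfolding eq_upto_unit_def h by (intro exI[of _ a]) (simp add: mult.commute)
  qed
qed

end

section \<open>Equivalence of the basis, determinant and degree conditions\<close>

theorem theorem3p6:
  fixes G :: "('a::field, 'n::{finite, linorder}) sqmat set"
    and ell :: "('a, 'n) space set \<Rightarrow> ('a, 'n) space"
    and k :: nat
    and B :: "('a, 'n) sext set"
    and bs :: "('a, 'n) sext list"
    and ps :: "('n set \<times> 'n) list"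
  assumes "subgroup G GL" and "finite G"
    and "\<And>H. H \<in> reflection_arrangement G \<Longrightarrow> {v. scalar_product (ell H) v = 0} = H"
    and "k \<le> CARD('n)"
    and "finite B" and "card B = CARD('n) * (CARD('n) choose k)"
    and "B \<subseteq> invariants G k" and "\<And>\<eta>. \<eta> \<in> B \<Longrightarrow> \<exists>d. homogeneous d \<eta>"
    and "distinct bs" and "set bs = B"
    and "distinct ps" and "set ps = basis_index k"
  shows "(free_basis (invariant_ring G) (invariants G k) B
          \<longleftrightarrow> Determinant.det (coef_mat bs ps) \<doteq>
                Q G ell ^ binom (int CARD('n) - 1) (int k)
                * Q_det G ell ^ ((CARD('n) - 1) * binom (int CARD('n) - 1) (int k - 1))
                * Q_exp G ell k)
       \<and> (free_basis (invariant_ring G) (invariants G k) B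
          \<longleftrightarrow> vec.independent (to_fract_vec ` B)
              \<and> (\<Sum>\<eta>\<in>B. pol_degree \<eta>) =
                  (\<Sum>H\<in>reflection_arrangement G.
                     binom (int CARD('n) - 1) (int k)
                     + (e_diag G H - 1) * (CARD('n) - 1) * binom (int CARD('n) - 1) (int k - 1)
                     + e_diag G H * a_exp G (ell H) H k))"
proof -
  interpret reflection_data G ell k ps by (rule reflection_data.intro) (use assms in blast)+
  \<comment> \<open>The number of elements of \<open>B\<close> is the rank over \<open>S\<close>,
    which makes the coefficient matrix square.\<close>
  have "length ps = card (basis_index k :: ('n set \<times> 'n) set)" using distinct_card[OF assms(11)] unfolding assms(12) by simp
  also have "\<dots> = CARD('n) * (CARD('n) choose k)"
    using n_subsets[of "UNIV :: 'n set" k] by (simp add: basis_index_def card_cartesian_product mult.commute)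
  finally have len: "length bs = length ps" using distinct_card[OF assms(9)] unfolding assms(10) assms(6) by simp
  have bs: "set bs \<subseteq> invariants G k" unfolding assms(10) by (rule assms(7))
  have hom: "\<exists>d. homogeneous d \<eta>" if "\<eta> \<in> set bs" for \<eta> using that assms(8,10) by blast
  have ab: "free_basis (invariant_ring G) (invariants G k) B \<longleftrightarrow> Determinant.det (coef_mat bs ps) \<doteq> Disc"
  proof
    assume "free_basis (invariant_ring G) (invariants G k) B"
    then show "Determinant.det (coef_mat bs ps) \<doteq> Disc"
      unfolding assms(10)[symmetric] by (rule free_imp_det[OF len assms(9)])
  next
    assume "Determinant.det (coef_mat bs ps) \<doteq> Disc"
    then obtain c where "c \<noteq> 0" "Determinant.det (coef_mat bs ps) = const c * Disc"
      unfolding eq_upto_unit_def by blast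
    then show "free_basis (invariant_ring G) (invariants G k) B"
      unfolding assms(10)[symmetric] by (intro det_imp_free[OF len assms(9) bs])
  qed
  show ?thesis unfolding Disc_eq ab
    by (intro conjI refl) (rule det_iff_degree[OF len assms(9) bs hom, unfolded assms(10) hexp_def])
qed

end
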